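(* Let $t>1$ be a fixed integer and write $t=2^s\ell$ with integers $s,\ell\ge0$ and $\ell$ odd. Then for sufficiently large $n$, the sign of $p_t^e(n)-p_t^o(n)$ is periodic in $n$ with period $2^{s+1}$. In particular, when $t$ is odd the sign of $p_t^e(n)-p_t^o(n)$ is alternating for sufficiently large $n$.
   Context: For a partition $\lambda$, each cell of its Young diagram has a hook number: the number of cells directly to its right in its row plus the number of cells directly below it in its column, plus one for the cell itself. $\mathcal H_t(\lambda)$ is the multiset of hook numbers of $\lambda$ that are multiples of $t$. Define $p_t^e(n)=\#\{\lambda\vdash n:\#\mathcal H_t(\lambda)\equiv0\pmod 2\}$, $p_t^o(n)=\#\{\lambda\vdash n:\#\mathcal H_t(\lambda)\equiv1\pmod2\}$, where $\#\mathcal H_t(\lambda)$ is counted with multiplicity. *)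

theory Defs
  imports Complex_Main "HOL-Library.Multiset"
begin

text \<open>A partition is the weakly decreasing list of its (positive) parts.\<close>

definition partitions_of :: "nat \<Rightarrow> nat list set" where
  "partitions_of n = {xs. sorted_wrt (\<ge>) xs \<and> 0 \<notin> set xs \<and> sum_list xs = n}"

text \<open>
  Cells are pairs (row, column), both counted from \<open>0\<close>, with row \<open>i\<close> of length \<open>xs ! i\<close>
  and rows drawn from top to bottom.
\<close>

definition young_diagram :: "nat list \<Rightarrow> (nat \<times> nat) set" where
  "young_diagram xs = (SIGMA i:{..<length xs}. {..<xs ! i})"

definition arm_length :: "nat list \<Rightarrow> nat \<times> nat \<Rightarrow> nat" where
  "arm_length xs c = card {j. snd c < j \<and> (fst c, j) \<in> young_diagram xs}"

definition leg_length :: "nat list \<Rightarrow> nat \<times> nat \<Rightarrow> nat" where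
  "leg_length xs c = card {i. fst c < i \<and> (i, snd c) \<in> young_diagram xs}"

definition hook_number :: "nat list \<Rightarrow> nat \<times> nat \<Rightarrow> nat" where
  "hook_number xs c = arm_length xs c + leg_length xs c + 1"

definition t_hooks :: "nat \<Rightarrow> nat list \<Rightarrow> nat multiset" where
  "t_hooks t xs =
     filter_mset (\<lambda>h. t dvd h) (image_mset (hook_number xs) (mset_set (young_diagram xs)))"

definition p_even :: "nat \<Rightarrow> nat \<Rightarrow> nat" where
  "p_even t n = card {xs \<in> partitions_of n. even (size (t_hooks t xs))}"

definition p_odd :: "nat \<Rightarrow> nat \<Rightarrow> nat" where
  "p_odd t n = card {xs \<in> partitions_of n. odd (size (t_hooks t xs))}"

text \<open>
  Finiteness of the sets under \<^const>\<open>mset_set\<close> and \<^const>\<open>card\<close>, which return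
  junk values on infinite sets.
\<close>

lemma finite_young_diagram: "finite (young_diagram xs)"
  by (simp add: young_diagram_def)

lemma finite_arm: "finite {j. snd c < j \<and> (fst c, j) \<in> young_diagram xs}"
  by (rule finite_subset[OF _ finite_imageI[OF finite_young_diagram, of snd xs]]) force

lemma finite_leg: "finite {i. fst c < i \<and> (i, snd c) \<in> young_diagram xs}"
  by (rule finite_subset[OF _ finite_imageI[OF finite_young_diagram, of fst xs]]) force

lemma length_le_sum_list: "0 \<notin> set xs \<Longrightarrow> length xs \<le> sum_list xs" for xs :: "nat list"
  by (induction xs) auto

lemma finite_partitions_of: "finite (partitions_of n)"
proof (rule finite_subset)
  show "partitions_of n \<subseteq> {xs. set xs \<subseteq> {..n} \<and> length xs \<le> n}"
    using length_le_sum_list member_le_sum_list by (fastforce simp: partitions_of_def)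
  show "finite {xs. set xs \<subseteq> {..n} \<and> length xs \<le> n}"
    by (rule finite_lists_length_le) simp
qed

end

theory Submission
  imports Defs
    "HOL-Computational_Algebra.Formal_Power_Series"
    "HOL-Complex_Analysis.Complex_Analysis"
    "HOL-Real_Asymp.Real_Asymp"
    "HOL-Library.Nat_Bijection"
    "HOL-Library.Real_Mod"
    "HOL-Number_Theory.Cong"
    "HOL-Probability.Distributions"
begin

text \<open>
  Encode partitions by their beta sets (bead positions). Hooks of length divisible by \<open>t\<close>
  correspond to pairs of a bead and a smaller gap in the same residue class mod \<open>t\<close>. At any
  bead set there are exactly \<open>m\<close> more addable than removable ribbons of length \<open>m\<close>; double
  counting ribbon moves gives a recursion for the number of partitions by size and number of such
  hooks, hence the generating function of the difference,
  \<open>E (q ^ t) ^ t / (E q * E (- (q ^ t)) ^ t)\<close> with \<open>E q = (q; q)\<^sub>\<infinity>\<close>.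

  The sign is then found by the circle method. Let \<open>k = 2 ^ (s + 1)\<close>. The pentagonal number theorem
  (proved by Shanks' finite identity) and theta inversion (proved by Polya's argument from the
  binomial theorem and roots of unity, then continued analytically) give the behaviour of \<open>E\<close> near
  \<open>k\<close>-th roots of unity. A compactness argument on the Lambert series shows that the primitive
  \<open>k\<close>-th roots of unity are exactly the points near which the generating function is largest.
  By Laplace's method, up to a positive factor the \<open>n\<close>-th coefficient is asymptotic to a constant
  times a sum over the primitive \<open>k\<close>-th roots of unity which depends only on \<open>n\<close> mod \<open>k\<close>. Evaluating the Gauss sums in it reduces the sum to a Ramanujan sum, which leaves
  two cosines that never cancel; so the sign is that of a nowhere vanishing \<open>k\<close>-periodic function.
\<close>

section \<open>Hooks and beta sets\<close>

text \<open>The radial growth rate explains \<open>k\<close>. Near a point of exact order d on the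
  circle, log (1 / E) grows like pi^2 / (6 d^2 z). In the quotient the exponent t cancels the t in
  \<open>q ^ t\<close>, so the rate at a root \<zeta> is that of \<zeta>, minus that of
  \<open>\<zeta> ^ t\<close>, plus that of \<open>- (\<zeta> ^ t)\<close>. Gaining from the last
  term requires an odd power of \<open>\<zeta> ^ t\<close> to be -1, which forces
  \<open>2 ^ (s + 1)\<close> to divide the order of \<zeta>. The optimum 3/4 + 1/k^2 (times pi^2 /
  6) is reached when \<open>\<zeta> ^ (2 ^ s) = - 1\<close>; then \<open>\<zeta> ^ t = - 1\<close>
  as well, since l is odd, and only the factor 1 / E q tells the dominant points apart.

  The classical transformation law would attach a Dedekind-sum phase to each of these points. No
  such phase is computed: the leading constant is kept as a finite Gauss-type sum, and only its
  squared modulus 12 k is found. As this is the same for all dominant points, the reciprocal of the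
  constant is its conjugate over 12 k, and the sum over the dominant points becomes linear in
  explicit exponentials.\<close>

definition t_weight :: "nat \<Rightarrow> nat set \<Rightarrow> nat" where
  "t_weight t X = card {(b, g). b \<in> X \<and> g \<notin> X \<and> g < b \<and> t dvd b - g}"

text \<open>Length 0 beyond the last part lets padding by empty rows and conjugation go without case
  distinctions.\<close>

definition row_len :: "nat list \<Rightarrow> nat \<Rightarrow> nat" where
  "row_len xs i = (if i < length xs then xs ! i else 0)"

text \<open>Empty rows are appended until there are \<open>L\<close> rows; row \<open>0\<close> carries the largest bead.\<close>

definition bead :: "nat \<Rightarrow> nat list \<Rightarrow> nat \<Rightarrow> nat" where
  "bead L xs i = row_len xs i + (L - 1 - i)"

text \<open>For \<open>L = length xs\<close> these are the hook numbers of the first column. A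
  larger \<open>L\<close> shifts them up and fills the vacated bottom with beads.\<close>

definition beta_set :: "nat \<Rightarrow> nat list \<Rightarrow> nat set" where
  "beta_set L xs = bead L xs ` {..<L}"

definition col_len :: "nat list \<Rightarrow> nat \<Rightarrow> nat" where
  "col_len xs j = card {i. j < row_len xs i}"

lemma down_closed_eq_lessThan:
  fixes A :: "nat set"
  assumes "finite A" "\<And>i j. j \<in> A \<Longrightarrow> i \<le> j \<Longrightarrow> i \<in> A"
  shows "A = {..<card A}"
proof (cases "A = {}")
  case False
  have "A = {..Max A}" using assms False by (auto intro: Max_ge Max_in)
  then have "card A = Suc (Max A)" by (metis card_atMost)
  with \<open>A = {..Max A}\<close> show ?thesis by (simp add: lessThan_Suc_atMost)
qed auto

lemma row_len_antimono:
  assumes "sorted_wrt (\<ge>) xs" "i \<le> j" shows "row_len xs j \<le> row_len xs i"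
  using assms by (cases "i = j") (auto simp: row_len_def sorted_wrt_iff_nth_less)

lemma finite_row_len_gt: "finite {i. (j::nat) < row_len xs i}"
  by (rule finite_subset[of _ "{..<length xs}"]) (auto simp: row_len_def split: if_splits)

text \<open>Conjugation as a Galois connection: in a weakly decreasing list the rows that reach
  column \<open>j\<close> form an initial segment, so their number decides which rows they
  are.\<close>

lemma less_row_len_iff:
  assumes "sorted_wrt (\<ge>) xs" shows "j < row_len xs i \<longleftrightarrow> i < col_len xs j"
proof -
  have "{i. j < row_len xs i} = {..<card {i. j < row_len xs i}}"
    by (rule down_closed_eq_lessThan[OF finite_row_len_gt])
      (use row_len_antimono[OF assms] in \<open>force intro: less_le_trans\<close>)
  then show ?thesis unfolding col_len_def by blast
qed

lemma col_len_le_length: "col_len xs j \<le> length xs"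
proof -
  have "{i. j < row_len xs i} \<subseteq> {..<length xs}" by (auto simp: row_len_def split: if_splits)
  then show ?thesis unfolding col_len_def by (metis card_lessThan card_mono finite_lessThan)
qed

lemma young_diagram_iff: "(i, j) \<in> young_diagram xs \<longleftrightarrow> j < row_len xs i"
  by (auto simp: young_diagram_def row_len_def)

lemma bead_strict_antimono:
  assumes "sorted_wrt (\<ge>) xs" "i < j" "j < L" shows "bead L xs j < bead L xs i"
  using row_len_antimono[OF assms(1), of i j] assms(2,3) by (auto simp: bead_def)

lemma inj_on_bead:
  assumes "sorted_wrt (\<ge>) xs" shows "inj_on (bead L xs) {..<L}"
  by (rule linorder_inj_onI) (use bead_strict_antimono[OF assms] in \<open>fastforce+\<close>)

lemma card_beta_set: "sorted_wrt (\<ge>) xs \<Longrightarrow> card (beta_set L xs) = L"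
  unfolding beta_set_def by (simp add: card_image inj_on_bead)

text \<open>Walk along the lower right boundary of the padded diagram, starting at the bottom left:
  vertical steps are beads, horizontal steps are gaps. The step under column \<open>j\<close> comes
  after \<open>j\<close> horizontal and \<open>L - col_len xs j\<close> vertical ones.\<close>

definition gap :: "nat \<Rightarrow> nat list \<Rightarrow> nat \<Rightarrow> nat" where
  "gap L xs j = j + L - col_len xs j"

lemma col_len_antimono:
  assumes "i \<le> j" shows "col_len xs j \<le> col_len xs i"
  unfolding col_len_def by (rule card_mono[OF finite_row_len_gt]) (use assms in auto)

lemma gap_strict_mono:
  assumes "length xs \<le> L" "i < j" shows "gap L xs i < gap L xs j"
  using col_len_antimono[of i j xs] col_len_le_length[of xs i] assms by (auto simp: gap_def)

lemma gap_notin_beta_set: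
  assumes "sorted_wrt (\<ge>) xs" "length xs \<le> L" shows "gap L xs j \<notin> beta_set L xs"
proof
  assume "gap L xs j \<in> beta_set L xs"
  then obtain i where i: "i < L" "gap L xs j = bead L xs i" by (auto simp: beta_set_def)
  show False
  proof (cases "i < col_len xs j")
    case True
    then have "j < row_len xs i" using less_row_len_iff[OF assms(1)] by simp
    then show False using True i col_len_le_length[of xs j] assms(2) by (auto simp: gap_def bead_def)
  next
    case False
    then have "row_len xs i \<le> j" using less_row_len_iff[OF assms(1)] by (meson not_le)
    then show False using False i col_len_le_length[of xs j] assms(2) by (auto simp: gap_def bead_def)
  qed
qed

text \<open>The padding cancels in the difference of the two positions, so what remains is arm plus
  leg plus one.\<close>

lemma hook_number_eq:
  assumes "sorted_wrt (\<ge>) xs" "length xs \<le> L" "(i, j) \<in> young_diagram xs"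
  shows "gap L xs j < bead L xs i" "hook_number xs (i, j) = bead L xs i - gap L xs j"
proof -
  have ij: "j < row_len xs i" "i < col_len xs j"
    using assms less_row_len_iff[OF assms(1)] by (auto simp: young_diagram_iff)
  have "{j'. j < j' \<and> (i, j') \<in> young_diagram xs} = {j<..<row_len xs i}"
    by (auto simp: young_diagram_iff)
  then have arm: "arm_length xs (i, j) = row_len xs i - j - 1" by (simp add: arm_length_def)
  have "{i'. i < i' \<and> (i', j) \<in> young_diagram xs} = {i<..<col_len xs j}"
    by (auto simp: young_diagram_iff less_row_len_iff[OF assms(1)])
  then have leg: "leg_length xs (i, j) = col_len xs j - i - 1" by (simp add: leg_length_def)
  show "gap L xs j < bead L xs i" "hook_number xs (i, j) = bead L xs i - gap L xs j"
    using ij arm leg col_len_le_length[of xs j] assms(2)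
    by (auto simp: gap_def bead_def hook_number_def)
qed

lemma beads_below:
  assumes "sorted_wrt (\<ge>) xs" "i < L"
  shows "card {b \<in> beta_set L xs. b < bead L xs i} = L - 1 - i"
proof -
  have "{b \<in> beta_set L xs. b < bead L xs i} = bead L xs ` {i<..<L}"
  proof (intro set_eqI iffI)
    fix b assume "b \<in> {b \<in> beta_set L xs. b < bead L xs i}"
    then obtain j where j: "j < L" "b = bead L xs j" "bead L xs j < bead L xs i"
      by (auto simp: beta_set_def)
    then have "i < j" using bead_strict_antimono[OF assms(1), of j i L] assms(2)
      by (metis less_asym linorder_neqE_nat)
    then show "b \<in> bead L xs ` {i<..<L}" using j by auto
  next
    fix b assume "b \<in> bead L xs ` {i<..<L}"
    then obtain j where "i < j" "j < L" "b = bead L xs j" by auto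
    then show "b \<in> {b \<in> beta_set L xs. b < bead L xs i}"
      using bead_strict_antimono[OF assms(1), of i j L] by (auto simp: beta_set_def)
  qed
  moreover have "inj_on (bead L xs) {i<..<L}" 
    by (rule inj_on_subset[OF inj_on_bead[OF assms(1)]]) auto
  ultimately show ?thesis by (simp add: card_image)
qed

text \<open>Inclusion plus counting: below bead \<open>i\<close> lie \<open>L - 1 - i\<close> beads,
  which leaves exactly \<open>row_len xs i\<close> other positions, as many as the distinct gaps on
  the left.\<close>

lemma gaps_below_bead:
  assumes "sorted_wrt (\<ge>) xs" "length xs \<le> L" "i < L"
  shows "gap L xs ` {..<row_len xs i} = {g. g \<notin> beta_set L xs \<and> g < bead L xs i}"
proof (rule card_subset_eq)
  show "finite {g. g \<notin> beta_set L xs \<and> g < bead L xs i}" by simp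
  show "gap L xs ` {..<row_len xs i} \<subseteq> {g. g \<notin> beta_set L xs \<and> g < bead L xs i}"
    using gap_notin_beta_set[OF assms(1,2)] hook_number_eq(1)[OF assms(1,2)]
    by (auto simp: young_diagram_iff)
  have "inj_on (gap L xs) {..<row_len xs i}"
    by (rule linorder_inj_onI) (use gap_strict_mono[OF assms(2)] in \<open>fastforce+\<close>)
  then have "card (gap L xs ` {..<row_len xs i}) = row_len xs i" by (simp add: card_image)
  moreover have eq: "{g. g \<notin> beta_set L xs \<and> g < bead L xs i} =
      {..<bead L xs i} - {b \<in> beta_set L xs. b < bead L xs i}" by auto
  have "card {g. g \<notin> beta_set L xs \<and> g < bead L xs i} = bead L xs i - (L - 1 - i)"
    unfolding eq using beads_below[OF assms(1,3)]
    by (subst card_Diff_subset) auto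
  ultimately show "card (gap L xs ` {..<row_len xs i}) =
      card {g. g \<notin> beta_set L xs \<and> g < bead L xs i}" by (simp add: bead_def)
qed

lemma bij_betw_hooks:
  assumes "sorted_wrt (\<ge>) xs" "length xs \<le> L"
  shows "bij_betw (\<lambda>(i, j). (bead L xs i, gap L xs j)) (young_diagram xs)
           {(b, g). b \<in> beta_set L xs \<and> g \<notin> beta_set L xs \<and> g < b}"
  unfolding bij_betw_def
proof
  have len: "i < L" if "(i, j) \<in> young_diagram xs" for i j
    using that assms(2) by (auto simp: young_diagram_def)
  show "inj_on (\<lambda>(i, j). (bead L xs i, gap L xs j)) (young_diagram xs)"
  proof (rule inj_onI, clarify)
    fix i j i' j' assume A: "(i, j) \<in> young_diagram xs" "(i', j') \<in> young_diagram xs"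
      "bead L xs i = bead L xs i'" "gap L xs j = gap L xs j'"
    have "i = i'" 
      using inj_onD[OF inj_on_bead[OF assms(1)] A(3)] len[OF A(1)] len[OF A(2)] by simp
    moreover have "j = j'" using A(4) gap_strict_mono[OF assms(2)]
      by (metis less_irrefl linorder_neqE_nat)
    ultimately show "i = i' \<and> j = j'" by simp
  qed
  show "(\<lambda>(i, j). (bead L xs i, gap L xs j)) ` young_diagram xs =
           {(b, g). b \<in> beta_set L xs \<and> g \<notin> beta_set L xs \<and> g < b}"
  proof (intro set_eqI iffI)
    fix p assume "p \<in> (\<lambda>(i, j). (bead L xs i, gap L xs j)) ` young_diagram xs"
    then show "p \<in> {(b, g). b \<in> beta_set L xs \<and> g \<notin> beta_set L xs \<and> g < b}"
      using len gap_notin_beta_set[OF assms] hook_number_eq(1)[OF assms] by (auto simp: beta_set_def)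
  next
    fix p assume "p \<in> {(b, g). b \<in> beta_set L xs \<and> g \<notin> beta_set L xs \<and> g < b}"
    then obtain b g where p: "p = (b, g)" "b \<in> beta_set L xs" "g \<notin> beta_set L xs" "g < b" by auto
    then obtain i where i: "i < L" "b = bead L xs i" by (auto simp: beta_set_def)
    then have "g \<in> gap L xs ` {..<row_len xs i}" using gaps_below_bead[OF assms i(1)] p by simp
    then obtain j where "j < row_len xs i" "g = gap L xs j" by auto
    then have "(i, j) \<in> young_diagram xs" "p = (\<lambda>(i, j). (bead L xs i, gap L xs j)) (i, j)"
      using p i by (auto simp: young_diagram_iff)
    then show "p \<in> (\<lambda>(i, j). (bead L xs i, gap L xs j)) ` young_diagram xs" by blast
  qed
qed

lemma size_t_hooks:
  assumes "sorted_wrt (\<ge>) xs" "length xs \<le> L"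
  shows "size (t_hooks t xs) = t_weight t (beta_set L xs)"
proof -
  let ?f = "\<lambda>(i, j). (bead L xs i, gap L xs j)"
  have "size (t_hooks t xs) = card {c \<in> young_diagram xs. t dvd hook_number xs c}"
    by (simp add: t_hooks_def filter_mset_image_mset finite_young_diagram)
  also have "\<dots> = card {(b, g). b \<in> beta_set L xs \<and> g \<notin> beta_set L xs \<and> g < b \<and> t dvd b - g}"
  proof (rule bij_betw_same_card[of ?f])
    have "bij_betw ?f {c \<in> young_diagram xs. t dvd hook_number xs c}
       (?f ` {c \<in> young_diagram xs. t dvd hook_number xs c})"
      using bij_betw_hooks[OF assms] by (auto simp: bij_betw_def intro: inj_on_subset)
    moreover have "?f ` {c \<in> young_diagram xs. t dvd hook_number xs c} =
       {(b, g). b \<in> beta_set L xs \<and> g \<notin> beta_set L xs \<and> g < b \<and> t dvd b - g}" (is "?A = ?B")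
    proof -
      have im: "?f ` young_diagram xs = {(b, g). b \<in> beta_set L xs \<and> g \<notin> beta_set L xs \<and> g < b}"
        using bij_betw_hooks[OF assms] by (simp add: bij_betw_def)
      have h: "t dvd hook_number xs c \<longleftrightarrow> t dvd fst (?f c) - snd (?f c)" if "c \<in> young_diagram xs" for c
        using hook_number_eq(2)[OF assms, of "fst c" "snd c"] that by (auto simp: case_prod_beta)
      have "?A = {p \<in> ?f ` young_diagram xs. t dvd fst p - snd p}" using h by blast
      also have "\<dots> = ?B" unfolding im by auto
      finally show ?thesis .
    qed
    ultimately show "bij_betw ?f {c \<in> young_diagram xs. t dvd hook_number xs c}
      {(b, g). b \<in> beta_set L xs \<and> g \<notin> beta_set L xs \<and> g < b \<and> t dvd b - g}" by simp
  qed
  finally show ?thesis by (simp add: t_weight_def)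
qed

text \<open>\<open>\<Sum>{..<L}\<close> is the total for the empty partition, so \<open>n\<close> is
  the total displacement of the beads.\<close>

definition beta_sets :: "nat \<Rightarrow> nat \<Rightarrow> nat set set" where
  "beta_sets L n = {X. finite X \<and> card X = L \<and> \<Sum>X = n + \<Sum>{..<L}}"

lemma sum_row_len:
  assumes "length xs \<le> L" shows "(\<Sum>i<L. row_len xs i) = sum_list xs"
proof -
  have "(\<Sum>i<L. row_len xs i) = (\<Sum>i<length xs. row_len xs i)"
    by (rule sum.mono_neutral_right) (use assms in \<open>auto simp: row_len_def\<close>)
  also have "\<dots> = sum_list xs" by (simp add: sum_list_sum_nth row_len_def atLeast0LessThan)
  finally show ?thesis .
qed

lemma beta_set_in_beta_sets:
  assumes "xs \<in> partitions_of n" "n \<le> L"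
  shows "beta_set L xs \<in> beta_sets L n"
proof -
  have xs: "sorted_wrt (\<ge>) xs" "sum_list xs = n" "length xs \<le> L"
    using assms length_le_sum_list[of xs] by (auto simp: partitions_of_def)
  have "\<Sum>(beta_set L xs) = (\<Sum>i<L. bead L xs i)"
    unfolding beta_set_def using inj_on_bead[OF xs(1)] by (simp add: sum.reindex)
  also have "\<dots> = n + (\<Sum>i<L. L - 1 - i)"
    unfolding bead_def sum.distrib sum_row_len[OF xs(3)] xs(2) ..
  also have "(\<Sum>i<L. L - 1 - i) = \<Sum>{..<L}"
    using sum.nat_diff_reindex[of "\<lambda>i. i" L] by (simp add: diff_diff_eq)
  finally show ?thesis using card_beta_set[OF xs(1)] by (simp add: beta_sets_def beta_set_def)
qed

lemma sorted_wrt_ge_positive_eqI: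
  assumes "0 \<notin> set xs" "0 \<notin> set ys" "\<And>i. row_len xs i = row_len ys i"
  shows "xs = ys"
proof -
  have *: "length zs = card {i. 0 < row_len zs i}" if "0 \<notin> set zs" for zs
  proof -
    have "zs ! i \<noteq> 0" if "i < length zs" for i
      using that \<open>0 \<notin> set zs\<close> nth_mem[OF that] by metis
    then have "{i. 0 < row_len zs i} = {..<length zs}"
      by (auto simp: row_len_def)
    then show ?thesis by simp
  qed
  have "length xs = length ys" using *[OF assms(1)] *[OF assms(2)] assms(3) by simp
  moreover have "xs ! i = ys ! i" if "i < length xs" for i
    using assms(3)[of i] that \<open>length xs = length ys\<close> by (simp add: row_len_def)
  ultimately show ?thesis by (rule nth_equalityI)
qed

lemma inj_on_beta_set: "n \<le> L \<Longrightarrow> inj_on (beta_set L) (partitions_of n)"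
proof (rule inj_onI)
  fix xs ys assume n: "n \<le> L" and xs: "xs \<in> partitions_of n" and ys: "ys \<in> partitions_of n"
    and eq: "beta_set L xs = beta_set L ys"
  have s: "sorted_wrt (\<ge>) xs" "sorted_wrt (\<ge>) ys" "length xs \<le> L" "length ys \<le> L"
    using n xs ys length_le_sum_list[of xs] length_le_sum_list[of ys] by (auto simp: partitions_of_def)
  \<comment> \<open>The set alone determines bead \<open>i\<close>: it is the element with exactly
    \<open>L - 1 - i\<close> elements below it.\<close>
  have row: "bead L zs i = (THE b. b \<in> beta_set L zs \<and> card {b' \<in> beta_set L zs. b' < b} = L - 1 - i)"
    if "sorted_wrt (\<ge>) zs" "i < L" for zs i
  proof (rule the_equality[symmetric])
    show "bead L zs i \<in> beta_set L zs \<and> card {b' \<in> beta_set L zs. b' < bead L zs i} = L - 1 - i"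
      using beads_below[OF that] that by (auto simp: beta_set_def)
    fix b assume b: "b \<in> beta_set L zs \<and> card {b' \<in> beta_set L zs. b' < b} = L - 1 - i"
    then obtain k where "k < L" "b = bead L zs k" by (auto simp: beta_set_def)
    moreover from this have "L - 1 - k = L - 1 - i" using b beads_below[OF that(1), of k] by simp
    ultimately have "k = i" using that by linarith
    with \<open>b = bead L zs k\<close> show "b = bead L zs i" by simp
  qed
  have "row_len xs i = row_len ys i" for i
  proof (cases "i < L")
    case True
    then show ?thesis using row[OF s(1) True] row[OF s(2) True] eq by (simp add: bead_def)
  qed (use s in \<open>auto simp: row_len_def\<close>)
  then show "xs = ys" using xs ys by (intro sorted_wrt_ge_positive_eqI) (auto simp: partitions_of_def)
qed

lemma beta_set_surj:
  assumes "X \<in> beta_sets L n" "n \<le> L"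
  shows "\<exists>xs\<in>partitions_of n. beta_set L xs = X"
proof -
  have X: "finite X" "card X = L" "\<Sum>X = n + \<Sum>{..<L}" using assms by (auto simp: beta_sets_def)
  define ys where "ys = rev (sorted_list_of_set X)"
  have ys: "length ys = L" "set ys = X" "sorted_wrt (>) ys" "distinct ys"
    using X sorted_list_of_set(3)[of X] strict_sorted_list_of_set[of X] by (auto simp: ys_def sorted_wrt_rev)
  have step: "ys ! Suc i < ys ! i" if "Suc i < L" for i
    using ys that by (auto simp: sorted_wrt_iff_nth_less)
  have dec: "L - 1 - i \<le> ys ! i" if "i < L" for i
    using that
  proof (induction "L - 1 - i" arbitrary: i)
    case (Suc k)
    then have "Suc i < L" "k = L - 1 - Suc i" by auto
    then show ?case using Suc(1)[of "Suc i"] step[of i] by linarith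
  qed auto
  \<comment> \<open>Removal of the staircase. \<open>dec\<close> makes the truncated subtraction
    exact, and strict decrease of \<open>ys\<close> becomes weak decrease of
    \<open>z\<close>.\<close>
  define z where "z i = (if i < L then ys ! i - (L - 1 - i) else 0)" for i
  have zmono1: "z (Suc i) \<le> z i" for i
    using step[of i] dec[of "Suc i"] by (auto simp: z_def)
  have zmono: "i \<le> j \<Longrightarrow> z j \<le> z i" for i j
    using zmono1 by (rule lift_Suc_antimono_le)
  define m where "m = card {i. 0 < z i}"
  have fin: "finite {i. 0 < z i}" by (rule finite_subset[of _ "{..<L}"]) (auto simp: z_def split: if_splits)
  have "{i. 0 < z i} = {..<m}" unfolding m_def
    by (rule down_closed_eq_lessThan[OF fin]) (use zmono in \<open>force intro: less_le_trans\<close>)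
  then have m: "0 < z i \<longleftrightarrow> i < m" for i by blast
  have "\<not> L < m" using m[of L] by (simp add: z_def)
  then have mL: "m \<le> L" by simp
  define xs where "xs = map z [0..<m]"
  have row: "row_len xs i = z i" for i
    using m[of i] by (cases "i < m") (simp_all add: row_len_def xs_def)
  have srt: "sorted_wrt (\<ge>) xs" using zmono by (auto simp: xs_def sorted_wrt_iff_nth_less)
  have "z i \<noteq> 0" if "i < m" for i using m[of i] that by simp
  then have pos: "0 \<notin> set xs" by (auto simp: xs_def image_iff)
  have bd: "bead L xs i = ys ! i" if "i < L" for i using row[of i] dec[OF that] that by (simp add: bead_def z_def)
  then have "beta_set L xs = (!) ys ` {..<L}" unfolding beta_set_def by (intro image_cong) auto
  also have "\<dots> = set ys" using ys(1) by (metis atLeast0LessThan list.set_map map_nth set_upt)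
  finally have bs: "beta_set L xs = X" using ys by simp
  have len: "length xs \<le> L" using mL by (simp add: xs_def)
  have "\<Sum>(beta_set L xs) = (\<Sum>i<L. bead L xs i)"
    unfolding beta_set_def using inj_on_bead[OF srt] by (simp add: sum.reindex)
  also have "\<dots> = sum_list xs + (\<Sum>i<L. L - 1 - i)"
    unfolding bead_def sum.distrib sum_row_len[OF len] ..
  also have "(\<Sum>i<L. L - 1 - i) = \<Sum>{..<L}"
    using sum.nat_diff_reindex[of "\<lambda>i. i" L] by (simp add: diff_diff_eq)
  finally have "sum_list xs = n" using bs X by simp
  then show ?thesis using srt pos bs by (auto simp: partitions_of_def)
qed

lemma bij_betw_beta_set: "n \<le> L \<Longrightarrow> bij_betw (beta_set L) (partitions_of n) (beta_sets L n)"
  using inj_on_beta_set beta_set_in_beta_sets beta_set_surj by (auto simp: bij_betw_def) blast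

definition weight_count :: "nat \<Rightarrow> nat \<Rightarrow> nat \<Rightarrow> nat" where
  "weight_count t n w = card {xs \<in> partitions_of n. size (t_hooks t xs) = w}"

lemma weight_count_eq:
  assumes "n \<le> L"
  shows "weight_count t n w = card {X \<in> beta_sets L n. t_weight t X = w}"
  unfolding weight_count_def
proof (rule bij_betw_same_card)
  have *: "size (t_hooks t xs) = t_weight t (beta_set L xs)" if "xs \<in> partitions_of n" for xs
    using that assms length_le_sum_list[of xs]
    by (intro size_t_hooks) (auto simp: partitions_of_def)
  show "bij_betw (beta_set L) {xs \<in> partitions_of n. size (t_hooks t xs) = w}
          {X \<in> beta_sets L n. t_weight t X = w}"
    unfolding bij_betw_def
  proof
    show "inj_on (beta_set L) {xs \<in> partitions_of n. size (t_hooks t xs) = w}"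
      using inj_on_beta_set[OF assms] by (rule inj_on_subset) auto
    show "beta_set L ` {xs \<in> partitions_of n. size (t_hooks t xs) = w} =
            {X \<in> beta_sets L n. t_weight t X = w}"
      unfolding bij_betw_imp_surj_on[OF bij_betw_beta_set[OF assms], symmetric]
      using * by (auto simp: image_iff)
  qed
qed

section \<open>Ribbon moves\<close>

lemma sum_lessThan_card_le:
  fixes A :: "nat set"
  assumes "finite A" shows "\<Sum>{..<card A} \<le> \<Sum>A"
  using assms
proof (induction "card A" arbitrary: A)
  case (Suc n)
  have ne: "A \<noteq> {}" using Suc(2) by auto
  define m where "m = Max A"
  have m: "m \<in> A" using Suc(3) ne by (simp add: m_def)
  have "A \<subseteq> {..m}" using Suc(3) by (auto simp: m_def)
  then have "card A \<le> Suc m" by (metis card_atMost card_mono finite_atMost)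
  moreover have "n = card (A - {m})" using Suc(3) m unfolding card_Diff_singleton[OF m] Suc(2)[symmetric] by simp
  then have "\<Sum>{..<n} \<le> \<Sum>(A - {m})" using Suc(1)[of "A - {m}"] Suc(3) by blast
  moreover have "\<Sum>A = m + \<Sum>(A - {m})" using m Suc(3) by (simp add: sum.remove)
  ultimately show ?case unfolding Suc(2)[symmetric] sum.lessThan_Suc by linarith
qed simp

text \<open>If some \<open>g < m\<close> were missing, inserting it would give \<open>L + 1\<close>
  distinct naturals whose sum is below the minimum \<open>\<Sum>{..<Suc L}\<close>. With enough
  padding the bottom is therefore full.\<close>

lemma beta_sets_initial_segment:
  assumes "X \<in> beta_sets L n" "n + m \<le> L" shows "{..<m} \<subseteq> X"
proof
  fix g assume g: "g \<in> {..<m}"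
  show "g \<in> X"
  proof (rule ccontr)
    assume "g \<notin> X"
    then have "card (insert g X) = Suc L" "\<Sum>(insert g X) = g + \<Sum>X" "finite (insert g X)"
      using assms by (auto simp: beta_sets_def)
    then have "\<Sum>{..<Suc L} \<le> g + \<Sum>X" using sum_lessThan_card_le by metis
    then show False using assms g by (simp add: beta_sets_def)
  qed
qed

lemma finite_beta_sets: "finite (beta_sets L n)"
proof (rule finite_subset)
  show "beta_sets L n \<subseteq> Pow {..n + \<Sum>{..<L}}"
    by (auto simp: beta_sets_def) (metis member_le_sum zero_le)
qed simp

text \<open>Moving bead \<open>b\<close> down to the empty position \<open>b - m\<close> strips a
  border ribbon of \<open>m\<close> cells. The guard \<open>m \<le> b\<close> excludes truncated
  subtraction.\<close>

definition removable :: "nat \<Rightarrow> nat set \<Rightarrow> nat set" where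
  "removable m X = {b \<in> X. m \<le> b \<and> b - m \<notin> X}"

definition addable :: "nat \<Rightarrow> nat set \<Rightarrow> nat set" where
  "addable m X = {b \<in> X. b + m \<notin> X}"

text \<open>Beads with another bead \<open>m\<close> above them correspond, by the shift, to beads
  with another bead \<open>m\<close> below them. The beads left over are the addable ones in the
  first count; in the second they are the removable ones together with the \<open>m\<close> bottom
  beads.\<close>

lemma card_addable:
  assumes "finite X" "{..<m} \<subseteq> X"
  shows "card (addable m X) = card (removable m X) + m"
proof -
  let ?A = "{b \<in> X. b + m \<in> X}" and ?B = "{b \<in> X. m \<le> b \<and> b - m \<in> X}"
  have "X = addable m X \<union> ?A" "addable m X \<inter> ?A = {}" by (auto simp: addable_def)
  then have 1: "card X = card (addable m X) + card ?A"
    using assms(1) by (metis card_Un_disjoint finite_Un)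
  have "X = {..<m} \<union> (removable m X \<union> ?B)" using assms(2) by (auto simp: removable_def)
  moreover have "card ({..<m} \<union> (removable m X \<union> ?B)) = card {..<m} + (card (removable m X) + card ?B)"
    using assms(1) by (subst card_Un_disjoint, auto simp: removable_def)+
  ultimately have 2: "card X = m + (card (removable m X) + card ?B)" by simp
  have "card ?A = card ?B"
    by (rule bij_betw_same_card[of "\<lambda>b. b + m"], rule bij_betw_byWitness[of _ "\<lambda>b. b - m"]) auto
  with 1 2 show ?thesis by simp
qed

lemma card_multiples_below:
  fixes t b :: nat
  assumes "t > 0" shows "card {g. g < b \<and> t dvd b - g} = b div t"
proof -
  have "bij_betw (\<lambda>i. b - t * i) {1..b div t} {g. g < b \<and> t dvd b - g}"
  proof (rule bij_betw_byWitness[of _ "\<lambda>g. (b - g) div t"])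
    have le: "t * i \<le> b" if "i \<le> b div t" for i
      using that by (metis div_times_less_eq_dividend le_trans mult.commute mult_le_mono2)
    show "\<forall>a\<in>{1..b div t}. (b - (b - t * a)) div t = a" using le assms by auto
    show "\<forall>g\<in>{g. g < b \<and> t dvd b - g}. b - t * ((b - g) div t) = g" by auto
    show "(\<lambda>i. b - t * i) ` {1..b div t} \<subseteq> {g. g < b \<and> t dvd b - g}"
    proof clarify
      fix i assume i: "i \<in> {1..b div t}"
      then have "0 < t * i" "t * i \<le> b" using le assms by auto
      then show "b - t * i < b \<and> t dvd b - (b - t * i)" by (metis diff_diff_cancel diff_less dvd_triv_left less_le_trans)
    qed
    show "(\<lambda>g. (b - g) div t) ` {g. g < b \<and> t dvd b - g} \<subseteq> {1..b div t}"
      using assms by (auto simp: div_le_mono Suc_le_eq div_greater_zero_iff dvd_imp_le)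
  qed
  then show ?thesis by (metis bij_betw_same_card card_atLeastAtMost diff_Suc_1)
qed

section \<open>Effect of a bead move on the weight\<close>

definition congr_pairs :: "nat \<Rightarrow> nat set \<Rightarrow> nat" where
  "congr_pairs t X = card {(x, b) \<in> X \<times> X. x < b \<and> t dvd b - x}"

text \<open>Below a bead \<open>b\<close> there are \<open>b div t\<close> positions of its residue
  class, and each is either a gap or a bead. This trades the weight for a quantity additive over
  beads and a correction that depends on residues only.\<close>

lemma t_weight_add_congr_pairs:
  assumes "t > 0" "finite X"
  shows "t_weight t X + congr_pairs t X = (\<Sum>b\<in>X. b div t)"
proof -
  have eq: "{(b, g). b \<in> X \<and> g \<notin> X \<and> g < b \<and> t dvd b - g} \<union>
        (\<lambda>(x, b). (b, x)) ` {(x, b) \<in> X \<times> X. x < b \<and> t dvd b - x} = 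
        Sigma X (\<lambda>b. {g. g < b \<and> t dvd b - g})" (is "?A \<union> ?B = ?C")
    by auto
  have fin: "finite ?C" using assms(2) by (intro finite_SigmaI) auto
  have "card ?C = card ?A + card ?B"
    unfolding eq[symmetric] using fin by (intro card_Un_disjoint) (auto simp flip: eq)
  moreover have "card ?B = congr_pairs t X"
    unfolding congr_pairs_def by (intro card_image) (auto simp: inj_on_def)
  moreover have "card ?C = (\<Sum>b\<in>X. b div t)"
    using card_multiples_below[OF assms(1)] assms(2) by (subst card_SigmaI) auto
  ultimately show ?thesis by (simp add: t_weight_def)
qed

text \<open>Counting ordered pairs removes the comparison \<open>x < b\<close>, so the count visibly
  depends only on how many beads each residue class contains.\<close>

lemma congr_pairs_double:
  assumes "finite X"
  shows "2 * congr_pairs t X + card X = card {(x, y) \<in> X \<times> X. x mod t = y mod t}"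
proof -
  let ?A = "{(x, b) \<in> X \<times> X. x < b \<and> t dvd b - x}" 
  let ?B = "(\<lambda>(x, b). (b, x)) ` ?A" and ?C = "(\<lambda>x. (x, x)) ` X"
  have dvd: "t dvd b - x \<longleftrightarrow> x mod t = b mod t" if "x < b" for x b
    using that by (metis less_imp_le mod_eq_dvd_iff_nat)
  have fin: "finite ?A" by (rule finite_subset[of _ "X \<times> X"]) (use assms in auto)
  have split: "{(x, y) \<in> X \<times> X. x mod t = y mod t} = ?A \<union> (?B \<union> ?C)"
  proof (intro set_eqI iffI)
    fix p assume "p \<in> {(x, y) \<in> X \<times> X. x mod t = y mod t}"
    then obtain x y where p: "p = (x, y)" "x \<in> X" "y \<in> X" "x mod t = y mod t" by auto
    consider "x < y" | "x = y" | "y < x" by linarith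
    then show "p \<in> ?A \<union> (?B \<union> ?C)"
    proof cases
      case 1
      then have "t dvd y - x" using dvd[of x y] p(4) by blast
      then have "p \<in> ?A" using p 1 by blast
      then show ?thesis by blast
    next
      case 2
      then have "p \<in> ?C" using p by blast
      then show ?thesis by blast
    next
      case 3
      then have "t dvd x - y" using dvd[of y x] p(4) by metis
      then have "(y, x) \<in> ?A" using p 3 by blast
      then have "p \<in> ?B" using p(1) by (metis (no_types, lifting) case_prod_conv imageI)
      then show ?thesis by blast
    qed
  next
    fix p assume "p \<in> ?A \<union> (?B \<union> ?C)"
    then consider "p \<in> ?A" | "p \<in> ?B" | "p \<in> ?C" by blast
    then show "p \<in> {(x, y) \<in> X \<times> X. x mod t = y mod t}"
      using dvd by cases (fastforce dest: sym)+
  qed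
  have "card (?A \<union> (?B \<union> ?C)) = card ?A + card (?B \<union> ?C)"
    by (rule card_Un_disjoint) (use fin assms in auto)
  moreover have "card (?B \<union> ?C) = card ?B + card ?C"
    by (rule card_Un_disjoint) (use fin assms in auto)
  moreover have "card ?B = card ?A" by (intro card_image) (auto simp: inj_on_def)
  moreover have "card ?C = card X" by (intro card_image) (auto simp: inj_on_def)
  ultimately show ?thesis unfolding congr_pairs_def split by linarith
qed

text \<open>A shift by \<open>t * j\<close> keeps every residue, hence \<open>congr_pairs\<close>,
  and raises \<open>\<Sum>b\<in>X. b div t\<close> by \<open>j\<close>; the whole change therefore
  falls on the weight.\<close>

lemma move_bead:
  assumes "finite X" "c \<in> X" "c + t * j \<notin> X" "t > 0"
  defines "Y \<equiv> insert (c + t * j) (X - {c})"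
  shows "t_weight t Y = t_weight t X + j" "card Y = card X" "\<Sum>Y = \<Sum>X + t * j" "finite Y"
proof -
  show fin: "finite Y" using assms by simp
  have cX: "card X > 0" using assms by (auto simp: card_gt_0_iff)
  show cardY: "card Y = card X" using assms cX by simp
  have S: "\<Sum>X = c + \<Sum>(X - {c})" using assms by (simp add: sum.remove)
  then show "\<Sum>Y = \<Sum>X + t * j" using assms by simp
  define h where "h x = (if x = c then c + t * j else x)" for x
  have h: "bij_betw h X Y"
    unfolding h_def by (rule bij_betw_byWitness[of _ "\<lambda>y. if y = c + t * j then c else y"])
      (use assms in auto)
  have hm: "h x mod t = x mod t" for x by (simp add: h_def)
  have inj: "h x = h y \<longleftrightarrow> x = y" if "x \<in> X" "y \<in> X" for x y
    using h that by (auto simp: bij_betw_def inj_on_def)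
  have "bij_betw (map_prod h h) {(x, y) \<in> X \<times> X. x mod t = y mod t} {(x, y) \<in> Y \<times> Y. x mod t = y mod t}"
    unfolding bij_betw_def
  proof
    show "inj_on (map_prod h h) {(x, y) \<in> X \<times> X. x mod t = y mod t}"
      using inj by (auto simp: inj_on_def)
    have "Y = h ` X" using h by (simp add: bij_betw_def)
    then show "map_prod h h ` {(x, y) \<in> X \<times> X. x mod t = y mod t} = {(x, y) \<in> Y \<times> Y. x mod t = y mod t}"
      using hm by (force simp: image_iff)
  qed
  then have "congr_pairs t Y = congr_pairs t X"
    using congr_pairs_double[OF fin, of t] congr_pairs_double[OF assms(1), of t] cardY
      bij_betw_same_card by (smt (verit) add_right_cancel mult_cancel1 zero_neq_numeral)
  moreover have "(\<Sum>b\<in>Y. b div t) = (\<Sum>b\<in>X. b div t) + j"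
  proof -
    have "(\<Sum>b\<in>X. b div t) = c div t + (\<Sum>b\<in>X-{c}. b div t)" using assms by (simp add: sum.remove)
    then show ?thesis using assms by (simp add: Y_def)
  qed
  ultimately show "t_weight t Y = t_weight t X + j"
    using t_weight_add_congr_pairs[OF assms(4) fin] t_weight_add_congr_pairs[OF assms(4,1)] by simp
qed

definition weight_sets :: "nat \<Rightarrow> nat \<Rightarrow> nat \<Rightarrow> nat \<Rightarrow> nat set set" where
  "weight_sets t L n w = {X \<in> beta_sets L n. t_weight t X = w}"

lemma finite_weight_sets: "finite (weight_sets t L n w)"
  using finite_beta_sets by (simp add: weight_sets_def)

text \<open>The bounds on \<open>j\<close> hold because the new set still has \<open>L\<close>
  elements, so its sum cannot fall below \<open>\<Sum>{..<L}\<close>, and because its weight is a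
  natural number.\<close>

lemma remove_ribbon:
  assumes "t > 0" "X \<in> weight_sets t L n w" "b \<in> removable (t * j) X"
  defines "Y \<equiv> insert (b - t * j) (X - {b})"
  shows "t * j \<le> n" "j \<le> w" "Y \<in> weight_sets t L (n - t * j) (w - j)" "b - t * j \<in> addable (t * j) Y"
    "X = insert b (Y - {b - t * j})"
proof -
  have X: "finite X" "card X = L" "\<Sum>X = n + \<Sum>{..<L}" "t_weight t X = w"
    using assms(2) by (auto simp: weight_sets_def beta_sets_def)
  have b: "b \<in> X" "t * j \<le> b" "b - t * j \<notin> X" using assms(3) by (auto simp: removable_def)
  have fin: "finite Y" using X by (simp add: Y_def)
  have nb: "b - t * j + t * j = b" using b by simp
  have jpos: "t * j > 0" using b by (metis diff_zero gr0I)
  have bY: "b \<notin> Y" using jpos b by (auto simp: Y_def)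
  show X_eq: "X = insert b (Y - {b - t * j})" using b by (auto simp: Y_def)
  have "insert (b - t * j + t * j) (Y - {b - t * j}) = X" using X_eq nb by simp
  then have m: "t_weight t X = t_weight t Y + j" "card X = card Y" "\<Sum>X = \<Sum>Y + t * j"
    using move_bead[of Y "b - t * j" t j] fin bY nb assms(1) by (auto simp: Y_def)
  have "\<Sum>{..<L} \<le> \<Sum>Y" using sum_lessThan_card_le[OF fin] m(2) X by simp
  then show "t * j \<le> n" using m X by simp
  show "j \<le> w" using m X by simp
  show "Y \<in> weight_sets t L (n - t * j) (w - j)"
    using m X fin \<open>t * j \<le> n\<close> by (auto simp: weight_sets_def beta_sets_def)
  show "b - t * j \<in> addable (t * j) Y" using bY nb by (auto simp: addable_def Y_def)
qed

definition ribbon_count :: "nat \<Rightarrow> nat \<Rightarrow> nat \<Rightarrow> nat \<Rightarrow> nat \<Rightarrow> nat" where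
  "ribbon_count t L j n w = (\<Sum>X\<in>weight_sets t L n w. card (removable (t * j) X))"

text \<open>Double counting: a removal from size \<open>n\<close> is the inverse of an addition to
  size \<open>n - t * j\<close>. Replacing addable by removable beads via
  \<open>card_addable\<close> produces the extra \<open>t * j\<close> per set.\<close>

lemma ribbon_count_rec:
  assumes "t > 0" "n \<le> L"
  shows "ribbon_count t L j n w =
    (if t * j \<le> n \<and> j \<le> w then ribbon_count t L j (n - t * j) (w - j) +
        t * j * card (weight_sets t L (n - t * j) (w - j)) else 0)"
proof (cases "t * j \<le> n \<and> j \<le> w")
  case False
  then have "removable (t * j) X = {}" if "X \<in> weight_sets t L n w" for X
    using remove_ribbon(1,2)[OF assms(1) that] by blast
  then have "ribbon_count t L j n w = 0" by (simp add: ribbon_count_def)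
  with False show ?thesis by metis
next
  case True
  let ?m = "t * j"
  let ?S = "weight_sets t L n w" and ?T = "weight_sets t L (n - ?m) (w - j)"
  have fin: "finite X" if "X \<in> weight_sets t L n w" for X n w
    using that by (simp add: weight_sets_def beta_sets_def)
  have bij: "bij_betw (\<lambda>(X, b). (insert (b - ?m) (X - {b}), b - ?m))
      (Sigma ?S (removable ?m)) (Sigma ?T (addable ?m))"
  proof (rule bij_betw_byWitness[of _ "\<lambda>(Y, c). (insert (c + ?m) (Y - {c}), c + ?m)"])
    show "\<forall>p\<in>Sigma ?S (removable ?m). (case (case p of (X, b) \<Rightarrow> (insert (b - ?m) (X - {b}), b - ?m)) of
        (Y, c) \<Rightarrow> (insert (c + ?m) (Y - {c}), c + ?m)) = p"
      using remove_ribbon(5)[OF assms(1)] by (auto simp: removable_def)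
    show "\<forall>p\<in>Sigma ?T (addable ?m). (case (case p of (Y, c) \<Rightarrow> (insert (c + ?m) (Y - {c}), c + ?m)) of
        (X, b) \<Rightarrow> (insert (b - ?m) (X - {b}), b - ?m)) = p"
      by (auto simp: addable_def)
    show "(\<lambda>(X, b). (insert (b - ?m) (X - {b}), b - ?m)) ` Sigma ?S (removable ?m) \<subseteq> Sigma ?T (addable ?m)"
      using remove_ribbon(3,4)[OF assms(1)] by auto
    show "(\<lambda>(Y, c). (insert (c + ?m) (Y - {c}), c + ?m)) ` Sigma ?T (addable ?m) \<subseteq> Sigma ?S (removable ?m)"
    proof clarify
      fix Y c assume Y: "Y \<in> ?T" "c \<in> addable ?m Y"
      then have c: "c \<in> Y" "c + ?m \<notin> Y" by (auto simp: addable_def)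
      from Y have Y': "finite Y" "card Y = L" "\<Sum>Y = n - ?m + \<Sum>{..<L}" "t_weight t Y = w - j"
        by (auto simp: weight_sets_def beta_sets_def)
      have "insert (c + ?m) (Y - {c}) \<in> ?S"
        unfolding weight_sets_def beta_sets_def
        using move_bead[OF Y'(1) c assms(1)] Y' True by simp
      moreover have "c \<noteq> c + ?m" using c by metis
      ultimately show "insert (c + ?m) (Y - {c}) \<in> ?S \<and> c + ?m \<in> removable ?m (insert (c + ?m) (Y - {c}))"
        by (auto simp: removable_def)
    qed
  qed
  have "ribbon_count t L j n w = card (Sigma ?S (removable ?m))"
    unfolding ribbon_count_def using fin finite_weight_sets by (subst card_SigmaI) (auto simp: removable_def)
  also have "\<dots> = card (Sigma ?T (addable ?m))" by (rule bij_betw_same_card[OF bij])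
  also have "\<dots> = (\<Sum>Y\<in>?T. card (addable ?m Y))"
    using fin finite_weight_sets by (subst card_SigmaI) (auto simp: addable_def)
  also have "\<dots> = (\<Sum>Y\<in>?T. card (removable ?m Y) + ?m)"
  proof (rule sum.cong)
    fix Y assume Y: "Y \<in> ?T"
    \<comment> \<open>Here the size is \<open>n - t * j\<close>, so room for a ribbon of length
      \<open>t * j\<close> is exactly the assumption \<open>n \<le> L\<close>.\<close>
    have "{..<?m} \<subseteq> Y"
      by (rule beta_sets_initial_segment[of _ L "n - ?m"]) (use Y True assms in \<open>auto simp: weight_sets_def\<close>)
    then show "card (addable ?m Y) = card (removable ?m Y) + ?m" using card_addable fin[OF Y] by blast
  qed simp
  finally show ?thesis using True by (simp add: ribbon_count_def sum.distrib)
qed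

text \<open>The recursion unrolled: its i-th step contributes the term for \<open>d = i * j\<close>,
  which is why \<open>d\<close> runs over the multiples of \<open>j\<close>.\<close>

lemma ribbon_count_eq:
  assumes "t > 0" "n \<le> L" "j > 0"
  shows "ribbon_count t L j n w =
    (\<Sum>d | d \<in> {1..w} \<and> j dvd d \<and> t * d \<le> n. t * j * card (weight_sets t L (n - t * d) (w - d)))"
  using assms(2)
proof (induction n arbitrary: w rule: less_induct)
  case (less n)
  show ?case
  proof (cases "t * j \<le> n \<and> j \<le> w")
    case False
    have e: "{d. d \<in> {1..w} \<and> j dvd d \<and> t * d \<le> n} = {}"
    proof (rule ccontr)
      assume "{d. d \<in> {1..w} \<and> j dvd d \<and> t * d \<le> n} \<noteq> {}"
      then obtain d where "1 \<le> d" "d \<le> w" "j dvd d" "t * d \<le> n" by auto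
      moreover from this have "j \<le> d" by (simp add: dvd_imp_le)
      ultimately show False using False by (meson le_trans mult_le_mono2)
    qed
    have "ribbon_count t L j n w = 0"
      using ribbon_count_rec[OF assms(1) less.prems, of j w] False by metis
    then show ?thesis unfolding e by simp
  next
    case True
    let ?f = "\<lambda>d. t * j * card (weight_sets t L (n - t * d) (w - d))"
    let ?D = "\<lambda>n w. {d. d \<in> {1..w} \<and> j dvd d \<and> t * d \<le> n}"
    have D: "?D n w = insert j ((\<lambda>d. d + j) ` ?D (n - t * j) (w - j))"
    proof (intro set_eqI iffI)
      fix d assume d: "d \<in> ?D n w"
      then have "j \<le> d" by (auto simp: dvd_imp_le)
      show "d \<in> insert j ((\<lambda>d. d + j) ` ?D (n - t * j) (w - j))"
      proof (cases "d = j")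
        case False
        have "t * (d - j) \<le> n - t * j" using d by (simp add: diff_mult_distrib2 diff_le_mono)
        then have "d - j \<in> ?D (n - t * j) (w - j)" using d \<open>j \<le> d\<close> False by (auto simp: dvd_diff_nat)
        then show ?thesis using \<open>j \<le> d\<close> by (force simp: image_iff)
      qed simp
    next
      fix d assume "d \<in> insert j ((\<lambda>d. d + j) ` ?D (n - t * j) (w - j))"
      then show "d \<in> ?D n w" using True assms(3) by (auto simp: distrib_left)
    qed
    have "0 < t * j" using assms(1,3) by simp
    then have "n - t * j < n" using True by linarith
    then have "ribbon_count t L j (n - t * j) (w - j) =
        (\<Sum>d\<in>?D (n - t * j) (w - j). t * j * card (weight_sets t L (n - t * j - t * d) (w - j - d)))"
      using less.IH less.prems by simp
    also have "\<dots> = (\<Sum>d\<in>(\<lambda>d. d + j) ` ?D (n - t * j) (w - j). ?f d)"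
      by (subst sum.reindex) (auto simp: distrib_left add.commute)
    finally have r: "ribbon_count t L j n w = ?f j + (\<Sum>d\<in>(\<lambda>d. d + j) ` ?D (n - t * j) (w - j). ?f d)"
      using True ribbon_count_rec[OF assms(1) less.prems, of j w] by simp
    show ?thesis unfolding r D by (subst sum.insert) auto
  qed
qed

text \<open>A bead and a gap at distance \<open>t * j\<close> are the same thing as a removable
  ribbon of length \<open>t * j\<close>. Such a removal lowers the weight by \<open>j\<close>, so
  \<open>j \<le> w\<close> covers all of them.\<close>

lemma t_weight_eq_sum_removable:
  assumes "t > 0" "X \<in> weight_sets t L n w"
  shows "w = (\<Sum>j=1..w. card (removable (t * j) X))"
proof -
  have fin: "finite X" using assms by (simp add: weight_sets_def beta_sets_def)
  let ?P = "{(b, g). b \<in> X \<and> g \<notin> X \<and> g < b \<and> t dvd b - g}"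
  have "bij_betw (\<lambda>(j, b). (b, b - t * j)) (Sigma {1..w} (\<lambda>j. removable (t * j) X)) ?P"
  proof (rule bij_betw_byWitness[of _ "\<lambda>(b, g). ((b - g) div t, b)"])
    show "\<forall>p\<in>Sigma {1..w} (\<lambda>j. removable (t * j) X).
       (case (case p of (j, b) \<Rightarrow> (b, b - t * j)) of (b, g) \<Rightarrow> ((b - g) div t, b)) = p"
      using assms(1) by (auto simp: removable_def)
    show "\<forall>p\<in>?P. (case (case p of (b, g) \<Rightarrow> ((b - g) div t, b)) of (j, b) \<Rightarrow> (b, b - t * j)) = p"
      by auto
    show "(\<lambda>(j, b). (b, b - t * j)) ` Sigma {1..w} (\<lambda>j. removable (t * j) X) \<subseteq> ?P"
    proof clarify
      fix j b assume "j \<in> {1..w}" "b \<in> removable (t * j) X"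
      then show "b \<in> X \<and> b - t * j \<notin> X \<and> b - t * j < b \<and> t dvd b - (b - t * j)"
        using assms(1) by (auto simp: removable_def)
          (metis diff_less gr0I less_le_trans mult_eq_0_iff not_less_eq_eq)
    qed
    show "(\<lambda>(b, g). ((b - g) div t, b)) ` ?P \<subseteq> Sigma {1..w} (\<lambda>j. removable (t * j) X)"
    proof clarify
      fix b g assume A: "b \<in> X" "g \<notin> X" "g < b" "t dvd b - g"
      then obtain j where j: "b - g = t * j" by blast
      then have "b \<in> removable (t * j) X" using A by (auto simp: removable_def) (metis diff_diff_cancel less_imp_le)
      moreover from this have "j \<le> w" by (rule remove_ribbon(2)[OF assms])
      moreover have "j \<ge> 1" using j A by (cases j) auto
      ultimately show "(b - g) div t \<in> {1..w} \<and> b \<in> removable (t * ((b - g) div t)) X"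
        using j assms(1) by simp
    qed
  qed
  from bij_betw_same_card[OF this]
  have "card ?P = card (Sigma {1..w} (\<lambda>j. removable (t * j) X))" ..
  also have "\<dots> = (\<Sum>j=1..w. card (removable (t * j) X))"
    using fin by (subst card_SigmaI) (auto simp: removable_def)
  finally show ?thesis using assms(2) by (simp add: weight_sets_def t_weight_def)
qed

text \<open>Exchanging the sums over ribbon length \<open>j\<close> and total shift \<open>d\<close>
  collects the divisors of \<open>d\<close>.\<close>

lemma weight_sets_rec:
  assumes "t > 0" "n \<le> L"
  shows "w * card (weight_sets t L n w) =
    t * (\<Sum>d=1..w. if t * d \<le> n then (\<Sum>j | j dvd d. j) * card (weight_sets t L (n - t * d) (w - d)) else 0)"
proof -
  let ?c = "\<lambda>d. card (weight_sets t L (n - t * d) (w - d))"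
  have "w * card (weight_sets t L n w) = (\<Sum>X\<in>weight_sets t L n w. w)" by simp
  also have "\<dots> = (\<Sum>X\<in>weight_sets t L n w. \<Sum>j=1..w. card (removable (t * j) X))"
    by (intro sum.cong refl t_weight_eq_sum_removable[OF assms(1)])
  also have "\<dots> = (\<Sum>j=1..w. ribbon_count t L j n w)"
    unfolding ribbon_count_def by (rule sum.swap)
  also have "\<dots> = (\<Sum>j=1..w. \<Sum>d=1..w. if j dvd d \<and> t * d \<le> n then t * j * ?c d else 0)"
    using ribbon_count_eq[OF assms]
    by (intro sum.cong refl) (simp add: sum.If_cases Int_def)
  also have "\<dots> = (\<Sum>d=1..w. \<Sum>j=1..w. if j dvd d \<and> t * d \<le> n then t * j * ?c d else 0)"
    by (rule sum.swap)
  also have "\<dots> = (\<Sum>d=1..w. t * (if t * d \<le> n then (\<Sum>j | j dvd d. j) * ?c d else 0))"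
  proof (rule sum.cong)
    fix d assume d: "d \<in> {1..w}"
    show "(\<Sum>j=1..w. if j dvd d \<and> t * d \<le> n then t * j * ?c d else 0) =
        t * (if t * d \<le> n then (\<Sum>j | j dvd d. j) * ?c d else 0)"
    proof (cases "t * d \<le> n")
      case True
      have "{j \<in> {1..w}. j dvd d} = {j. j dvd d}" using d by (auto dest: dvd_imp_le intro: le_trans Suc_leI dvd_pos_nat)
      then have "(\<Sum>j=1..w. if j dvd d then t * j * ?c d else 0) = (\<Sum>j | j dvd d. t * j * ?c d)"
        by (subst sum.inter_filter[symmetric]) auto
      then show ?thesis using True by (simp add: sum_distrib_left sum_distrib_right mult.assoc)
    qed simp
  qed simp
  finally show ?thesis by (simp add: sum_distrib_left)
qed

lemma weight_count_rec:
  assumes "t > 0"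
  shows "w * weight_count t n w =
    t * (\<Sum>d=1..w. if t * d \<le> n then (\<Sum>j | j dvd d. j) * weight_count t (n - t * d) (w - d) else 0)"
proof -
  have *: "weight_count t m v = card (weight_sets t n m v)" if "m \<le> n" for m v
    unfolding weight_count_eq[OF that] weight_sets_def ..
  show ?thesis
    unfolding *[OF order_refl] *[OF diff_le_self] by (rule weight_sets_rec[OF assms order_refl])
qed

text \<open>Every step of the recursion lowers \<open>n\<close> by \<open>t\<close> for each unit of
  weight, so \<open>n - t * w\<close> is constant along it and the count splits off its value at
  weight 0. This is the numerical form of the core and quotient decomposition, with the t-cores
  counted by \<open>weight_count t m 0\<close> and without constructing the quotient.\<close>

lemma weight_count_factor:
  fixes q :: "nat \<Rightarrow> nat"
  assumes "t > 0" "q 0 = 1"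
    and q: "\<And>w. w * q w = t * (\<Sum>d=1..w. (\<Sum>j | j dvd d. j) * q (w - d))"
  shows "weight_count t n w = (if t * w \<le> n then weight_count t (n - t * w) 0 * q w else 0)"
proof (induction w arbitrary: n rule: less_induct)
  case (less w)
  show ?case
  proof (cases "w = 0")
    case False
    let ?s = "\<lambda>d. \<Sum>j | j dvd d. j"
    have "w * weight_count t n w = t * (\<Sum>d=1..w. if t * d \<le> n then ?s d * weight_count t (n - t * d) (w - d) else 0)"
      by (rule weight_count_rec[OF assms(1)])
    also have "(\<Sum>d=1..w. if t * d \<le> n then ?s d * weight_count t (n - t * d) (w - d) else 0) =
       (\<Sum>d=1..w. if t * w \<le> n then weight_count t (n - t * w) 0 * (?s d * q (w - d)) else 0)"
    proof (rule sum.cong)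
      fix d assume d: "d \<in> {1..w}"
      then have td: "t * w = t * d + t * (w - d)" by (simp add: distrib_left[symmetric])
      have "weight_count t (n - t * d) (w - d) = (if t * (w - d) \<le> n - t * d then
           weight_count t (n - t * d - t * (w - d)) 0 * q (w - d) else 0)"
        by (rule less.IH) (use d False in auto)
      then show "(if t * d \<le> n then ?s d * weight_count t (n - t * d) (w - d) else 0) =
         (if t * w \<le> n then weight_count t (n - t * w) 0 * (?s d * q (w - d)) else 0)"
        using td by (auto simp: diff_diff_eq)
    qed simp
    also have "t * \<dots> = w * (if t * w \<le> n then weight_count t (n - t * w) 0 * q w else 0)"
    proof (cases "t * w \<le> n")
      case True
      let ?c = "weight_count t (n - t * w) 0"
      have "t * (\<Sum>d=1..w. ?c * (?s d * q (w - d))) = ?c * (t * (\<Sum>d=1..w. ?s d * q (w - d)))"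
        by (simp add: sum_distrib_left mult.left_commute)
      also have "\<dots> = w * (?c * q w)" by (simp only: q[of w, symmetric] mult.left_commute)
      finally show ?thesis using True by (simp only: if_True)
    qed simp
    finally show ?thesis using False by simp
  qed (use assms in simp)
qed

lemma weight_count_one: "weight_count 1 n w = (if w = n then card (partitions_of n) else 0)"
proof -
  have "size (t_hooks 1 xs) = n" if "xs \<in> partitions_of n" for xs
  proof -
    have "size (t_hooks 1 xs) = card (young_diagram xs)"
      by (simp add: t_hooks_def)
    also have "\<dots> = (\<Sum>i<length xs. xs ! i)" by (simp add: young_diagram_def card_SigmaI)
    also have "\<dots> = sum_list xs" by (simp add: sum_list_sum_nth atLeast0LessThan)
    finally show ?thesis using that by (simp add: partitions_of_def)
  qed
  then have "{xs \<in> partitions_of n. size (t_hooks 1 xs) = w} = (if w = n then partitions_of n else {})"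
    by auto
  then show ?thesis by (simp add: weight_count_def)
qed

text \<open>The case \<open>t = 1\<close>, where every cell counts and the weight is the size, is
  Euler's divisor-sum recursion.\<close>

lemma partitions_rec:
  "n * card (partitions_of n) = (\<Sum>d=1..n. (\<Sum>j | j dvd d. j) * card (partitions_of (n - d)))"
proof -
  have "n * card (partitions_of n) = n * weight_count 1 n n" unfolding weight_count_one by simp
  also have "\<dots> = (\<Sum>d=1..n. if 1 * d \<le> n then (\<Sum>j | j dvd d. j) * weight_count 1 (n - 1 * d) (n - d) else 0)"
    using weight_count_rec[of 1 n n] by simp
  also have "\<dots> = (\<Sum>d=1..n. (\<Sum>j | j dvd d. j) * card (partitions_of (n - d)))"
    unfolding weight_count_one by (rule sum.cong) auto
  finally show ?thesis .
qed

section \<open>Generating functions\<close>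

text \<open>The operator q d/dq. It is a derivation that keeps the index of each coefficient, which
  turns divisor-sum recursions into logarithmic derivatives.\<close>

definition fps_euler_op :: "nat fps \<Rightarrow> nat fps" where
  "fps_euler_op f = Abs_fps (\<lambda>n. n * fps_nth f n)"

lemma fps_euler_op_mult: "fps_euler_op (f * g) = fps_euler_op f * g + f * fps_euler_op g"
proof (rule fps_ext)
  fix n
  have "n * (\<Sum>i=0..n. fps_nth f i * fps_nth g (n - i)) =
      (\<Sum>i=0..n. i * fps_nth f i * fps_nth g (n - i) + fps_nth f i * ((n - i) * fps_nth g (n - i)))"
    unfolding sum_distrib_left
  proof (rule sum.cong)
    fix i assume "i \<in> {0..n}"
    then have "n = i + (n - i)" by simp
    then have "n * (fps_nth f i * fps_nth g (n - i)) = (i + (n - i)) * (fps_nth f i * fps_nth g (n - i))"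
      by metis
    then show "n * (fps_nth f i * fps_nth g (n - i)) =
        i * fps_nth f i * fps_nth g (n - i) + fps_nth f i * ((n - i) * fps_nth g (n - i))"
      by (simp add: algebra_simps)
  qed simp
  then show "fps_nth (fps_euler_op (f * g)) n = fps_nth (fps_euler_op f * g + f * fps_euler_op g) n"
    by (simp add: fps_euler_op_def fps_mult_nth sum.distrib)
qed

definition partitions_fps :: "nat fps" where
  "partitions_fps = Abs_fps (\<lambda>n. card (partitions_of n))"

definition sigma_fps :: "nat fps" where
  "sigma_fps = Abs_fps (\<lambda>d. if d = 0 then 0 else \<Sum>j | j dvd d. j)"

lemma sigma_fps_mult_nth:
  "fps_nth (sigma_fps * f) w = (\<Sum>d=1..w. (\<Sum>j | j dvd d. j) * fps_nth f (w - d))"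
proof -
  have "fps_nth (sigma_fps * f) w = (\<Sum>d\<in>insert 0 {1..w}. fps_nth sigma_fps d * fps_nth f (w - d))"
    unfolding fps_mult_nth by (intro sum.cong) auto
  also have "\<dots> = (\<Sum>d=1..w. (\<Sum>j | j dvd d. j) * fps_nth f (w - d))"
    by (simp add: sigma_fps_def)
  finally show ?thesis .
qed

lemma euler_op_partitions_fps: "fps_euler_op partitions_fps = sigma_fps * partitions_fps"
  by (rule fps_ext)
    (simp add: sigma_fps_mult_nth, simp add: fps_euler_op_def partitions_fps_def partitions_rec)

text \<open>The power rule multiplies the logarithmic derivative by \<open>t\<close>; hence the
  coefficients of the \<open>t\<close>-th power solve the recursion that
  \<open>weight_count_factor\<close> asks for.\<close>

lemma euler_op_partitions_fps_power:
  "fps_euler_op (partitions_fps ^ t) = of_nat t * (sigma_fps * partitions_fps ^ t)"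
proof (induction t)
  case 0
  have "fps_euler_op 1 = 0" by (rule fps_ext) (simp add: fps_euler_op_def)
  then show ?case by simp
next
  case (Suc t)
  then show ?case by (simp add: fps_euler_op_mult euler_op_partitions_fps algebra_simps)
qed

lemma card_partitions_of_0: "card (partitions_of 0) = 1"
proof -
  have "partitions_of 0 = {[]}"
  proof (intro set_eqI iffI)
    fix xs assume "xs \<in> partitions_of 0"
    then have "0 \<notin> set xs" "sum_list xs = 0" unfolding partitions_of_def by blast+
    then have "length xs = 0" using length_le_sum_list[of xs] by linarith
    then show "xs \<in> {[]}" by simp
  qed (simp add: partitions_of_def)
  then show ?thesis by simp
qed

lemma partitions_fps_power_nth_0: "fps_nth (partitions_fps ^ t) 0 = 1"
  by (simp add: fps_power_zeroth partitions_fps_def card_partitions_of_0)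

lemma partitions_fps_power_rec:
  "w * fps_nth (partitions_fps ^ t) w =
     t * (\<Sum>d=1..w. (\<Sum>j | j dvd d. j) * fps_nth (partitions_fps ^ t) (w - d))"
proof -
  have "w * fps_nth (partitions_fps ^ t) w = fps_nth (fps_euler_op (partitions_fps ^ t)) w"
    by (simp add: fps_euler_op_def)
  also have "\<dots> = fps_nth (of_nat t * (sigma_fps * partitions_fps ^ t)) w"
    by (simp only: euler_op_partitions_fps_power)
  also have "\<dots> = t * fps_nth (sigma_fps * partitions_fps ^ t) w"
    by (simp add: fps_of_nat[symmetric])
  finally show ?thesis by (simp add: sigma_fps_mult_nth)
qed

text \<open>The weight variable stays free on purpose. At \<open>y = 1\<close> the left side is the
  partition number, at \<open>y = - 1\<close> the wanted difference, and comparing the two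
  eliminates the unknown t-core counts.\<close>

lemma sum_power_t_hooks:
  fixes y :: "'a :: comm_ring_1"
  assumes "t > 0"
  shows "(\<Sum>xs\<in>partitions_of n. y ^ size (t_hooks t xs)) =
    (\<Sum>w | t * w \<le> n. of_nat (weight_count t (n - t * w) 0) * (of_nat (fps_nth (partitions_fps ^ t) w) * y ^ w))"
proof -
  let ?q = "fps_nth (partitions_fps ^ t)"
  have factor: "weight_count t n w = (if t * w \<le> n then weight_count t (n - t * w) 0 * ?q w else 0)" for w
    by (rule weight_count_factor[OF assms partitions_fps_power_nth_0 partitions_fps_power_rec])
  have W: "finite {w. t * w \<le> n}"
    by (rule finite_subset[of _ "{..n}"]) (use assms le_square in
        \<open>auto intro: order.trans[rotated] mult_le_mono1[of 1 t, simplified]\<close>)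
  have "size (t_hooks t xs) \<in> {w. t * w \<le> n}" if "xs \<in> partitions_of n" for xs
  proof -
    have "xs \<in> {xs' \<in> partitions_of n. size (t_hooks t xs') = size (t_hooks t xs)}" using that by simp
    then have "weight_count t n (size (t_hooks t xs)) > 0"
      unfolding weight_count_def using finite_partitions_of by (auto simp: card_gt_0_iff)
    then show ?thesis unfolding factor[of "size (t_hooks t xs)"] by (simp split: if_splits)
  qed
  then have sub: "(\<lambda>xs. size (t_hooks t xs)) ` partitions_of n \<subseteq> {w. t * w \<le> n}" by auto
  have "(\<Sum>xs\<in>partitions_of n. y ^ size (t_hooks t xs)) =
     (\<Sum>w | t * w \<le> n. \<Sum>xs | xs \<in> partitions_of n \<and> size (t_hooks t xs) = w. y ^ size (t_hooks t xs))"
    by (rule sum.group[OF finite_partitions_of W sub, symmetric])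
  also have "\<dots> = (\<Sum>w | t * w \<le> n. of_nat (weight_count t n w) * y ^ w)"
    by (intro sum.cong) (auto simp: weight_count_def)
  also have "\<dots> = (\<Sum>w | t * w \<le> n. of_nat (weight_count t (n - t * w) 0) * (of_nat (?q w) * y ^ w))"
  proof (rule sum.cong)
    fix w assume "w \<in> {w. t * w \<le> n}"
    then have "weight_count t n w = weight_count t (n - t * w) 0 * ?q w" by (simp only: factor mem_Collect_eq if_True)
    then show "of_nat (weight_count t n w) * y ^ w =
        of_nat (weight_count t (n - t * w) 0) * (of_nat (?q w) * y ^ w)"
      by (simp only: of_nat_mult mult.assoc)
  qed simp
  finally show ?thesis .
qed

lemma card_partitions_eq_sum_weights:
  assumes "t > 0"
  shows "card (partitions_of n) =
    (\<Sum>w | t * w \<le> n. weight_count t (n - t * w) 0 * fps_nth (partitions_fps ^ t) w)"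
proof -
  have "int (card (partitions_of n)) =
      int (\<Sum>w | t * w \<le> n. weight_count t (n - t * w) 0 * fps_nth (partitions_fps ^ t) w)"
    using sum_power_t_hooks[OF assms, of "1 :: int" n] by simp
  then show ?thesis by (simp only: of_nat_eq_iff)
qed

lemma p_even_minus_p_odd:
  assumes "t > 0"
  shows "int (p_even t n) - int (p_odd t n) =
    (\<Sum>w | t * w \<le> n. int (weight_count t (n - t * w) 0) * (int (fps_nth (partitions_fps ^ t) w) * (- 1) ^ w))"
proof -
  let ?S = "partitions_of n" and ?w = "\<lambda>xs. size (t_hooks t xs)"
  have e: "?S \<inter> {xs. even (?w xs)} = {xs \<in> ?S. even (?w xs)}"
    and o: "?S \<inter> - {xs. even (?w xs)} = {xs \<in> ?S. odd (?w xs)}" by auto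
  have "(\<Sum>xs\<in>?S. (- 1) ^ ?w xs) = (\<Sum>xs\<in>?S. if even (?w xs) then 1 else - 1 :: int)"
    by (intro sum.cong) auto
  also have "\<dots> = int (card {xs \<in> ?S. even (?w xs)}) - int (card {xs \<in> ?S. odd (?w xs)})"
    unfolding sum.If_cases[OF finite_partitions_of] e o by simp
  also have "\<dots> = int (p_even t n) - int (p_odd t n)"
    unfolding p_even_def p_odd_def ..
  finally show ?thesis unfolding sum_power_t_hooks[OF assms] by simp
qed

section \<open>Euler's function and the pentagonal number theorem\<close>

definition parts_le :: "nat \<Rightarrow> nat \<Rightarrow> nat list set" where
  "parts_le m n = {xs \<in> partitions_of n. \<forall>x\<in>set xs. x \<le> m}"

lemma finite_parts_le: "finite (parts_le m n)"
  using finite_partitions_of by (simp add: parts_le_def)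

lemma card_parts_le_0: "card (parts_le 0 n) = (if n = 0 then 1 else 0)"
proof -
  have "xs \<in> parts_le 0 n \<longleftrightarrow> xs = [] \<and> n = 0" for xs
    by (cases xs) (auto simp: parts_le_def partitions_of_def)
  then have "parts_le 0 n = (if n = 0 then {[]} else {})" by auto
  then show ?thesis by simp
qed

lemma parts_le_eq: "n \<le> m \<Longrightarrow> parts_le m n = partitions_of n"
  unfolding parts_le_def partitions_of_def using member_le_sum_list by fastforce

text \<open>Either the largest part is \<open>Suc m\<close>, and it can be deleted, or all parts are
  at most \<open>m\<close>.\<close>

lemma card_parts_le_Suc:
  "card (parts_le (Suc m) n) =
     card (parts_le m n) + (if Suc m \<le> n then card (parts_le (Suc m) (n - Suc m)) else 0)"
proof -
  let ?B = "{xs \<in> parts_le (Suc m) n. xs \<noteq> [] \<and> hd xs = Suc m}"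
  have hd_ge: "x \<le> hd xs" if "x \<in> set xs" "sorted_wrt (\<ge>) xs" for x and xs :: "nat list"
    using that by (cases xs) auto
  have split: "parts_le (Suc m) n = parts_le m n \<union> ?B"
  proof (intro set_eqI iffI)
    fix xs assume xs: "xs \<in> parts_le (Suc m) n"
    show "xs \<in> parts_le m n \<union> ?B"
    proof (cases "xs \<noteq> [] \<and> hd xs = Suc m")
      case False
      have "x \<le> m" if "x \<in> set xs" for x
      proof -
        have "hd xs \<in> set xs" using that by (cases xs) auto
        then have "hd xs \<le> Suc m" using xs by (simp add: parts_le_def)
        moreover have "xs \<noteq> []" using that by auto
        ultimately have "hd xs \<le> m" using False by simp
        then show ?thesis using hd_ge[OF that] xs by (simp add: parts_le_def partitions_of_def)
      qed
      then show ?thesis using xs by (simp add: parts_le_def)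
    qed (use xs in simp)
  qed (auto simp: parts_le_def intro: le_SucI)
  have disj: "parts_le m n \<inter> ?B = {}"
  proof -
    have False if "xs \<in> parts_le m n" "xs \<in> ?B" for xs
    proof -
      have "Suc m \<in> set xs" using that(2) by (metis (mono_tags, lifting) list.set_sel(1) mem_Collect_eq)
      then show False using that(1) by (auto simp: parts_le_def)
    qed
    then show ?thesis by blast
  qed
  have "card (parts_le (Suc m) n) = card (parts_le m n) + card ?B"
    by (subst split, rule card_Un_disjoint[OF _ _ disj])
      (auto intro: finite_parts_le finite_subset[OF _ finite_parts_le[of "Suc m" n]])
  moreover have "card ?B = (if Suc m \<le> n then card (parts_le (Suc m) (n - Suc m)) else 0)"
  proof (cases "Suc m \<le> n")
    case True
    have "?B = (#) (Suc m) ` parts_le (Suc m) (n - Suc m)"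
    proof (intro set_eqI iffI)
      fix xs assume "xs \<in> ?B"
      moreover from this obtain ys where "xs = Suc m # ys" by (cases xs) auto
      ultimately show "xs \<in> (#) (Suc m) ` parts_le (Suc m) (n - Suc m)"
        by (auto simp: parts_le_def partitions_of_def)
    next
      fix xs assume "xs \<in> (#) (Suc m) ` parts_le (Suc m) (n - Suc m)"
      then obtain ys where "xs = Suc m # ys" "ys \<in> parts_le (Suc m) (n - Suc m)" by auto
      then show "xs \<in> ?B" using True by (auto simp: parts_le_def partitions_of_def)
    qed
    then show ?thesis using True by (simp add: card_image)
  next
    case False
    have "?B = {}"
    proof -
      have False if "xs \<in> ?B" for xs
      proof -
        have "Suc m \<in> set xs" using that by (metis (mono_tags, lifting) list.set_sel(1) mem_Collect_eq)
        then have "Suc m \<le> sum_list xs" by (simp add: member_le_sum_list)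
        then show False using that False by (simp add: parts_le_def partitions_of_def)
      qed
      then show ?thesis by blast
    qed
    then show ?thesis using False by (simp only: card.empty if_False)
  qed
  ultimately show ?thesis by simp
qed

text \<open>Euler's function \<open>(q; q)\<^sub>\<infinity>\<close>, written through the Lambert series of its logarithm.\<close>

definition lambert_term :: "complex \<Rightarrow> nat \<Rightarrow> complex" where
  "lambert_term q j = q ^ Suc j / (of_nat (Suc j) * (1 - q ^ Suc j))"

definition euler_fun :: "complex \<Rightarrow> complex" where
  "euler_fun q = exp (- (\<Sum>j. lambert_term q j))"

lemma norm_one_minus_power_ge:
  fixes q :: complex
  assumes "norm q < 1" shows "1 - norm q \<le> norm (1 - q ^ Suc j)"
proof -
  have "norm (q ^ Suc j) \<le> norm q"
    using assms by (simp add: norm_mult norm_power mult_left_le power_le_one)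
  then show ?thesis using norm_triangle_ineq2[of 1 "q ^ Suc j"] by simp
qed

lemma one_minus_power_nz:
  fixes q :: complex
  assumes "norm q < 1" shows "1 - q ^ Suc j \<noteq> 0"
  using norm_one_minus_power_ge[OF assms, of j] assms by (metis diff_gt_0_iff_gt norm_zero not_less)

lemma norm_lambert_term_le:
  assumes "norm q < 1" shows "norm (lambert_term q j) \<le> norm q ^ Suc j / (1 - norm q)"
proof -
  have "norm (lambert_term q j) = norm q ^ Suc j / (real (Suc j) * norm (1 - q ^ Suc j))"
    by (simp only: lambert_term_def norm_divide norm_mult norm_power norm_of_nat)
  also have "\<dots> \<le> norm q ^ Suc j / (1 * (1 - norm q))"
    using norm_one_minus_power_ge[OF assms, of j] assms
    by (intro divide_left_mono mult_mono mult_pos_pos) auto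
  finally show ?thesis by simp
qed

lemma summable_lambert_term:
  assumes "norm q < 1" shows "summable (lambert_term q)" "summable (\<lambda>j. norm (lambert_term q j))"
proof -
  have "summable (\<lambda>j. norm q ^ Suc j / (1 - norm q))"
    using assms by (intro summable_divide summable_mult[of _ "norm q", simplified power_Suc[symmetric]] summable_geometric) auto
  then show "summable (\<lambda>j. norm (lambert_term q j))"
    by (rule summable_comparison_test'[where N = 0])
      (use norm_lambert_term_le[OF assms] in \<open>simp only: real_norm_def abs_norm_cancel\<close>)
  then show "summable (lambert_term q)" by (rule summable_norm_cancel)
qed

text \<open>Expand the logarithm of each factor and sum over the factors first: for fixed
  \<open>j\<close> the geometric sums over \<open>i\<close> converge to
  \<open>lambert_term q j\<close>, and Tannery's theorem allows the limit under the sum over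
  \<open>j\<close>.\<close>

lemma tendsto_prod_euler_fun:
  assumes "norm q < 1" shows "(\<lambda>m. \<Prod>i=1..m. 1 - q ^ i) \<longlonglongrightarrow> euler_fun q"
proof -
  \<comment> \<open>The contribution of the first \<open>m\<close> factors to the power
    \<open>Suc j\<close> in the logarithmic expansion.\<close>
  define c where "c j m = (\<Sum>i=1..m. (q ^ i) ^ Suc j) / of_nat (Suc j)" for j m :: nat
  have q: "norm (q ^ i) < 1" if "i \<ge> 1" for i
    using assms that by (simp add: norm_power power_less_one_iff)
  have log1: "(\<lambda>j. x ^ Suc j / of_nat (Suc j)) sums (- ln (1 - x))" if "norm x < 1" for x :: complex
  proof -
    have "(\<lambda>n. (-1) ^ Suc n / of_nat n * (- x) ^ n) sums ln (1 + - x)"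
      by (rule Ln_series) (use that in simp)
    then have "(\<lambda>n. - ((-1) ^ Suc n / of_nat n * (- x) ^ n)) sums - ln (1 - x)"
      using sums_minus by fastforce
    then have *: "(\<lambda>n. x ^ n / of_nat n) sums - ln (1 - x)"
      by (rule sums_cong[THEN iffD1, rotated]) (simp flip: power_mult_distrib)
    show ?thesis using *[THEN sums_split_initial_segment, of 1] by simp
  qed
  have prod: "(\<Prod>i=1..m. 1 - q ^ i) = exp (- (\<Sum>j. c j m))" for m
  proof -
    have s: "(\<lambda>j. \<Sum>i=1..m. (q ^ i) ^ Suc j / of_nat (Suc j)) sums (\<Sum>i=1..m. - ln (1 - q ^ i))"
      by (intro sums_sum log1 q) auto
    then have "(\<Sum>j. c j m) = (\<Sum>i=1..m. - ln (1 - q ^ i))"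
      unfolding c_def sum_divide_distrib by (simp add: sums_iff)
    then have "exp (- (\<Sum>j. c j m)) = (\<Prod>i=1..m. exp (ln (1 - q ^ i)))"
      by (simp add: sum_negf exp_sum)
    also have "\<dots> = (\<Prod>i=1..m. 1 - q ^ i)"
    proof (rule prod.cong)
      fix i assume "i \<in> {1..m}"
      then have "1 - q ^ i \<noteq> 0" using q[of i] by auto
      then show "exp (ln (1 - q ^ i)) = 1 - q ^ i" by simp
    qed simp
    finally show ?thesis by simp
  qed
  have geo: "(\<Sum>i=1..m. x ^ i) = x * (1 - x ^ m) / (1 - x)" if "x \<noteq> 1" for x :: complex and m
  proof -
    have "(\<Sum>i=1..m. x ^ i) * (1 - x) = x * (1 - x ^ m)"
    proof (induction m)
      case (Suc m)
      have "(\<Sum>i=1..Suc m. x ^ i) * (1 - x) = (\<Sum>i=1..m. x ^ i) * (1 - x) + x ^ Suc m * (1 - x)"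
        by (simp add: distrib_right)
      also have "\<dots> = x * (1 - x ^ Suc m)" unfolding Suc by (simp add: algebra_simps)
      finally show ?case .
    qed simp
    then show ?thesis using that by (simp add: eq_divide_eq)
  qed
  have lim: "(\<lambda>m. \<Sum>j. c j m) \<longlonglongrightarrow> (\<Sum>j. lambert_term q j)"
  proof (rule tannerys_theorem[THEN conjunct2, THEN conjunct2])
    show "(\<lambda>m. c j m) \<longlonglongrightarrow> lambert_term q j" for j
    proof -
      let ?x = "q ^ Suc j"
      have x: "norm ?x < 1" using q[of "Suc j"] by simp
      have nz: "1 - ?x \<noteq> 0" by (rule one_minus_power_nz[OF assms])
      have "(\<lambda>m. ?x * (1 - ?x ^ m) / (1 - ?x) / of_nat (Suc j)) \<longlonglongrightarrow> ?x * (1 - 0) / (1 - ?x) / of_nat (Suc j)"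
        by (intro tendsto_intros LIMSEQ_power_zero x nz of_nat_neq_0)
      moreover have "c j m = ?x * (1 - ?x ^ m) / (1 - ?x) / of_nat (Suc j)" for m
      proof -
        have "(q ^ i) ^ Suc j = ?x ^ i" for i by (simp only: power_mult[symmetric] mult.commute)
        then show ?thesis unfolding c_def using geo[of ?x m] nz by simp
      qed
      ultimately show ?thesis by (simp add: lambert_term_def mult.commute)
    qed
    show "\<forall>\<^sub>F (j, m) in at_top \<times>\<^sub>F sequentially. norm (c j m) \<le> norm q ^ Suc j * (2 / (1 - norm q))"
    proof (rule always_eventually, clarify)
      fix j m
      let ?x = "q ^ Suc j"
      have x: "norm ?x < 1" using q[of "Suc j"] by simp
      have nz: "1 - ?x \<noteq> 0" by (rule one_minus_power_nz[OF assms])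
      have "(q ^ i) ^ Suc j = ?x ^ i" for i by (simp only: power_mult[symmetric] mult.commute)
      then have "c j m = ?x * (1 - ?x ^ m) / (1 - ?x) / of_nat (Suc j)"
        unfolding c_def using geo[of ?x m] nz by simp
      then have "norm (c j m) = norm ?x * (norm (1 - ?x ^ m) / (norm (1 - ?x) * real (Suc j)))"
        by (simp only: norm_mult norm_divide norm_of_nat) simp
      also have "\<dots> \<le> norm ?x * (2 / ((1 - norm q) * 1))"
      proof (intro mult_left_mono frac_le mult_mono)
        have "norm (1 - ?x ^ m) \<le> 1 + norm (?x ^ m)" using norm_triangle_ineq4[of 1 "?x ^ m"] by simp
        also have "norm (?x ^ m) \<le> 1" using x by (simp only: norm_power[of ?x]) (simp add: power_le_one)
        finally show "norm (1 - ?x ^ m) \<le> 2" by simp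
      qed (use norm_one_minus_power_ge[OF assms, of j] assms in auto)
      finally show "norm (c j m) \<le> norm q ^ Suc j * (2 / (1 - norm q))" by (simp only: norm_power mult_1_right)
    qed
    show "summable (\<lambda>j. norm q ^ Suc j * (2 / (1 - norm q)))"
      using assms by (intro summable_mult2 summable_Suc_iff[THEN iffD2] summable_geometric) auto
  qed simp
  show ?thesis unfolding prod euler_fun_def by (intro tendsto_intros lim)
qed

lemma euler_fun_nz: "euler_fun q \<noteq> 0"
  by (simp add: euler_fun_def)

text \<open>The products decrease to a nonnegative real limit, and this limit is a value of
  \<open>exp\<close>, so it is not zero.\<close>

lemma prod_one_minus_power_ge:
  fixes r :: real
  assumes "0 \<le> r" "r < 1" shows "\<exists>K>0. \<forall>m. K \<le> (\<Prod>i=1..m. 1 - r ^ i)"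
proof -
  have of_real: "(\<Prod>i=1..m. 1 - complex_of_real r ^ i) = complex_of_real (\<Prod>i=1..m. 1 - r ^ i)" for m
    by simp
  have lim: "(\<lambda>m. (\<Prod>i=1..m. 1 - r ^ i)) \<longlonglongrightarrow> Re (euler_fun (of_real r))"
  proof -
    have "(\<lambda>m. Re (\<Prod>i=1..m. 1 - complex_of_real r ^ i)) \<longlonglongrightarrow> Re (euler_fun (of_real r))"
      by (intro tendsto_Re tendsto_prod_euler_fun) (use assms in simp)
    moreover have "Re (\<Prod>i=1..m. 1 - complex_of_real r ^ i) = (\<Prod>i=1..m. 1 - r ^ i)" for m
      unfolding of_real by (rule Re_complex_of_real)
    ultimately show ?thesis by simp
  qed
  have fac: "0 \<le> r ^ i" "r ^ i \<le> 1" "r ^ Suc i < 1" for i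
    using assms by (auto simp: power_le_one power_less_one_iff simp del: power_Suc)
  have dec: "decseq (\<lambda>m. \<Prod>i=1..m. 1 - r ^ i)"
  proof (rule decseq_SucI)
    fix m
    have "0 \<le> (\<Prod>i=1..m. 1 - r ^ i)" by (intro prod_nonneg) (use fac in auto)
    then show "(\<Prod>i=1..Suc m. 1 - r ^ i) \<le> (\<Prod>i=1..m. 1 - r ^ i)"
      using fac(1)[of "Suc m"] by (simp add: mult_left_le mult_nonneg_nonneg)
  qed
  have nonneg: "0 \<le> (\<Prod>i=1..m. 1 - r ^ i)" for m by (intro prod_nonneg) (use fac in auto)
  have "0 \<le> Re (euler_fun (of_real r))"
    by (rule LIMSEQ_le_const[OF lim]) (use nonneg in auto)
  moreover have "Im (euler_fun (of_real r)) = 0"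
  proof -
    have "(\<lambda>m. Im (\<Prod>i=1..m. 1 - complex_of_real r ^ i)) \<longlonglongrightarrow> Im (euler_fun (of_real r))"
      by (intro tendsto_Im tendsto_prod_euler_fun) (use assms in simp)
    moreover have "Im (\<Prod>i=1..m. 1 - complex_of_real r ^ i) = 0" for m
      unfolding of_real by (rule Im_complex_of_real)
    ultimately show ?thesis by (simp only: LIMSEQ_const_iff)
  qed
  ultimately have "0 < Re (euler_fun (of_real r))"
    using euler_fun_nz[of "of_real r"] by (simp add: complex_eq_iff less_le)
  moreover have "Re (euler_fun (of_real r)) \<le> (\<Prod>i=1..m. 1 - r ^ i)" for m
    by (rule decseq_ge[OF dec lim])
  ultimately show ?thesis by blast
qed

text \<open>A truncated form of the product formula. Cutting the series at \<open>N\<close> leaves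
  an inequality, which needs no convergence and so can be used to prove convergence.\<close>

lemma parts_le_partial_sum:
  fixes r :: real
  assumes "0 \<le> r" "r < 1"
  shows "(\<Sum>n\<le>N. real (card (parts_le m n)) * r ^ n) * (\<Prod>i=1..m. 1 - r ^ i) \<le> 1"
proof (induction m)
  case 0
  have "(\<Sum>n\<le>N. real (card (parts_le 0 n)) * r ^ n) = (\<Sum>n\<le>N. if n = 0 then 1 else 0)"
    by (intro sum.cong) (auto simp: card_parts_le_0)
  then show ?case by simp
next
  case (Suc m)
  let ?T = "\<lambda>m. \<Sum>n\<le>N. real (card (parts_le m n)) * r ^ n"
  let ?f = "\<lambda>n. real (card (parts_le (Suc m) n)) * r ^ n"
  have fac: "0 \<le> r ^ i" "r ^ i \<le> 1" for i using assms by (auto simp: power_le_one)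
  have "?T (Suc m) = ?T m + (\<Sum>n\<le>N. if Suc m \<le> n then r ^ Suc m * ?f (n - Suc m) else 0)"
    unfolding sum.distrib[symmetric]
  proof (rule sum.cong)
    fix n
    show "?f n = real (card (parts_le m n)) * r ^ n + (if Suc m \<le> n then r ^ Suc m * ?f (n - Suc m) else 0)"
    proof (cases "Suc m \<le> n")
      case True
      then have "r ^ n = r ^ Suc m * r ^ (n - Suc m)" by (metis le_add_diff_inverse power_add)
      then show ?thesis using True by (simp add: card_parts_le_Suc[of m n] algebra_simps del: power_Suc)
    qed (simp add: card_parts_le_Suc[of m n])
  qed simp
  also have "(\<Sum>n\<le>N. if Suc m \<le> n then r ^ Suc m * ?f (n - Suc m) else 0) =
      (\<Sum>n\<in>{Suc m..N}. r ^ Suc m * ?f (n - Suc m))"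
    by (subst sum.inter_filter[symmetric]) (auto intro!: sum.cong)
  also have "\<dots> \<le> r ^ Suc m * ?T (Suc m)"
  proof -
    have "(\<Sum>n\<in>{Suc m..N}. ?f (n - Suc m)) = (\<Sum>n\<in>(\<lambda>n. n - Suc m) ` {Suc m..N}. ?f n)"
      by (subst sum.reindex) (auto simp: inj_on_def)
    also have "\<dots> \<le> (\<Sum>n\<le>N. ?f n)"
      by (rule sum_mono2) (use fac in auto)
    finally show ?thesis using fac(1)[of "Suc m"] unfolding sum_distrib_left[symmetric]
      by (rule mult_left_mono)
  qed
  finally have "?T (Suc m) * (1 - r ^ Suc m) \<le> ?T m" by (simp add: algebra_simps del: power_Suc)
  moreover have "0 \<le> (\<Prod>i=1..m. 1 - r ^ i)" by (intro prod_nonneg) (use fac in auto)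
  ultimately have "?T (Suc m) * (1 - r ^ Suc m) * (\<Prod>i=1..m. 1 - r ^ i) \<le> ?T m * (\<Prod>i=1..m. 1 - r ^ i)"
    by (rule mult_right_mono)
  also have "\<dots> \<le> 1" by (rule Suc.IH)
  finally show ?case by (simp add: mult_ac del: power_Suc)
qed

lemma summable_partitions:
  fixes r :: real
  assumes "0 \<le> r" "r < 1" shows "summable (\<lambda>n. real (card (partitions_of n)) * r ^ n)"
proof -
  obtain K where K: "K > 0" "\<And>m. K \<le> (\<Prod>i=1..m. 1 - r ^ i)"
    using prod_one_minus_power_ge[OF assms] by blast
  show ?thesis
  proof (rule summableI_nonneg_bounded)
    fix N
    let ?S = "\<Sum>n\<le>N. real (card (partitions_of n)) * r ^ n"
    have "?S = (\<Sum>n\<le>N. real (card (parts_le N n)) * r ^ n)"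
      by (intro sum.cong) (auto simp: parts_le_eq)
    then have "?S * (\<Prod>i=1..N. 1 - r ^ i) \<le> 1" using parts_le_partial_sum[OF assms] by simp
    moreover have "0 \<le> ?S" using assms by (intro sum_nonneg) auto
    ultimately have "?S * K \<le> 1" using mult_left_mono[OF K(2), of ?S N] by linarith
    then have "?S \<le> 1 / K" using K(1) by (simp add: field_simps)
    moreover have "(\<Sum>n<N. real (card (partitions_of n)) * r ^ n) \<le> ?S"
      using assms by (intro sum_mono2) auto
    ultimately show "(\<Sum>n<N. real (card (partitions_of n)) * r ^ n) \<le> 1 / K" by simp
  qed (use assms in auto)
qed

text \<open>With the majorant available, the product formula for parts at most \<open>m\<close> is
  exact, and Tannery's theorem sends \<open>m\<close> to infinity.\<close>

lemma partitions_sums: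
  assumes "norm q < 1"
  shows "summable (\<lambda>n. norm (of_nat (card (partitions_of n)) * q ^ n))"
    and "(\<Sum>n. of_nat (card (partitions_of n)) * q ^ n) = 1 / euler_fun q"
proof -
  have s: "summable (\<lambda>n. real (card (partitions_of n)) * norm q ^ n)"
    by (rule summable_partitions) (use assms in auto)
  then show "summable (\<lambda>n. norm (of_nat (card (partitions_of n)) * q ^ n))"
    by (simp add: norm_mult norm_power)
  have le: "card (parts_le m n) \<le> card (partitions_of n)" for m n
    by (rule card_mono[OF finite_partitions_of]) (auto simp: parts_le_def)
  let ?F = "\<lambda>m. \<Sum>n. of_nat (card (parts_le m n)) * q ^ n"
  have bd: "norm (of_nat (card (parts_le m n)) * q ^ n) \<le> real (card (partitions_of n)) * norm q ^ n" for m n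
    using le[of m n] by (simp add: norm_mult norm_power mult_right_mono)
  have sm: "summable (\<lambda>n. of_nat (card (parts_le m n)) * q ^ n)" for m
    by (rule summable_comparison_test[OF _ s]) (use bd in auto)
  have F: "?F m * (\<Prod>i=1..m. 1 - q ^ i) = 1" for m
  proof (induction m)
    case 0
    have "(\<lambda>n. of_nat (card (parts_le 0 n)) * q ^ n) = (\<lambda>n. if n = 0 then 1 else 0)"
      by (auto simp: card_parts_le_0)
    then show ?case using sums_If_finite[of "\<lambda>n. n = (0::nat)" "\<lambda>_. 1 :: complex"]
      by (simp add: sums_iff)
  next
    case (Suc m)
    let ?f = "\<lambda>n. of_nat (card (parts_le (Suc m) n)) * q ^ n"
    have "(\<lambda>n. if Suc m \<le> n then q ^ Suc m * ?f (n - Suc m) else 0) sums (q ^ Suc m * ?F (Suc m))"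
    proof -
      have "(\<lambda>n. q ^ Suc m * ?f n) sums (q ^ Suc m * ?F (Suc m))"
        by (intro sums_mult summable_sums sm)
      then show ?thesis
        by (subst sums_zero_iff_shift[of "Suc m", symmetric]) (simp_all del: power_Suc)
    qed
    then have "(\<lambda>n. of_nat (card (parts_le m n)) * q ^ n + (if Suc m \<le> n then q ^ Suc m * ?f (n - Suc m) else 0))
        sums (?F m + q ^ Suc m * ?F (Suc m))"
      by (intro sums_add summable_sums sm)
    moreover have "of_nat (card (parts_le m n)) * q ^ n + (if Suc m \<le> n then q ^ Suc m * ?f (n - Suc m) else 0) = ?f n" for n
    proof (cases "Suc m \<le> n")
      case True
      then have "q ^ n = q ^ Suc m * q ^ (n - Suc m)" by (metis le_add_diff_inverse power_add)
      then show ?thesis using True by (simp add: card_parts_le_Suc[of m n] algebra_simps del: power_Suc)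
    qed (simp add: card_parts_le_Suc[of m n])
    ultimately have "?F (Suc m) = ?F m + q ^ Suc m * ?F (Suc m)" by (simp add: sums_iff del: power_Suc)
    then have "?F (Suc m) * (1 - q ^ Suc m) = ?F m" by (simp add: algebra_simps del: power_Suc)
    then have "?F (Suc m) * ((1 - q ^ Suc m) * (\<Prod>i=1..m. 1 - q ^ i)) = 1"
      using Suc.IH by (simp only: mult.assoc[symmetric])
    then show ?case by (simp add: mult.commute del: power_Suc)
  qed
  have "?F \<longlonglongrightarrow> (\<Sum>n. of_nat (card (partitions_of n)) * q ^ n)"
  proof (rule tannerys_theorem[THEN conjunct2, THEN conjunct2])
    show "(\<lambda>m. of_nat (card (parts_le m n)) * q ^ n) \<longlonglongrightarrow> of_nat (card (partitions_of n)) * q ^ n" for n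
      by (rule tendsto_eventually) (auto simp: eventually_sequentially parts_le_eq intro!: exI[of _ n])
    show "\<forall>\<^sub>F (n, m) in at_top \<times>\<^sub>F sequentially.
        norm (of_nat (card (parts_le m n)) * q ^ n) \<le> real (card (partitions_of n)) * norm q ^ n"
      using bd by (intro always_eventually) auto
  qed (use s in auto)
  then have "(\<lambda>m. ?F m * (\<Prod>i=1..m. 1 - q ^ i)) \<longlonglongrightarrow>
      (\<Sum>n. of_nat (card (partitions_of n)) * q ^ n) * euler_fun q"
    by (intro tendsto_mult tendsto_prod_euler_fun assms)
  then have "(\<Sum>n. of_nat (card (partitions_of n)) * q ^ n) * euler_fun q = 1"
    unfolding F by (simp add: LIMSEQ_const_iff)
  then show "(\<Sum>n. of_nat (card (partitions_of n)) * q ^ n) = 1 / euler_fun q"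
    using euler_fun_nz[of q] by (simp add: field_simps)
qed

lemma abs_summable_Cauchy_product:
  fixes a b :: "nat \<Rightarrow> complex"
  assumes "summable (\<lambda>n. norm (a n))" "summable (\<lambda>n. norm (b n))"
  shows "summable (\<lambda>k. norm (\<Sum>i\<le>k. a i * b (k - i)))"
proof (rule summable_comparison_test'[where N = 0])
  show "summable (\<lambda>k. \<Sum>i\<le>k. norm (a i) * norm (b (k - i)))"
    using Cauchy_product_sums[of "\<lambda>n. norm (a n)" "\<lambda>n. norm (b n)"] assms by (simp add: sums_iff)
  show "norm (norm (\<Sum>i\<le>k. a i * b (k - i))) \<le> (\<Sum>i\<le>k. norm (a i) * norm (b (k - i)))" for k
    by (simp add: sum_norm_le norm_mult)
qed

lemma partitions_fps_power_sums:
  fixes x :: complex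
  assumes "norm x < 1"
  shows "summable (\<lambda>w. norm (of_nat (fps_nth (partitions_fps ^ t) w) * x ^ w)) \<and>
     (\<Sum>w. of_nat (fps_nth (partitions_fps ^ t) w) * x ^ w) = (1 / euler_fun x) ^ t"
proof (induction t)
  case 0
  have eq: "(\<lambda>w. of_nat (fps_nth (partitions_fps ^ 0) w) * x ^ w) = (\<lambda>w. if w = 0 then 1 else 0)"
    by auto
  have "(\<lambda>w. norm (of_nat (fps_nth (partitions_fps ^ 0) w) * x ^ w)) = (\<lambda>w. if w = 0 then 1 else 0)"
    by auto
  then show ?case unfolding eq using sums_If_finite[of "\<lambda>w. w = (0::nat)" "\<lambda>_. 1 :: complex"]
      sums_If_finite[of "\<lambda>w. w = (0::nat)" "\<lambda>_. 1 :: real"]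
    by (simp add: sums_iff)
next
  case (Suc t)
  let ?a = "\<lambda>n. of_nat (card (partitions_of n)) * x ^ n"
  let ?b = "\<lambda>w. of_nat (fps_nth (partitions_fps ^ t) w) * x ^ w"
  have eq: "of_nat (fps_nth (partitions_fps ^ Suc t) w) * x ^ w = (\<Sum>i\<le>w. ?a i * ?b (w - i))" for w
  proof -
    have "of_nat (fps_nth (partitions_fps ^ Suc t) w) * x ^ w =
        (\<Sum>i\<le>w. of_nat (card (partitions_of i)) * of_nat (fps_nth (partitions_fps ^ t) (w - i)) * x ^ w)"
      by (simp add: fps_mult_nth partitions_fps_def atLeast0AtMost sum_distrib_right)
    also have "\<dots> = (\<Sum>i\<le>w. ?a i * ?b (w - i))"
    proof (rule sum.cong)
      fix i assume "i \<in> {..w}"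
      then have "x ^ w = x ^ i * x ^ (w - i)" by (simp flip: power_add)
      then show "of_nat (card (partitions_of i)) * of_nat (fps_nth (partitions_fps ^ t) (w - i)) * x ^ w = ?a i * ?b (w - i)"
        by (simp only: mult_ac)
    qed simp
    finally show ?thesis .
  qed
  have A: "summable (\<lambda>n. norm (?a n))" "(\<Sum>n. ?a n) = 1 / euler_fun x"
    using partitions_sums[OF assms] by blast+
  have B: "summable (\<lambda>n. norm (?b n))" "(\<Sum>n. ?b n) = (1 / euler_fun x) ^ t"
    using Suc.IH by blast+
  have "summable (\<lambda>k. norm (\<Sum>i\<le>k. ?a i * ?b (k - i)))"
    by (rule abs_summable_Cauchy_product[OF A(1) B(1)])
  moreover have "(\<Sum>k. \<Sum>i\<le>k. ?a i * ?b (k - i)) = (1 / euler_fun x) * (1 / euler_fun x) ^ t"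
    using Cauchy_product[OF A(1) B(1)] A(2) B(2) by simp
  ultimately show ?case unfolding eq by simp
qed

text \<open>The sum over \<open>w\<close> is a Cauchy product once the coefficients of the
  \<open>t\<close>-th power are spread over the multiples of \<open>t\<close>. It is used at
  \<open>y = 1\<close> and \<open>y = - 1\<close>.\<close>

lemma weighted_gf:
  fixes q y :: complex
  assumes q: "norm q < 1" and t: "t > 0" and y: "norm y = 1"
    and f: "\<And>n. f n = (\<Sum>w | t * w \<le> n. of_nat (weight_count t (n - t * w) 0) *
                     (of_nat (fps_nth (partitions_fps ^ t) w) * y ^ w))"
  shows "summable (\<lambda>n. norm (f n * q ^ n))"
    "(\<Sum>n. f n * q ^ n) = (\<Sum>n. of_nat (weight_count t n 0) * q ^ n) * (1 / euler_fun (y * q ^ t)) ^ t"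
proof -
  let ?P = "\<lambda>w. of_nat (fps_nth (partitions_fps ^ t) w) :: complex"
  let ?a = "\<lambda>n. of_nat (weight_count t n 0) * q ^ n"
  define d where "d m = (if t dvd m then ?P (m div t) * y ^ (m div t) * q ^ m else 0)" for m
  have x: "norm (y * q ^ t) < 1"
    using q t y by (simp add: norm_mult norm_power power_less_one_iff)
  have mono: "strict_mono (\<lambda>w. t * w)" using t by (auto simp: strict_mono_def)
  have d_eq: "d (t * w) = ?P w * (y * q ^ t) ^ w" for w
    using t by (simp add: d_def power_mult_distrib power_mult)
  have d0: "d m = 0" if "m \<notin> range (\<lambda>w. t * w)" for m
    using that by (auto simp: d_def dvd_def)
  note P = partitions_fps_power_sums[OF x, of t]
  have D1: "summable (\<lambda>m. norm (d m))"
    using summable_mono_reindex[OF mono, of "\<lambda>m. norm (d m)"] d0 P by (simp add: d_eq)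
  have D2: "(\<Sum>m. d m) = (1 / euler_fun (y * q ^ t)) ^ t"
    using suminf_mono_reindex[OF mono, of d] d0 P by (simp add: d_eq)
  have A: "summable (\<lambda>n. norm (?a n))"
  proof (rule summable_comparison_test'[where N = 0])
    show "summable (\<lambda>n. norm (of_nat (card (partitions_of n)) * q ^ n))" by (rule partitions_sums(1)[OF q])
    fix n
    have "weight_count t n 0 \<le> card (partitions_of n)"
      unfolding weight_count_def by (rule card_mono[OF finite_partitions_of]) auto
    then show "norm (norm (?a n)) \<le> norm (of_nat (card (partitions_of n)) * q ^ n)"
      by (simp add: norm_mult mult_right_mono)
  qed
  have eq: "f n * q ^ n = (\<Sum>i\<le>n. d i * ?a (n - i))" for n
  proof -
    have "f n * q ^ n = (\<Sum>w | t * w \<le> n. d (t * w) * ?a (n - t * w))"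
      unfolding f sum_distrib_right
    proof (rule sum.cong)
      fix w assume "w \<in> {w. t * w \<le> n}"
      then have "q ^ n = (q ^ t) ^ w * q ^ (n - t * w)" by (simp flip: power_add power_mult)
      then show "of_nat (weight_count t (n - t * w) 0) * (?P w * y ^ w) * q ^ n = d (t * w) * ?a (n - t * w)"
        by (simp only: d_eq power_mult_distrib mult_ac)
    qed simp
    also have "\<dots> = (\<Sum>i\<in>(\<lambda>w. t * w) ` {w. t * w \<le> n}. d i * ?a (n - i))"
      using t by (subst sum.reindex) (auto simp: inj_on_def)
    also have "\<dots> = (\<Sum>i\<le>n. d i * ?a (n - i))"
    proof (rule sum.mono_neutral_left)
      show "\<forall>i\<in>{..n} - (\<lambda>w. t * w) ` {w. t * w \<le> n}. d i * ?a (n - i) = 0"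
      proof
        fix i assume i: "i \<in> {..n} - (\<lambda>w. t * w) ` {w. t * w \<le> n}"
        then have "i \<notin> range (\<lambda>w. t * w)" by auto
        then show "d i * ?a (n - i) = 0" using d0 by simp
      qed
    qed auto
    finally show ?thesis .
  qed
  show "summable (\<lambda>n. norm (f n * q ^ n))"
    unfolding eq by (rule abs_summable_Cauchy_product[OF D1 A])
  show "(\<Sum>n. f n * q ^ n) = (\<Sum>n. ?a n) * (1 / euler_fun (y * q ^ t)) ^ t"
    unfolding eq using Cauchy_product[OF D1 A] D2 by (simp add: mult.commute)
qed

definition p_diff :: "nat \<Rightarrow> nat \<Rightarrow> int" where
  "p_diff t n = int (p_even t n) - int (p_odd t n)"

definition hook_gf :: "nat \<Rightarrow> complex \<Rightarrow> complex" where
  "hook_gf t q = euler_fun (q ^ t) ^ t / (euler_fun q * euler_fun (- (q ^ t)) ^ t)"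

theorem p_diff_gf:
  assumes t: "t > 0" and q: "norm q < 1"
  shows "summable (\<lambda>n. norm (of_int (p_diff t n) * q ^ n))"
    "(\<Sum>n. of_int (p_diff t n) * q ^ n) = hook_gf t q"
proof -
  let ?C = "\<Sum>n. of_nat (weight_count t n 0) * q ^ n"
  have 1: "complex_of_nat (card (partitions_of n)) = (\<Sum>w | t * w \<le> n. of_nat (weight_count t (n - t * w) 0) *
                     (of_nat (fps_nth (partitions_fps ^ t) w) * 1 ^ w))" for n
    unfolding card_partitions_eq_sum_weights[OF t, of n] by simp
  have 2: "complex_of_int (p_diff t n) = (\<Sum>w | t * w \<le> n. of_nat (weight_count t (n - t * w) 0) *
                     (of_nat (fps_nth (partitions_fps ^ t) w) * (- 1) ^ w))" for n
    unfolding p_diff_def p_even_minus_p_odd[OF t, of n] by simp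
  \<comment> \<open>The case \<open>y = 1\<close> is solved for the generating function
    \<open>?C\<close> of the t-cores, which the case \<open>y = - 1\<close> then multiplies.\<close>
  have "1 / euler_fun q = ?C * (1 / euler_fun (1 * q ^ t)) ^ t"
    using weighted_gf(2)[OF q t _ 1] partitions_sums(2)[OF q] by simp
  then have C: "?C = euler_fun (q ^ t) ^ t / euler_fun q"
    using euler_fun_nz[of q] euler_fun_nz[of "q ^ t"] by (simp add: field_simps)
  show "summable (\<lambda>n. norm (of_int (p_diff t n) * q ^ n))"
    using weighted_gf(1)[OF q t _ 2] by simp
  have "(\<Sum>n. of_int (p_diff t n) * q ^ n) = ?C * (1 / euler_fun (- 1 * q ^ t)) ^ t"
    using weighted_gf(2)[OF q t _ 2] by simp
  then show "(\<Sum>n. of_int (p_diff t n) * q ^ n) = hook_gf t q"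
    unfolding C by (simp add: hook_gf_def power_divide)
qed

section \<open>Shanks' finite form of the pentagonal number theorem\<close>

definition shanks_term :: "complex \<Rightarrow> nat \<Rightarrow> nat \<Rightarrow> complex" where
  "shanks_term q n i = (- 1) ^ i * (\<Prod>r=Suc i..n. 1 - q ^ r) * q ^ (n * i + \<Sum>{..i})"

text \<open>Passing from \<open>n\<close> to \<open>Suc n\<close> changes each summand by two
  corrections, and the second one at \<open>i\<close> cancels the first one at \<open>Suc i\<close>.
  Only \<open>B n\<close> and the new last summand remain; they give the two pentagonal
  terms.\<close>

lemma shanks_step:
  "(\<Sum>i\<le>Suc n. shanks_term q (Suc n) i) = (\<Sum>i\<le>n. shanks_term q n i) +
     (- 1) ^ Suc n * (q ^ (Suc n * Suc n + \<Sum>{..n}) + q ^ (Suc n * Suc n + \<Sum>{..Suc n}))"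
proof -
  define N where "N = Suc n"
  define P where "P i = (\<Prod>r=Suc i..n. 1 - q ^ r)" for i
  define T where "T i = (\<Sum>{..i} :: nat)" for i
  define B where "B i = (- 1) ^ i * P i * q ^ (N * Suc i + T i)" for i
  have T_Suc: "T (Suc i) = T i + Suc i" for i by (simp add: T_def)
  have P_Suc: "P i = (1 - q ^ Suc i) * P (Suc i)" if "i < n" for i
    using that unfolding P_def by (subst prod.atLeast_Suc_atMost) auto
  have summand: "shanks_term q N i = (- 1) ^ i * P i * (1 - q ^ N) * q ^ (N * i + T i)" if "i \<le> n" for i
    using that by (simp add: shanks_term_def P_def T_def N_def prod.nat_ivl_Suc')
  have diff: "shanks_term q N i = shanks_term q n i - (if i = 0 then 0 else (- 1) ^ i * P (i - 1) * q ^ (n * i + T i)) - B i"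
    if "i \<le> n" for i
  proof (cases i)
    case 0
    then show ?thesis using summand[of 0] by (simp add: shanks_term_def B_def P_def T_def N_def algebra_simps)
  next
    case (Suc j)
    define X where "X = (- 1) ^ i * P i * q ^ (n * i + T i)"
    have e: "q ^ (N * i + T i) = q ^ i * q ^ (n * i + T i)" by (simp add: N_def power_add)
    have "(- 1) ^ i * P (i - 1) * q ^ (n * i + T i) = (1 - q ^ i) * X"
      using P_Suc[of j] Suc that by (simp add: X_def)
    moreover have "shanks_term q n i = X"
      by (simp add: shanks_term_def P_def T_def X_def)
    moreover have "B i = q ^ N * q ^ i * X"
      unfolding B_def X_def mult_Suc_right add.assoc power_add[of q N] e by (simp only: mult_ac)
    moreover have "shanks_term q N i = (1 - q ^ N) * q ^ i * X"
      unfolding summand[OF that] e X_def by (simp only: mult_ac)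
    ultimately show ?thesis using Suc by (simp only: if_False nat.distinct) (simp add: algebra_simps)
  qed
  have tele: "(\<Sum>i\<le>n. if i = 0 then 0 else (- 1) ^ i * P (i - 1) * q ^ (n * i + T i)) = - (\<Sum>i<n. B i)"
  proof -
    have "(\<Sum>i\<le>n. if i = 0 then 0 else (- 1) ^ i * P (i - 1) * q ^ (n * i + T i)) =
       (\<Sum>i<n. (- 1) ^ Suc i * P i * q ^ (n * Suc i + T (Suc i)))"
      by (subst sum.atMost_shift) simp
    also have "\<dots> = - (\<Sum>i<n. B i)"
      unfolding sum_negf[symmetric]
      by (intro sum.cong) (simp_all add: B_def N_def T_Suc algebra_simps)
    finally show ?thesis .
  qed
  have "(\<Sum>i\<le>n. shanks_term q N i) = (\<Sum>i\<le>n. shanks_term q n i) + (\<Sum>i<n. B i) - (\<Sum>i\<le>n. B i)"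
    using diff tele by (simp add: sum_subtractf)
  also have "(\<Sum>i\<le>n. B i) = (\<Sum>i<n. B i) + B n" by (simp add: lessThan_Suc_atMost[symmetric])
  finally have "(\<Sum>i\<le>n. shanks_term q N i) = (\<Sum>i\<le>n. shanks_term q n i) - B n" by simp
  moreover have "B n = (- 1) ^ n * q ^ (N * N + T n)" by (simp add: B_def P_def N_def)
  moreover have "shanks_term q N N = (- 1) ^ N * q ^ (N * N + T N)" by (simp add: shanks_term_def T_def)
  ultimately show ?thesis by (simp add: N_def T_def algebra_simps)
qed

lemma shanks_identity:
  "(\<Sum>i\<le>n. shanks_term q n i) =
     1 + (\<Sum>k<n. (- 1) ^ Suc k * (q ^ (Suc k * Suc k + \<Sum>{..k}) + q ^ (Suc k * Suc k + \<Sum>{..Suc k})))"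
proof (induction n)
  case 0
  show ?case by (simp add: shanks_term_def)
next
  case (Suc n)
  then show ?case unfolding shanks_step by simp
qed

text \<open>In Shanks' sum the term \<open>i = 0\<close> is the partial product itself. Each of the
  other \<open>n\<close> terms is at most a constant times \<open>r ^ n\<close>, so only the product
  survives in the limit.\<close>

theorem pentagonal_number_theorem:
  assumes "norm q < 1"
  shows "(\<lambda>k. (- 1) ^ Suc k * (q ^ (Suc k * Suc k + \<Sum>{..k}) + q ^ (Suc k * Suc k + \<Sum>{..Suc k})))
    sums (euler_fun q - 1)"
proof -
  define r where "r = norm q"
  have r: "0 \<le> r" "r < 1" using assms by (auto simp: r_def)
  define K where "K = exp (r / (1 - r))"
  have prod_le: "norm (\<Prod>k=Suc i..n. 1 - q ^ k) \<le> K" for i n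
  proof -
    have "norm (\<Prod>k=Suc i..n. 1 - q ^ k) \<le> (\<Prod>k=Suc i..n. exp (r ^ k))"
      unfolding prod_norm[symmetric]
    proof (rule prod_mono, safe)
      fix k
      have "norm (1 - q ^ k) \<le> 1 + r ^ k"
        using norm_triangle_ineq4[of 1 "q ^ k"] by (simp add: r_def norm_power)
      also have "\<dots> \<le> exp (r ^ k)" by (rule exp_ge_add_one_self)
      finally show "norm (1 - q ^ k) \<le> exp (r ^ k)" .
    qed simp
    also have "\<dots> = exp (\<Sum>k=Suc i..n. r ^ k)" by (simp add: exp_sum)
    also have "(\<Sum>k=Suc i..n. r ^ k) \<le> (\<Sum>k\<in>{1..n}. r ^ k)"
      using r by (intro sum_mono2) auto
    also have "(\<Sum>k\<in>{1..n}. r ^ k) = (\<Sum>k<n. r * r ^ k)"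
      by (rule sum.reindex_bij_witness[of _ Suc "\<lambda>k. k - 1"]) (auto simp: power_eq_if)
    also have "\<dots> = r * (\<Sum>k<n. r ^ k)" by (simp add: sum_distrib_left)
    also have "(\<Sum>k<n. r ^ k) \<le> (\<Sum>k. r ^ k)"
      using r by (intro sum_le_suminf summable_geometric) auto
    also have "(\<Sum>k. r ^ k) = 1 / (1 - r)" using r by (intro suminf_geometric) auto
    finally show ?thesis using r by (simp add: K_def mult_left_mono)
  qed
  have rest: "norm ((\<Sum>i\<le>n. shanks_term q n i) - (\<Prod>k=1..n. 1 - q ^ k)) \<le> real n * (K * r ^ n)" for n
  proof -
    have "(\<Sum>i\<le>n. shanks_term q n i) = (\<Prod>k=1..n. 1 - q ^ k) + (\<Sum>i=1..n. shanks_term q n i)"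
      by (simp add: sum.atLeast_Suc_atMost[of 0 n] shanks_term_def flip: atLeast0AtMost)
    then have "norm ((\<Sum>i\<le>n. shanks_term q n i) - (\<Prod>k=1..n. 1 - q ^ k)) \<le> (\<Sum>i=1..n. norm (shanks_term q n i))"
      by (simp add: sum_norm_le)
    also have "\<dots> \<le> (\<Sum>i=1..n. K * r ^ n)"
    proof (rule sum_mono)
      fix i assume i: "i \<in> {1..n}"
      have "norm (shanks_term q n i) = norm (\<Prod>k=Suc i..n. 1 - q ^ k) * r ^ (n * i + \<Sum>{..i})"
        by (simp add: shanks_term_def norm_mult norm_power r_def)
      also have "\<dots> \<le> K * r ^ n"
      proof (rule mult_mono[OF prod_le])
        have "n \<le> n * i" using i by simp
        then have "n \<le> n * i + \<Sum>{..i}" by (rule trans_le_add1)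
        then show "r ^ (n * i + \<Sum>{..i}) \<le> r ^ n" using r by (intro power_decreasing) auto
      qed (use r in \<open>auto simp: K_def\<close>)
      finally show "norm (shanks_term q n i) \<le> K * r ^ n" .
    qed
    finally show ?thesis by simp
  qed
  have "(\<lambda>n. real n * r ^ n) \<longlonglongrightarrow> 0" using r by (intro powser_times_n_limit_0) auto
  then have "(\<lambda>n. K * (real n * r ^ n)) \<longlonglongrightarrow> K * 0" by (intro tendsto_intros)
  then have "(\<lambda>n. real n * (K * r ^ n)) \<longlonglongrightarrow> 0" by (simp add: mult_ac)
  then have "(\<lambda>n. (\<Sum>i\<le>n. shanks_term q n i) - (\<Prod>k=1..n. 1 - q ^ k)) \<longlonglongrightarrow> 0"
    by (rule Lim_null_comparison[rotated]) (use rest in auto)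
  from tendsto_add[OF this tendsto_prod_euler_fun[OF assms]]
  have "(\<lambda>n. \<Sum>i\<le>n. shanks_term q n i) \<longlonglongrightarrow> euler_fun q" by simp
  from tendsto_diff[OF this tendsto_const[of 1]] show ?thesis
    unfolding shanks_identity sums_def by simp
qed

section \<open>Inversion of the theta function\<close>

lemma infsum_int_eq_suminf:
  fixes f :: "int \<Rightarrow> 'a :: banach"
  assumes "(\<lambda>k. norm (f k)) summable_on UNIV"
  shows "summable (\<lambda>n. norm (f (int_decode n)))" "infsum f UNIV = (\<Sum>n. f (int_decode n))"
proof -
  have "(\<lambda>n. norm (f (int_decode n))) summable_on UNIV"
    using summable_on_reindex_bij_betw[OF bij_int_decode, of "\<lambda>k. norm (f k)"] assms by simp
  then show s: "summable (\<lambda>n. norm (f (int_decode n)))"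
    by (subst (asm) summable_on_UNIV_nonneg_real_iff) auto
  have "infsum f UNIV = infsum (\<lambda>n. f (int_decode n)) UNIV"
    using infsum_reindex_bij_betw[OF bij_int_decode, of f] by simp
  also have "\<dots> = (\<Sum>n. f (int_decode n))"
    by (intro infsumI norm_summable_imp_has_sum s summable_sums summable_norm_cancel)
  finally show "infsum f UNIV = (\<Sum>n. f (int_decode n))" .
qed

text \<open>Tannery's theorem transported along \<open>int_decode\<close>; absolute domination makes
  the order of enumeration immaterial.\<close>

lemma tannery_int:
  fixes a :: "int \<Rightarrow> 'b \<Rightarrow> 'a :: {real_normed_algebra, banach}"
  assumes lim: "\<And>k. (a k \<longlongrightarrow> b k) F"
    and bound: "\<forall>\<^sub>F n in F. \<forall>k. norm (a k n) \<le> M k"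
    and M: "M summable_on UNIV" and F: "F \<noteq> bot"
  shows "((\<lambda>n. infsum (\<lambda>k. a k n) UNIV) \<longlongrightarrow> infsum b UNIV) F"
proof -
  have bM: "norm (b k) \<le> M k" for k
    by (rule tendsto_upperbound[OF tendsto_norm[OF lim] _ F]) (use bound in \<open>auto elim: eventually_mono\<close>)
  have M0: "0 \<le> M k" for k using bM[of k] norm_ge_zero order_trans by blast
  have sM: "summable (\<lambda>n. M (int_decode n))"
    using infsum_int_eq_suminf(1)[of M] M M0 by simp
  have A: "((\<lambda>n. \<Sum>i. a (int_decode i) n) \<longlongrightarrow> (\<Sum>i. b (int_decode i))) F"
  proof (rule tannerys_theorem[THEN conjunct2, THEN conjunct2])
    show "\<forall>\<^sub>F (k, n) in at_top \<times>\<^sub>F F. norm (a (int_decode k) n) \<le> M (int_decode k)"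
      unfolding eventually_prod_filter
      by (intro exI[of _ "\<lambda>_. True"] exI[of _ "\<lambda>n. \<forall>k. norm (a k n) \<le> M k"]) (use bound in auto)
  qed (use lim sM F in auto)
  have B: "(\<Sum>i. b (int_decode i)) = infsum b UNIV"
    by (rule infsum_int_eq_suminf(2)[symmetric], rule Infinite_Sum.abs_summable_on_comparison_test'[OF M]) (use bM in auto)
  have C: "\<forall>\<^sub>F n in F. (\<Sum>i. a (int_decode i) n) = infsum (\<lambda>k. a k n) UNIV"
    using bound
  proof eventually_elim
    case (elim n)
    then show ?case
      by (intro infsum_int_eq_suminf(2)[symmetric] Infinite_Sum.abs_summable_on_comparison_test'[OF M]) auto
  qed
  show ?thesis using Lim_transform_eventually[OF A C] unfolding B .
qed

lemma summable_on_int_power_abs: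
  fixes r :: real
  assumes "0 \<le> r" "r < 1"
  shows "(\<lambda>k::int. r ^ nat \<bar>k\<bar>) summable_on UNIV"
proof -
  have s: "(\<lambda>n::nat. r ^ n) summable_on UNIV"
    using assms by (subst summable_on_UNIV_nonneg_real_iff) (auto intro: summable_geometric)
  have 1: "(\<lambda>k::int. r ^ nat \<bar>k\<bar>) summable_on {0..}"
    by (rule summable_on_reindex_bij_witness[of UNIV nat int, THEN iffD1, OF _ _ _ _ _ s]) auto
  have "(\<lambda>n::nat. r * r ^ n) summable_on UNIV" by (intro summable_on_cmult_right s)
  then have 2: "(\<lambda>k::int. r ^ nat \<bar>k\<bar>) summable_on {..<0}"
    by (rule summable_on_reindex_bij_witness[of UNIV "\<lambda>k. nat (- k - 1)" "\<lambda>n. - int n - 1", THEN iffD1, rotated -1])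
      (auto simp: nat_add_distrib simp flip: power_Suc)
  have "(UNIV :: int set) = {0..} \<union> {..<0}" "{0..} \<inter> {..<0::int} = {}" by auto
  then show ?thesis using summable_on_Un_disjoint[OF 1 2] by metis
qed

text \<open>Comparison with a geometric series, from (k + b)^2 >= k^2 / 2 - b^2 and k^2 >=
  |k|.\<close>

lemma summable_on_gaussian:
  fixes A b :: real
  assumes "A > 0"
  shows "(\<lambda>k::int. exp (- A * (of_int k + b)\<^sup>2)) summable_on UNIV"
proof (rule summable_on_comparison_test)
  show "(\<lambda>k::int. exp (A * b\<^sup>2) * exp (- A / 2) ^ nat \<bar>k\<bar>) summable_on UNIV"
    using assms by (intro summable_on_cmult_right summable_on_int_power_abs) auto
  fix k :: int
  have "real (nat \<bar>k\<bar>) \<le> (of_int k)\<^sup>2"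
  proof -
    have "\<bar>k\<bar> \<le> k\<^sup>2"
    proof (cases "k = 0")
      case False
      then have "1 \<le> \<bar>k\<bar>" by linarith
      then have "\<bar>k\<bar> * 1 \<le> \<bar>k\<bar> * \<bar>k\<bar>" by (intro mult_left_mono) auto
      then show ?thesis by (simp add: power2_eq_square)
    qed simp
    then have "real_of_int \<bar>k\<bar> \<le> real_of_int (k\<^sup>2)" by linarith
    then show ?thesis by simp
  qed
  moreover have "(of_int k)\<^sup>2 / 2 - b\<^sup>2 \<le> (of_int k + b)\<^sup>2"
    using zero_le_power2[of "of_int k + 2 * b"] by (simp add: power2_eq_square algebra_simps)
  ultimately have "real (nat \<bar>k\<bar>) / 2 - b\<^sup>2 \<le> (of_int k + b)\<^sup>2" by linarith
  then have "A * (real (nat \<bar>k\<bar>) / 2 - b\<^sup>2) \<le> A * (of_int k + b)\<^sup>2"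
    using assms by (intro mult_left_mono) auto
  then have "- A * (of_int k + b)\<^sup>2 \<le> A * b\<^sup>2 + real (nat \<bar>k\<bar>) * (- A / 2)" by (simp add: algebra_simps)
  then have "exp (- A * (of_int k + b)\<^sup>2) \<le> exp (A * b\<^sup>2 + real (nat \<bar>k\<bar>) * (- A / 2))" by simp
  then show "exp (- A * (of_int k + b)\<^sup>2) \<le> exp (A * b\<^sup>2) * exp (- A / 2) ^ nat \<bar>k\<bar>"
    by (simp only: exp_add exp_of_nat_mult)
qed auto

text \<open>(1 - d) / (1 + d) is exp (-2 artanh d), and artanh d = d + d^3 / 3 + ... exceeds d by at
  most d^3 / 2 on this range. The matching upper bound is \<open>ratio_le_exp\<close>.\<close>

lemma ln_ratio_bounds:
  fixes d :: real
  assumes "0 \<le> d" "d \<le> 1 / 2"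
  shows "exp (- 2 * d - d ^ 3) \<le> (1 - d) / (1 + d)"
proof -
  have "2 * x + x ^ 3 - ln (1 + x) + ln (1 - x) \<ge> 2 * 0 + 0 ^ 3 - ln (1 + 0) + ln (1 - 0)"
    if x: "0 \<le> x" "x \<le> 1 / 2" for x :: real
  proof (rule DERIV_nonneg_imp_nondecreasing[of 0 x "\<lambda>x. 2 * x + x ^ 3 - ln (1 + x) + ln (1 - x)"])
    fix y assume y: "0 \<le> y" "y \<le> x"
    have y2: "y\<^sup>2 \<le> 1 / 4" using y x power_mono[of y "1 / 2" 2] by (simp add: power2_eq_square)
    have "((\<lambda>x. 2 * x + x ^ 3 - ln (1 + x) + ln (1 - x)) has_real_derivative
        (2 + 3 * y\<^sup>2 - 1 / (1 + y) - 1 / (1 - y))) (at y)"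
      using y x by (auto intro!: derivative_eq_intros simp: power2_eq_square)
    moreover have "1 / (1 + y) + 1 / (1 - y) = 2 / (1 - y\<^sup>2)"
      using y x by (simp add: field_simps power2_eq_square)
    moreover have "2 / (1 - y\<^sup>2) \<le> 2 + 3 * y\<^sup>2"
    proof -
      have "2 \<le> (2 + 3 * y\<^sup>2) * (1 - y\<^sup>2)"
      proof -
        have "(2 + 3 * y\<^sup>2) * (1 - y\<^sup>2) - 2 = y\<^sup>2 * (1 - 3 * y\<^sup>2)" by (simp add: algebra_simps)
        moreover have "0 \<le> y\<^sup>2 * (1 - 3 * y\<^sup>2)" using y2 by (intro mult_nonneg_nonneg) auto
        ultimately show ?thesis by linarith
      qed
      then show ?thesis using y2 by (simp add: pos_divide_le_eq)
    qed
    ultimately show "\<exists>D. ((\<lambda>x. 2 * x + x ^ 3 - ln (1 + x) + ln (1 - x)) has_real_derivative D) (at y) \<and> 0 \<le> D"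
      by (intro exI[of _ "2 + 3 * y\<^sup>2 - 1 / (1 + y) - 1 / (1 - y)"] conjI) (assumption, linarith)
  qed (use x in auto)
  from this[of d] have "- 2 * d - d ^ 3 \<le> ln (1 - d) - ln (1 + d)" using assms by simp
  also have "\<dots> = ln ((1 - d) / (1 + d))" using assms by (simp add: ln_div)
  finally have "exp (- 2 * d - d ^ 3) \<le> exp (ln ((1 - d) / (1 + d)))" by simp
  then show ?thesis using assms by simp
qed

lemma ratio_le_exp:
  fixes d :: real
  assumes "0 \<le> d" "d \<le> 1"
  shows "(1 - d) / (1 + d) \<le> exp (- 2 * d)"
proof (cases "d = 1")
  case False
  have "ln (1 + x) - ln (1 - x) - 2 * x \<ge> ln (1 + 0) - ln (1 - 0) - 2 * 0" if x: "0 \<le> x" "x < 1" for x :: real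
  proof (rule DERIV_nonneg_imp_nondecreasing[of 0 x "\<lambda>x. ln (1 + x) - ln (1 - x) - 2 * x"])
    fix y assume y: "0 \<le> y" "y \<le> x"
    have y2: "y\<^sup>2 < 1" using y x power_strict_mono[of y 1 2] by simp
    have "((\<lambda>x. ln (1 + x) - ln (1 - x) - 2 * x) has_real_derivative
        (1 / (1 + y) + 1 / (1 - y) - 2)) (at y)"
      using y x by (auto intro!: derivative_eq_intros)
    moreover have "1 / (1 + y) + 1 / (1 - y) = 2 / (1 - y\<^sup>2)"
      using y x by (simp add: field_simps power2_eq_square)
    moreover have "2 / (1 - y\<^sup>2) \<ge> 2" using y2 by (simp add: pos_le_divide_eq)
    ultimately show "\<exists>D. ((\<lambda>x. ln (1 + x) - ln (1 - x) - 2 * x) has_real_derivative D) (at y) \<and> 0 \<le> D"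
      by (intro exI[of _ "1 / (1 + y) + 1 / (1 - y) - 2"] conjI) (assumption, linarith)
  qed (use x in auto)
  from this[of d] have "ln (1 - d) - ln (1 + d) \<le> - 2 * d" using assms False by simp
  moreover have "ln (1 - d) - ln (1 + d) = ln ((1 - d) / (1 + d))" using assms False by (simp add: ln_div)
  ultimately have "exp (ln ((1 - d) / (1 + d))) \<le> exp (- 2 * d)" by simp
  then show ?thesis using assms False by simp
qed simp

section \<open>Binomial coefficients near the centre\<close>

definition central_ratio :: "nat \<Rightarrow> nat \<Rightarrow> real" where
  "central_ratio M v = real ((2 * M) choose (M + v)) / real ((2 * M) choose M)"

lemma central_ratio_0: "central_ratio M 0 = 1"
  by (simp add: central_ratio_def)

text \<open>With this \<open>d\<close> the quotient (M - v) / (M + v + 1) becomes (1 - d) / (1 + d).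
  The first-order exponents -2 d then add up exactly to -2 v^2 / (2 M + 1), because the odd numbers
  sum to squares.\<close>

lemma central_ratio_Suc:
  assumes "v < M"
  defines "d \<equiv> (2 * real v + 1) / (2 * real M + 1)"
  shows "central_ratio M (Suc v) = central_ratio M v * ((1 - d) / (1 + d))"
proof -
  have "Suc (M + v) * ((2 * M) choose Suc (M + v)) = (2 * M - (M + v)) * ((2 * M) choose (M + v))"
    by (metis binomial_absorb_comp binomial_absorption mult.commute)
  then have "real (Suc (M + v)) * real ((2 * M) choose (M + Suc v)) = real (2 * M - (M + v)) * real ((2 * M) choose (M + v))"
    by (metis add_Suc_right of_nat_mult)
  moreover have "real (2 * M - (M + v)) = real M - real v" using assms(1) by (simp add: of_nat_diff)
  ultimately have "real (Suc (M + v)) * real ((2 * M) choose (M + Suc v)) = (real M - real v) * real ((2 * M) choose (M + v))"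
    by simp
  then have "real ((2 * M) choose (M + Suc v)) = (real M - real v) / (real M + real v + 1) * real ((2 * M) choose (M + v))"
    by (simp add: field_simps)
  moreover have "(1 - d) / (1 + d) = (real M - real v) / (real M + real v + 1)"
  proof -
    have "1 - d = (real M - real v) * (2 / (2 * real M + 1))" "1 + d = (real M + real v + 1) * (2 / (2 * real M + 1))"
      by (simp_all add: d_def field_simps)
    then show ?thesis by (simp only:) (simp del: times_divide_eq_right)
  qed
  ultimately show ?thesis by (simp add: central_ratio_def mult_ac)
qed

lemma central_ratio_nonneg: "0 \<le> central_ratio M v"
  by (simp add: central_ratio_def)

lemma central_ratio_le: "central_ratio M v \<le> exp (- 2 * (real v)\<^sup>2 / (2 * real M + 1))"
proof (cases "v \<le> M")
  case False
  then show ?thesis by (simp add: central_ratio_def binomial_eq_0)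
next
  case True
  then show ?thesis
  proof (induction v)
    case (Suc v)
    define d where "d = (2 * real v + 1) / (2 * real M + 1)"
    have d: "0 \<le> d" "d \<le> 1" using Suc.prems by (auto simp: d_def field_simps)
    have "central_ratio M (Suc v) = central_ratio M v * ((1 - d) / (1 + d))"
      unfolding d_def by (rule central_ratio_Suc) (use Suc.prems in simp)
    also have "\<dots> \<le> exp (- 2 * (real v)\<^sup>2 / (2 * real M + 1)) * exp (- 2 * d)"
      using Suc ratio_le_exp[OF d] d by (intro mult_mono) auto
    also have "\<dots> = exp (- 2 * (real (Suc v))\<^sup>2 / (2 * real M + 1))"
      unfolding exp_add[symmetric]
      by (simp add: d_def power2_eq_square add_divide_distrib diff_divide_distrib algebra_simps)
    finally show ?case .
  qed (simp add: central_ratio_0)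
qed

text \<open>The condition \<open>4 * v \<le> M\<close> keeps every \<open>d\<close> below 1/2. Each
  of the \<open>v\<close> steps loses at most the cube of \<open>2 * v / M\<close>; for
  \<open>v\<close> of order sqrt M the total loss tends to 0.\<close>

lemma central_ratio_ge:
  assumes "v \<le> M" "4 * v \<le> M"
  shows "exp (- 2 * (real v)\<^sup>2 / (2 * real M + 1) - real v * (2 * real v / real M) ^ 3) \<le> central_ratio M v"
proof -
  have *: "exp (- 2 * (real u)\<^sup>2 / (2 * real M + 1) - real u * (2 * real v / real M) ^ 3) \<le> central_ratio M u"
    if "u \<le> v" for u
    using that
  proof (induction u)
    case (Suc u)
    define d where "d = (2 * real u + 1) / (2 * real M + 1)"
    have M: "real M > 0" using Suc.prems assms by auto
    have u: "real u + 1 \<le> real v" using Suc.prems by linarith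
    have v: "4 * real v \<le> real M" using assms by linarith
    have d: "0 \<le> d" "d \<le> 1 / 2" using M u v by (auto simp: d_def field_simps)
    have "d \<le> 2 * real v / real M"
      unfolding d_def using M u by (intro frac_le) auto
    then have d3: "d ^ 3 \<le> (2 * real v / real M) ^ 3" using d by (intro power_mono)
    have "exp (- 2 * (real (Suc u))\<^sup>2 / (2 * real M + 1) - real (Suc u) * (2 * real v / real M) ^ 3) =
       exp (- 2 * (real u)\<^sup>2 / (2 * real M + 1) - real u * (2 * real v / real M) ^ 3) *
       exp (- 2 * d - (2 * real v / real M) ^ 3)"
      unfolding exp_add[symmetric] by (simp add: d_def power2_eq_square add_divide_distrib diff_divide_distrib algebra_simps)
    also have "\<dots> \<le> central_ratio M u * exp (- 2 * d - d ^ 3)"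
      using Suc d3 by (intro mult_mono) (auto simp: central_ratio_nonneg)
    also have "\<dots> \<le> central_ratio M u * ((1 - d) / (1 + d))"
      by (intro mult_left_mono ln_ratio_bounds d central_ratio_nonneg)
    also have "\<dots> = central_ratio M (Suc u)"
      unfolding d_def by (rule central_ratio_Suc[symmetric]) (use Suc.prems assms in simp)
    finally show ?case .
  qed (simp add: central_ratio_0)
  then show ?thesis by simp
qed

text \<open>Wallis' formula, obtained from Euler's limit for Gamma at 1/2.\<close>

lemma central_binomial_asymptotics:
  "(\<lambda>n. sqrt (real n) * real ((2 * n) choose n) / 4 ^ n) \<longlonglongrightarrow> 1 / sqrt pi"
proof -
  have "(\<lambda>n. real n / (real n + 1 / 2) / Gamma_series (1 / 2) n) \<longlonglongrightarrow> 1 / Gamma (1 / 2 :: real)"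
  proof (intro tendsto_divide Gamma_series_LIMSEQ)
    show "(\<lambda>n. real n / (real n + 1 / 2)) \<longlonglongrightarrow> 1" by real_asymp
    show "Gamma (1 / 2 :: real) \<noteq> 0" by (simp add: Gamma_one_half_real)
  qed
  moreover have "\<forall>\<^sub>F n in sequentially. real n / (real n + 1 / 2) / Gamma_series (1 / 2) n =
      sqrt (real n) * real ((2 * n) choose n) / 4 ^ n"
    using eventually_gt_at_top[of 0]
  proof eventually_elim
    case (elim n)
    define C where "C = real ((2 * n) choose n)"
    define p where "p = pochhammer (1 / 2 :: real) n"
    have "C = fact (2 * n) / (fact n * fact n)"
      by (simp add: C_def binomial_fact)
    also have "\<dots> = 4 ^ n * p / fact n"
      by (simp add: p_def fact_double power_mult)
    finally have C: "C / 4 ^ n = p / fact n" by simp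
    have e: "exp (1 / 2 * ln (real n)) = sqrt (real n)"
      using elim by (simp add: ln_sqrt[symmetric])
    have p: "p > 0" unfolding p_def by (rule pochhammer_pos) simp
    have n: "real n + 1 / 2 \<noteq> 0" "real n = sqrt (real n) * sqrt (real n)" "sqrt (real n) \<noteq> 0"
      using elim by auto
    have "Gamma_series (1 / 2) n = fact n * sqrt (real n) / (p * (real n + 1 / 2))"
      using e by (simp add: Gamma_series_def pochhammer_Suc p_def add.commute)
    moreover have "x / y / (f * s / (p * y)) = x / s * (p / f)" if "y \<noteq> 0" for x y f s :: real
      using that by simp
    ultimately have "real n / (real n + 1 / 2) / Gamma_series (1 / 2) n = real n / sqrt (real n) * (p / fact n)"
      using n(1) by (simp only:)
    also have "real n / sqrt (real n) = sqrt (real n)" by (rule real_div_sqrt) simp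
    finally show ?case unfolding C[symmetric] C_def by simp
  qed
  ultimately show ?thesis by (simp add: Gamma_one_half_real tendsto_cong)
qed

text \<open>Supplies the Gaussian majorant that lets the trigonometric side of Polya's identity pass
  to the limit.\<close>

lemma cos_le_exp_gaussian:
  assumes "\<bar>y\<bar> \<le> pi / 2" shows "\<bar>cos y\<bar> \<le> exp (- (y\<^sup>2 / 2))"
proof -
  have *: "cos y \<le> exp (- (y\<^sup>2 / 2))" if y: "0 \<le> y" "y \<le> pi / 2" for y :: real
  proof -
    have g: "x * cos x \<le> sin x" if x: "0 \<le> x" "x \<le> pi / 2" for x :: real
    proof -
      have "sin 0 - 0 * cos 0 \<le> sin x - x * cos x"
      proof (rule DERIV_nonneg_imp_nondecreasing[of 0 x "\<lambda>x. sin x - x * cos x"])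
        fix z assume z: "0 \<le> z" "z \<le> x"
        have "((\<lambda>x. sin x - x * cos x) has_real_derivative (z * sin z)) (at z)"
          by (auto intro!: derivative_eq_intros)
        moreover have "0 \<le> z * sin z" using z x by (intro mult_nonneg_nonneg sin_ge_zero) auto
        ultimately show "\<exists>D. ((\<lambda>x. sin x - x * cos x) has_real_derivative D) (at z) \<and> 0 \<le> D" by blast
      qed (use x in auto)
      then show ?thesis by simp
    qed
    have "exp (y\<^sup>2 / 2) * cos y \<le> exp (0\<^sup>2 / 2) * cos 0"
    proof (rule DERIV_nonpos_imp_nonincreasing[of 0 y "\<lambda>x. exp (x\<^sup>2 / 2) * cos x"])
      fix z assume z: "0 \<le> z" "z \<le> y"
      have "((\<lambda>x. exp (x\<^sup>2 / 2) * cos x) has_real_derivative (exp (z\<^sup>2 / 2) * (z * cos z - sin z))) (at z)"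
        by (auto intro!: derivative_eq_intros simp: algebra_simps)
      moreover have "exp (z\<^sup>2 / 2) * (z * cos z - sin z) \<le> 0"
        using g[of z] z y by (simp add: mult_le_0_iff)
      ultimately show "\<exists>D. ((\<lambda>x. exp (x\<^sup>2 / 2) * cos x) has_real_derivative D) (at z) \<and> D \<le> 0" by blast
    qed (use y in auto)
    then have "cos y \<le> inverse (exp (y\<^sup>2 / 2))" by (simp add: field_simps)
    then show ?thesis by (simp add: exp_minus)
  qed
  have "cos \<bar>y\<bar> \<le> exp (- (\<bar>y\<bar>\<^sup>2 / 2))" by (rule *) (use assms in auto)
  moreover have "0 \<le> cos y" using assms by (intro cos_ge_zero) auto
  ultimately show ?thesis by simp
qed

text \<open>The range is symmetric so that, as \<open>h\<close> grows, each fixed integer frequency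
  eventually belongs to it.\<close>

lemma sum_roots_of_unity:
  fixes h :: nat and n :: int
  assumes "h > 0"
  shows "(\<Sum>j = - int h..<int h. cis (2 * pi * of_int j * of_int n / (2 * real h))) =
    (if int (2 * h) dvd n then of_nat (2 * h) else 0)"
proof -
  define \<rho> where "\<rho> = cis (2 * pi * of_int n / (2 * real h))"
  have pw: "cis (2 * pi * real u * of_int n / (2 * real h)) = \<rho> ^ u" for u :: nat
    by (simp add: \<rho>_def Complex.DeMoivre mult_ac)
  have "(\<Sum>j = - int h..<int h. cis (2 * pi * of_int j * of_int n / (2 * real h))) =
    (\<Sum>u<2 * h. cis (- (2 * pi * real h * of_int n / (2 * real h))) * \<rho> ^ u)"
  proof (rule sum.reindex_bij_witness[of _ "\<lambda>u. int u - int h" "\<lambda>j. nat (j + int h)"])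
    fix j assume j: "j \<in> {- int h..<int h}"
    then have e: "of_int j = real (nat (j + int h)) - real h" by simp
    show "cis (- (2 * pi * real h * of_int n / (2 * real h))) * \<rho> ^ nat (j + int h) =
       cis (2 * pi * of_int j * of_int n / (2 * real h))"
      unfolding pw[symmetric] cis_mult e by (simp add: algebra_simps add_divide_distrib diff_divide_distrib)
  qed auto
  also have "\<dots> = cis (- (2 * pi * real h * of_int n / (2 * real h))) * (\<Sum>u<2 * h. \<rho> ^ u)"
    by (simp add: sum_distrib_left)
  also have "\<dots> = (if int (2 * h) dvd n then of_nat (2 * h) else 0)"
  proof (cases "int (2 * h) dvd n")
    case True
    then obtain m where m: "n = int (2 * h) * m" by auto
    have "2 * pi * of_int n / (2 * real h) = 2 * pi * of_int m" using assms by (simp add: m)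
    then have "\<rho> = 1" by (simp only: \<rho>_def cis_multiple_2pi Ints_of_int)
    moreover have "cis (- (2 * pi * real h * of_int n / (2 * real h))) = 1"
    proof -
      have "- (2 * pi * real h * of_int n / (2 * real h)) = 2 * pi * of_int (- (int h * m))"
        using assms by (simp add: m field_simps)
      then show ?thesis by (simp only: cis_multiple_2pi Ints_of_int)
    qed
    ultimately show ?thesis using True by simp
  next
    case False
    have "\<rho> \<noteq> 1"
    proof
      assume "\<rho> = 1"
      then obtain m :: int where "2 * pi * of_int n / (2 * real h) = of_int m * (2 * pi)"
        unfolding \<rho>_def cis_eq_1_iff by blast
      then have "real_of_int n = of_int (int (2 * h) * m)" using assms by (simp add: field_simps)
      then have "n = int (2 * h) * m" by linarith
      then show False using False by simp
    qed
    moreover have "\<rho> ^ (2 * h) = 1"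
    proof -
      have "real (2 * h) * (2 * pi * of_int n / (2 * real h)) = 2 * pi * of_int n" using assms by simp
      then show ?thesis by (simp only: \<rho>_def Complex.DeMoivre cis_multiple_2pi Ints_of_int)
    qed
    ultimately have "(\<Sum>u<2 * h. \<rho> ^ u) = 0" by (simp add: sum_gp_strict)
    then show ?thesis using False by simp
  qed
  finally show ?thesis .
qed

text \<open>Expand the power of the cosine by the binomial theorem. Summation over the frequencies
  against a character is a root-of-unity filter that keeps only the binomial coefficients at
  positions congruent to \<open>a\<close> mod \<open>2 * h\<close>. It is theta inversion in finite
  form.\<close>

lemma polya_identity:
  fixes h M :: nat and a :: int
  assumes "h > 0"
  shows "(\<Sum>j = - int h..<int h. cis (- (2 * pi * of_int j * of_int a / (2 * real h))) *
            of_real (cos (pi * of_int j / (2 * real h)) ^ (2 * M))) =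
    of_real (real (2 * h) * real ((2 * M) choose M) / 4 ^ M *
       (\<Sum>\<^sub>\<infinity>i::int. central_ratio M (nat \<bar>a + 2 * int h * i\<bar>)))"
proof -
  let ?B = "\<lambda>v::int. real ((2 * M) choose (M + nat \<bar>v\<bar>))"
  let ?S = "{v \<in> {- int M..int M}. 2 * int h dvd v - a}"
  have cos_pow: "of_real ((2 * cos (x / 2)) ^ (2 * M)) = (\<Sum>v = - int M..int M. of_real (?B v) * cis (x * of_int v))"
    for x :: real
  proof -
    have "of_real (2 * cos (x / 2)) = cis (x / 2) + cis (- (x / 2))"
      by (simp add: complex_eq_iff)
    then have "of_real ((2 * cos (x / 2)) ^ (2 * M)) = (cis (x / 2) + cis (- (x / 2))) ^ (2 * M)"
      by (simp only: of_real_power)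
    also have "\<dots> = (\<Sum>u\<le>2 * M. of_nat ((2 * M) choose u) * cis (x / 2) ^ u * cis (- (x / 2)) ^ (2 * M - u))"
      by (rule binomial_ring)
    also have "\<dots> = (\<Sum>v = - int M..int M. of_real (?B v) * cis (x * of_int v))"
    proof (rule sum.reindex_bij_witness[of _ "\<lambda>v. nat (v + int M)" "\<lambda>u. int u - int M"])
      fix u assume u: "u \<in> {..2 * M}"
      have "?B (int u - int M) = real ((2 * M) choose u)"
      proof (cases "M \<le> u")
        case False
        then have e: "M + nat \<bar>int u - int M\<bar> = 2 * M - u" by linarith
        have "(2 * M) choose (2 * M - u) = (2 * M) choose u"
          using u binomial_symmetric[of u "2 * M"] by simp
        then show ?thesis unfolding e by simp
      next
        case True
        then have e: "M + nat \<bar>int u - int M\<bar> = u" by linarith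
        show ?thesis unfolding e ..
      qed
      moreover have "cis (x / 2) ^ u * cis (- (x / 2)) ^ (2 * M - u) = cis (x * of_int (int u - int M))"
        using u unfolding Complex.DeMoivre cis_mult by (simp add: of_nat_diff algebra_simps)
      ultimately show "of_real (?B (int u - int M)) * cis (x * of_int (int u - int M)) =
         of_nat ((2 * M) choose u) * cis (x / 2) ^ u * cis (- (x / 2)) ^ (2 * M - u)"
        by (simp add: mult.assoc)
    qed auto
    finally show ?thesis .
  qed
  have "(\<Sum>j = - int h..<int h. cis (- (2 * pi * of_int j * of_int a / (2 * real h))) *
            of_real ((2 * cos (pi * of_int j / (2 * real h))) ^ (2 * M))) =
     (\<Sum>j = - int h..<int h. \<Sum>v = - int M..int M. of_real (?B v) * cis (2 * pi * of_int j * of_int (v - a) / (2 * real h)))"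
  proof (rule sum.cong)
    fix j
    let ?x = "2 * pi * of_int j / (2 * real h)"
    have e: "pi * of_int j / (2 * real h) = ?x / 2" by simp
    show "cis (- (2 * pi * of_int j * of_int a / (2 * real h))) *
            of_real ((2 * cos (pi * of_int j / (2 * real h))) ^ (2 * M)) =
      (\<Sum>v = - int M..int M. of_real (?B v) * cis (2 * pi * of_int j * of_int (v - a) / (2 * real h)))"
      unfolding e cos_pow sum_distrib_left
    proof (rule sum.cong)
      fix v :: int
      have "cis (- (2 * pi * of_int j * of_int a / (2 * real h))) * cis (?x * of_int v) =
        cis (2 * pi * of_int j * of_int (v - a) / (2 * real h))"
        unfolding cis_mult by (simp add: algebra_simps diff_divide_distrib)
      then show "cis (- (2 * pi * of_int j * of_int a / (2 * real h))) * (of_real (?B v) * cis (?x * of_int v)) =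
        of_real (?B v) * cis (2 * pi * of_int j * of_int (v - a) / (2 * real h))"
        by (metis mult.left_commute)
    qed simp
  qed simp
  also have "\<dots> = (\<Sum>v = - int M..int M. of_real (?B v) * (\<Sum>j = - int h..<int h. cis (2 * pi * of_int j * of_int (v - a) / (2 * real h))))"
    unfolding sum_distrib_left by (rule sum.swap)
  also have "\<dots> = (\<Sum>v = - int M..int M. if 2 * int h dvd v - a then of_real (?B v) * of_nat (2 * h) else 0)"
    unfolding sum_roots_of_unity[OF assms] by (intro sum.cong) auto
  also have "\<dots> = (\<Sum>v\<in>?S. of_real (?B v) * of_nat (2 * h))"
    by (rule sum.inter_filter[symmetric]) simp
  also have "\<dots> = of_real (real (2 * h) * (\<Sum>v\<in>?S. ?B v))"
    by (simp add: sum_distrib_left mult.commute)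
  finally have 1: "(\<Sum>j = - int h..<int h. cis (- (2 * pi * of_int j * of_int a / (2 * real h))) *
            of_real ((2 * cos (pi * of_int j / (2 * real h))) ^ (2 * M))) = of_real (real (2 * h) * (\<Sum>v\<in>?S. ?B v))" .
  have inj: "inj (\<lambda>i. a + 2 * int h * i)" using assms by (auto simp: inj_on_def)
  \<comment> \<open>Binomial coefficients vanish outside their range, so the sum over the whole
    progression is a finite one.\<close>
  have "(\<Sum>\<^sub>\<infinity>i. central_ratio M (nat \<bar>a + 2 * int h * i\<bar>)) =
      infsum (\<lambda>v. central_ratio M (nat \<bar>v\<bar>)) (range (\<lambda>i. a + 2 * int h * i))"
    using infsum_reindex[OF inj, of "\<lambda>v. central_ratio M (nat \<bar>v\<bar>)"] by (simp add: o_def)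
  also have "\<dots> = infsum (\<lambda>v. central_ratio M (nat \<bar>v\<bar>)) ?S"
  proof (rule infsum_cong_neutral)
    fix v assume v: "v \<in> range (\<lambda>i. a + 2 * int h * i) - ?S"
    then have "2 * int h dvd v - a" by auto
    then have "\<not> (v \<in> {- int M..int M})" using v by blast
    then have "nat \<bar>v\<bar> > M" by auto
    then show "central_ratio M (nat \<bar>v\<bar>) = 0" by (simp add: central_ratio_def binomial_eq_0)
  next
    fix v assume v: "v \<in> ?S - range (\<lambda>i. a + 2 * int h * i)"
    then obtain i where "v - a = 2 * int h * i" by (auto elim: dvdE)
    then have "v = a + 2 * int h * i" by simp
    then show "central_ratio M (nat \<bar>v\<bar>) = 0" using v by blast
  qed simp
  also have "\<dots> = (\<Sum>v\<in>?S. central_ratio M (nat \<bar>v\<bar>))"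
    by (rule infsum_finite, rule finite_subset[of _ "{- int M..int M}"]) auto
  also have "\<dots> = (\<Sum>v\<in>?S. ?B v) / real ((2 * M) choose M)"
    by (simp add: central_ratio_def sum_divide_distrib)
  finally have 2: "(\<Sum>v\<in>?S. ?B v) = real ((2 * M) choose M) * (\<Sum>\<^sub>\<infinity>i. central_ratio M (nat \<bar>a + 2 * int h * i\<bar>))"
    by simp
  have "4 ^ M * (\<Sum>j = - int h..<int h. cis (- (2 * pi * of_int j * of_int a / (2 * real h))) *
            of_real (cos (pi * of_int j / (2 * real h)) ^ (2 * M))) = complex_of_real (real (2 * h) * (\<Sum>v\<in>?S. ?B v))"
  proof -
    have "complex_of_real ((2 * cos x) ^ (2 * M)) = 4 ^ M * of_real (cos x ^ (2 * M))" for x :: real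
      by (simp add: power_mult_distrib power_mult)
    from 1[unfolded this] show ?thesis
      by (simp only: mult.left_commute[of _ "4 ^ M"] sum_distrib_left[symmetric])
  qed
  then have "(\<Sum>j = - int h..<int h. cis (- (2 * pi * of_int j * of_int a / (2 * real h))) *
            of_real (cos (pi * of_int j / (2 * real h)) ^ (2 * M))) = complex_of_real (real (2 * h) * (\<Sum>v\<in>?S. ?B v)) / 4 ^ M"
    by (simp add: field_simps)
  then show ?thesis unfolding 2 by simp
qed

text \<open>Polya's identity is rescaled so that cosine powers and binomial coefficients both become
  Gaussian. Rational parameters make the scaling exact along a sequence of integers.\<close>

lemma theta_inversion_rational:
  fixes b c :: real
  assumes b: "b \<in> \<rat>" and c: "c \<in> \<rat>" "c > 0"
  shows "complex_of_real (\<Sum>\<^sub>\<infinity>k::int. exp (- ((of_int k + b)\<^sup>2 / c))) =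
    of_real (sqrt (pi * c)) * (\<Sum>\<^sub>\<infinity>j::int. cis (- (2 * pi * of_int j * b)) * of_real (exp (- (pi\<^sup>2 * c * (of_int j)\<^sup>2))))"
proof -
  have rat: "\<exists>p D. D > 0 \<and> x = of_int p / of_nat D" if "x \<in> \<rat>" for x :: real
  proof -
    from that obtain p d where "d > 0" "x = of_int p / of_int d" by (rule Rats_cases')
    then show ?thesis by (intro exI[of _ p] exI[of _ "nat d"]) simp
  qed
  obtain p D where D: "D > 0" "b = of_int p / of_nat D" using rat[OF b] by blast
  obtain u w where w: "w > 0" "c = of_int u / of_nat w" using rat[OF c(1)] by blast
  have u: "u > 0" using w c(2) by (simp add: zero_less_divide_iff)
  \<comment> \<open>Chosen so that with L = 2 h both M = c L^2 and a = b L hold exactly in integers;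
    the factors \<open>D\<close> and \<open>w\<close> clear the denominators.\<close>
  define h where "h N = D * w * N" for N :: nat
  define M where "M N = nat u * 4 * D\<^sup>2 * w * N\<^sup>2" for N :: nat
  define a where "a N = 2 * p * int w * int N" for N :: nat
  have M_eq: "real (M N) = c * (2 * real (h N))\<^sup>2" for N
    using w u by (simp add: M_def h_def power_mult_distrib power2_eq_square)
  have a_eq: "real_of_int (a N) = b * (2 * real (h N))" for N
    using D by (simp add: a_def h_def)
  have h_pos: "h N > 0" if "N > 0" for N using that D w by (simp add: h_def)
  have h_lim: "filterlim (\<lambda>N. 2 * real (h N)) at_top sequentially"
  proof -
    have "filterlim (\<lambda>N. (2 * real D * real w) * real N) at_top sequentially"
      using D w by (intro filterlim_tendsto_pos_mult_at_top[OF tendsto_const] filterlim_real_sequentially) auto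
    then show ?thesis by (simp add: h_def mult_ac)
  qed
  have M_lim: "filterlim M at_top sequentially"
  proof -
    have "filterlim (\<lambda>N. real (M N)) at_top sequentially"
      unfolding M_eq using c(2)
      by (intro filterlim_tendsto_pos_mult_at_top[OF tendsto_const] filterlim_pow_at_top h_lim) auto
    then show ?thesis by (simp add: filterlim_sequentially_iff_filterlim_real)
  qed
  define A where "A j N = (if j \<in> {- int (h N)..<int (h N)} then
      cis (- (2 * pi * of_int j * b)) * of_real (cos (pi * of_int j / (2 * real (h N))) ^ (2 * M N)) else 0)" for j N
  define R where "R i N = central_ratio (M N) (nat \<bar>a N + 2 * int (h N) * i\<bar>)" for i N
  have id: "(\<Sum>\<^sub>\<infinity>j. A j N) = of_real (2 * real (h N) * real ((2 * M N) choose (M N)) / 4 ^ M N * (\<Sum>\<^sub>\<infinity>i. R i N))"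
    if N: "N > 0" for N
  proof -
    have "(\<Sum>\<^sub>\<infinity>j. A j N) = infsum (\<lambda>j. A j N) {- int (h N)..<int (h N)}"
      by (rule infsum_cong_neutral) (auto simp: A_def)
    also have "\<dots> = (\<Sum>j = - int (h N)..<int (h N). A j N)" by (rule infsum_finite) simp
    also have "\<dots> = (\<Sum>j = - int (h N)..<int (h N). cis (- (2 * pi * of_int j * of_int (a N) / (2 * real (h N)))) *
            of_real (cos (pi * of_int j / (2 * real (h N))) ^ (2 * M N)))"
      unfolding a_eq A_def using h_pos[OF N] by (intro sum.cong) (auto simp: mult_ac)
    also have "\<dots> = of_real (real (2 * h N) * real ((2 * M N) choose (M N)) / 4 ^ M N * (\<Sum>\<^sub>\<infinity>i. R i N))"
      unfolding polya_identity[OF h_pos[OF N]] R_def ..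
    finally show ?thesis by simp
  qed
  have A_lim: "(A j \<longlonglongrightarrow> cis (- (2 * pi * of_int j * b)) * of_real (exp (- (pi\<^sup>2 * c * (of_int j)\<^sup>2))))" for j
  proof -
    have "((\<lambda>L. cos (p / L) powr (2 * c * L\<^sup>2)) \<longlongrightarrow> exp (- (p * (p * c)))) at_top" for p
      using c(2) by real_asymp
    from this[of "pi * of_int j"]
    have "((\<lambda>L. cos (pi * of_int j / L) powr (2 * c * L\<^sup>2)) \<longlongrightarrow> exp (- (pi\<^sup>2 * c * (of_int j)\<^sup>2))) at_top"
      by (simp add: power2_eq_square mult_ac)
    from filterlim_compose[OF this h_lim]
    have l: "(\<lambda>N. cos (pi * of_int j / (2 * real (h N))) powr (2 * c * (2 * real (h N))\<^sup>2)) \<longlonglongrightarrow> exp (- (pi\<^sup>2 * c * (of_int j)\<^sup>2))" .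
    have "(\<lambda>N. cis (- (2 * pi * of_int j * b)) * of_real (cos (pi * of_int j / (2 * real (h N))) powr (2 * c * (2 * real (h N))\<^sup>2)))
       \<longlonglongrightarrow> cis (- (2 * pi * of_int j * b)) * of_real (exp (- (pi\<^sup>2 * c * (of_int j)\<^sup>2)))"
      by (intro tendsto_intros l)
    moreover have "\<forall>\<^sub>F N in sequentially. 2 * real (h N) > 2 * \<bar>of_int j\<bar> + 1"
      using h_lim by (rule filterlim_at_top_dense[THEN iffD1, rule_format])
    then have "\<forall>\<^sub>F N in sequentially. cis (- (2 * pi * of_int j * b)) * of_real (cos (pi * of_int j / (2 * real (h N))) powr (2 * c * (2 * real (h N))\<^sup>2)) = A j N"
    proof eventually_elim
      case (elim N)
      then have H: "real (h N) > \<bar>of_int j\<bar>" by linarith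
      then have "j \<in> {- int (h N)..<int (h N)}" by auto
      moreover have "cos (pi * of_int j / (2 * real (h N))) > 0"
      proof (rule cos_gt_zero_pi)
        have "\<bar>of_int j / (2 * real (h N))\<bar> < 1 / 2" using H by (simp add: abs_if field_simps split: if_splits)
        then have "pi * \<bar>of_int j / (2 * real (h N))\<bar> < pi * (1 / 2)" by (intro mult_strict_left_mono) auto
        then have "\<bar>pi * of_int j / (2 * real (h N))\<bar> < pi / 2" by (simp add: abs_mult)
        then show "- (pi / 2) < pi * of_int j / (2 * real (h N))" "pi * of_int j / (2 * real (h N)) < pi / 2"
          by linarith+
      qed
      moreover from this have "cos (pi * of_int j / (2 * real (h N))) ^ (2 * M N) = cos (pi * of_int j / (2 * real (h N))) powr (2 * c * (2 * real (h N))\<^sup>2)"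
        by (subst powr_realpow[symmetric]) (simp_all add: M_eq mult.assoc)
      ultimately show ?case by (simp add: A_def)
    qed
    ultimately show ?thesis by (rule Lim_transform_eventually)
  qed
  have A_bound: "norm (A j N) \<le> exp (- (pi\<^sup>2 * c) * (of_int j + 0)\<^sup>2)" for j N
  proof (cases "j \<in> {- int (h N)..<int (h N)}")
    case True
    let ?y = "pi * of_int j / (2 * real (h N))"
    have hp: "real (h N) > 0" using True by auto
    have "\<bar>of_int j\<bar> \<le> real (h N)" using True by auto
    then have "\<bar>of_int j / (2 * real (h N))\<bar> \<le> 1 / 2" using hp by (simp add: field_simps)
    then have "pi * \<bar>of_int j / (2 * real (h N))\<bar> \<le> pi * (1 / 2)" by (intro mult_left_mono) auto
    then have "\<bar>?y\<bar> \<le> pi / 2" by (simp add: abs_mult)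
    then have "\<bar>cos ?y\<bar> \<le> exp (- (?y\<^sup>2 / 2))" by (rule cos_le_exp_gaussian)
    then have "\<bar>cos ?y\<bar> ^ (2 * M N) \<le> exp (- (?y\<^sup>2 / 2)) ^ (2 * M N)" by (intro power_mono) auto
    also have "\<dots> = exp (real (2 * M N) * (- (?y\<^sup>2 / 2)))" by (simp only: exp_of_nat_mult)
    also have "real (2 * M N) * (- (?y\<^sup>2 / 2)) = - (pi\<^sup>2 * c) * (of_int j + 0)\<^sup>2"
      using hp by (simp add: M_eq power_mult_distrib power_divide)
    finally show ?thesis using True by (simp add: A_def norm_mult norm_power)
  qed (simp only: A_def if_False norm_zero exp_ge_zero)
  have limA: "(\<lambda>N. \<Sum>\<^sub>\<infinity>j. A j N) \<longlonglongrightarrow> (\<Sum>\<^sub>\<infinity>j::int. cis (- (2 * pi * of_int j * b)) * of_real (exp (- (pi\<^sup>2 * c * (of_int j)\<^sup>2))))"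
  proof (rule tannery_int[OF A_lim])
    show "\<forall>\<^sub>F N in sequentially. \<forall>j. norm (A j N) \<le> exp (- (pi\<^sup>2 * c) * (of_int j + 0)\<^sup>2)"
      by (intro always_eventually allI A_bound)
    show "(\<lambda>j::int. exp (- (pi\<^sup>2 * c) * (of_int j + 0)\<^sup>2)) summable_on UNIV"
      by (rule summable_on_gaussian) (use c in simp)
  qed simp
  define v where "v i N = nat \<bar>a N + 2 * int (h N) * i\<bar>" for i N
  have v_eq: "real (v i N) = \<bar>of_int i + b\<bar> * (2 * real (h N))" for i N
  proof -
    have "real (v i N) = \<bar>real_of_int (a N) + 2 * real (h N) * of_int i\<bar>" by (simp add: v_def)
    also have "\<dots> = \<bar>(of_int i + b) * (2 * real (h N))\<bar>" unfolding a_eq by (simp add: algebra_simps)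
    finally show ?thesis by (simp add: abs_mult)
  qed
  have R_lim: "R i \<longlonglongrightarrow> exp (- ((of_int i + b)\<^sup>2 / c))" for i
  proof -
    define x where "x = \<bar>of_int i + b\<bar>"
    have x: "x \<ge> 0" "x\<^sup>2 = (of_int i + b)\<^sup>2" by (auto simp: x_def)
    have "((\<lambda>L. L\<^sup>2 / (2 * (c * L\<^sup>2) + 1)) \<longlongrightarrow> inverse c / 2) at_top"
      using c(2) by real_asymp
    note tendsto_mult_left[OF this, of "- 2 * x\<^sup>2"]
    moreover have "- 2 * x\<^sup>2 * (L\<^sup>2 / (2 * (c * L\<^sup>2) + 1)) = - 2 * (x * L)\<^sup>2 / (2 * (c * L\<^sup>2) + 1)" for L
      by (simp add: power_mult_distrib)
    moreover have "- 2 * x\<^sup>2 * (inverse c / 2) = - (x\<^sup>2 / c)" using c(2) by (simp add: field_simps)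
    ultimately have lo1: "((\<lambda>L. - 2 * (x * L)\<^sup>2 / (2 * (c * L\<^sup>2) + 1)) \<longlongrightarrow> - (x\<^sup>2 / c)) at_top"
      by (simp only:)
    then have up: "((\<lambda>L. exp (- 2 * (x * L)\<^sup>2 / (2 * (c * L\<^sup>2) + 1))) \<longlongrightarrow> exp (- (x\<^sup>2 / c))) at_top"
      by (rule tendsto_exp)
    have "((\<lambda>L::real. 1 / L\<^sup>2) \<longlongrightarrow> 0) at_top" by real_asymp
    from tendsto_mult_left[OF this, of "8 * x ^ 4 / c ^ 3"]
    have l1: "((\<lambda>L. 8 * x ^ 4 / c ^ 3 * (1 / L\<^sup>2)) \<longlongrightarrow> 0) at_top" by (simp only: mult_zero_right)
    have l2: "\<forall>\<^sub>F L in at_top. 8 * x ^ 4 / c ^ 3 * (1 / L\<^sup>2) = (x * L) * (2 * (x * L) / (c * L\<^sup>2)) ^ 3"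
      using eventually_gt_at_top[of 0]
      by eventually_elim (use c in \<open>simp add: field_simps power2_eq_square power3_eq_cube power4_eq_xxxx\<close>)
    have lo0: "((\<lambda>L. (x * L) * (2 * (x * L) / (c * L\<^sup>2)) ^ 3) \<longlongrightarrow> 0) at_top"
      by (rule Lim_transform_eventually[OF l1 l2])
    have lo: "((\<lambda>L. exp (- 2 * (x * L)\<^sup>2 / (2 * (c * L\<^sup>2) + 1) - (x * L) * (2 * (x * L) / (c * L\<^sup>2)) ^ 3)) \<longlongrightarrow> exp (- (x\<^sup>2 / c))) at_top"
      using tendsto_exp[OF tendsto_diff[OF lo1 lo0]] by (simp only: diff_zero)
    note up' = filterlim_compose[OF up h_lim] and lo' = filterlim_compose[OF lo h_lim]
    have ev: "\<forall>\<^sub>F L in at_top. 4 * (x * L) \<le> c * L\<^sup>2" using c(2) by real_asymp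
    have "\<forall>\<^sub>F N in sequentially. 4 * (x * (2 * real (h N))) \<le> c * (2 * real (h N))\<^sup>2"
      using h_lim ev by (rule filterlim_iff[THEN iffD1, rule_format])
    then have ev1: "\<forall>\<^sub>F N in sequentially.
       exp (- 2 * (x * (2 * real (h N)))\<^sup>2 / (2 * (c * (2 * real (h N))\<^sup>2) + 1) -
         (x * (2 * real (h N))) * (2 * (x * (2 * real (h N))) / (c * (2 * real (h N))\<^sup>2)) ^ 3) \<le> R i N"
    proof eventually_elim
      case (elim N)
      then have "4 * real (v i N) \<le> real (M N)" by (simp add: v_eq M_eq x_def)
      then have "4 * v i N \<le> M N" by linarith
      then show ?case using central_ratio_ge[of "v i N" "M N"]
        unfolding R_def v_def[symmetric] v_eq M_eq x_def by simp
    qed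
    have ev2: "\<forall>\<^sub>F N in sequentially. R i N \<le> exp (- 2 * (x * (2 * real (h N)))\<^sup>2 / (2 * (c * (2 * real (h N))\<^sup>2) + 1))"
    proof (rule always_eventually, rule allI)
      fix N
      show "R i N \<le> exp (- 2 * (x * (2 * real (h N)))\<^sup>2 / (2 * (c * (2 * real (h N))\<^sup>2) + 1))"
        using central_ratio_le[of "M N" "v i N"] unfolding R_def v_def[symmetric] v_eq M_eq x_def .
    qed
    have "R i \<longlonglongrightarrow> exp (- (x\<^sup>2 / c))" by (rule real_tendsto_sandwich[OF ev1 ev2 lo' up'])
    then show ?thesis unfolding x .
  qed
  have R_bound: "norm (R i N) \<le> exp (- (2 / (3 * c)) * (of_int i + b)\<^sup>2)" if N: "N > 0" for i N
  proof -
    have H: "real (h N) > 0" using h_pos[OF N] by simp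
    have "M N > 0" using M_eq[of N] c H by (metis mult_pos_pos of_nat_0_less_iff zero_less_numeral zero_less_power)
    \<comment> \<open>Source of the constant 2 / (3 c) in the majorant, which thereby becomes
      independent of \<open>N\<close>.\<close>
    then have M1: "2 * real (M N) + 1 \<le> 3 * real (M N)" by simp
    have "norm (R i N) \<le> exp (- 2 * (real (v i N))\<^sup>2 / (2 * real (M N) + 1))"
      using central_ratio_le[of "M N" "v i N"] central_ratio_nonneg[of "M N" "v i N"]
      unfolding R_def v_def[symmetric] by simp
    also have "\<dots> \<le> exp (- 2 * (real (v i N))\<^sup>2 / (3 * real (M N)))"
      using M1 \<open>M N > 0\<close> by (simp add: frac_le)
    also have "- 2 * (real (v i N))\<^sup>2 / (3 * real (M N)) = - (2 / (3 * c)) * (of_int i + b)\<^sup>2"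
      unfolding v_eq M_eq using H c by (simp add: power_mult_distrib field_simps)
    finally show ?thesis .
  qed
  have limR: "(\<lambda>N. \<Sum>\<^sub>\<infinity>i. R i N) \<longlonglongrightarrow> (\<Sum>\<^sub>\<infinity>i::int. exp (- ((of_int i + b)\<^sup>2 / c)))"
  proof (rule tannery_int[OF R_lim _ summable_on_gaussian])
    show "\<forall>\<^sub>F N in sequentially. \<forall>i. norm (R i N) \<le> exp (- (2 / (3 * c)) * (of_int i + b)\<^sup>2)"
      using eventually_gt_at_top[of 0] by eventually_elim (use R_bound in blast)
  qed (use c in auto)
  have limC: "(\<lambda>N. 2 * real (h N) * real ((2 * M N) choose (M N)) / 4 ^ M N) \<longlonglongrightarrow> 1 / sqrt (pi * c)"
  proof -
    have "(\<lambda>N. 1 / sqrt c * (sqrt (real (M N)) * real ((2 * M N) choose (M N)) / 4 ^ M N)) \<longlonglongrightarrow> 1 / sqrt c * (1 / sqrt pi)"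
      by (intro tendsto_intros filterlim_compose[OF central_binomial_asymptotics M_lim])
    moreover have "1 / sqrt c * sqrt (real (M N)) = 2 * real (h N)" for N
      using c unfolding M_eq by (simp add: real_sqrt_mult)
    then have "1 / sqrt c * (sqrt (real (M N)) * real ((2 * M N) choose (M N)) / 4 ^ M N) =
       2 * real (h N) * real ((2 * M N) choose (M N)) / 4 ^ M N" for N
      by (metis mult.assoc times_divide_eq_right)
    ultimately show ?thesis by (simp add: real_sqrt_mult mult.commute)
  qed
  have "(\<lambda>N. complex_of_real (2 * real (h N) * real ((2 * M N) choose (M N)) / 4 ^ M N * (\<Sum>\<^sub>\<infinity>i. R i N)))
     \<longlonglongrightarrow> of_real (1 / sqrt (pi * c) * (\<Sum>\<^sub>\<infinity>i::int. exp (- ((of_int i + b)\<^sup>2 / c))))"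
    by (intro tendsto_of_real tendsto_mult limC limR)
  moreover have "\<forall>\<^sub>F N in sequentially. complex_of_real (2 * real (h N) * real ((2 * M N) choose (M N)) / 4 ^ M N * (\<Sum>\<^sub>\<infinity>i. R i N)) = (\<Sum>\<^sub>\<infinity>j. A j N)"
    using eventually_gt_at_top[of 0] by eventually_elim (use id in simp)
  ultimately have "(\<lambda>N. \<Sum>\<^sub>\<infinity>j. A j N) \<longlonglongrightarrow> of_real (1 / sqrt (pi * c) * (\<Sum>\<^sub>\<infinity>i::int. exp (- ((of_int i + b)\<^sup>2 / c))))"
    by (rule Lim_transform_eventually)
  from LIMSEQ_unique[OF this limA] show ?thesis using c by (simp add: field_simps)
qed

section \<open>Analytic continuation of theta inversion\<close>

lemma norm_gaussian_term:
  fixes \<kappa> w :: complex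
  assumes "norm \<kappa> \<le> 1" "\<delta> \<le> Re w"
  shows "norm (\<kappa> * exp (- w * of_real ((of_int k + b)\<^sup>2))) \<le> exp (- \<delta> * (of_int k + b)\<^sup>2)"
proof -
  have "norm (\<kappa> * exp (- w * of_real ((of_int k + b)\<^sup>2))) \<le> 1 * exp (- Re w * (of_int k + b)\<^sup>2)"
    unfolding norm_mult norm_exp_eq_Re using assms(1) by (intro mult_mono) auto
  also have "\<dots> \<le> exp (- \<delta> * (of_int k + b)\<^sup>2)"
    using assms(2) by (simp add: mult_right_mono)
  finally show ?thesis .
qed

lemma abs_summable_gaussian:
  fixes w :: complex
  assumes "\<And>k. norm (\<kappa> k) \<le> 1" "Re w > 0"
  shows "(\<lambda>k::int. norm (\<kappa> k * exp (- w * of_real ((of_int k + b)\<^sup>2)))) summable_on UNIV"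
  by (rule Infinite_Sum.abs_summable_on_comparison_test'[OF summable_on_gaussian[OF assms(2), of b]])
    (use norm_gaussian_term assms(1) in blast)

lemma holomorphic_gaussian_sum:
  assumes "\<And>k. norm (\<kappa> k) \<le> 1"
  shows "(\<lambda>w. \<Sum>\<^sub>\<infinity>k::int. \<kappa> k * exp (- w * of_real ((of_int k + b)\<^sup>2))) holomorphic_on {w. Re w > 0}"
proof -
  let ?t = "\<lambda>w k. \<kappa> k * exp (- w * of_real ((of_int k + b)\<^sup>2))"
  have "(\<lambda>w. \<Sum>n. ?t w (int_decode n)) holomorphic_on {w. Re w > 0}"
  proof (rule holomorphic_uniform_sequence[where f = "\<lambda>N w. \<Sum>n<N. ?t w (int_decode n)"])
    show "open {w. 0 < Re w}" by (rule open_halfspace_Re_gt)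
    show "(\<lambda>w. \<Sum>n<N. ?t w (int_decode n)) holomorphic_on {w. 0 < Re w}" for N
      by (intro holomorphic_intros)
    fix w :: complex assume "w \<in> {w. 0 < Re w}"
    then have w: "Re w > 0" by simp
    have ge: "Re w / 2 \<le> Re z" if "z \<in> cball w (Re w / 2)" for z
    proof -
      have "\<bar>Re (w - z)\<bar> \<le> Re w / 2"
        using that abs_Re_le_cmod[of "w - z"] by (simp add: dist_norm)
      then have "\<bar>Re w - Re z\<bar> \<le> Re w / 2" by simp
      then show ?thesis by linarith
    qed
    have s: "summable (\<lambda>n. exp (- (Re w / 2) * (of_int (int_decode n) + b)\<^sup>2))"
      using infsum_int_eq_suminf(1)[of "\<lambda>k. exp (- (Re w / 2) * (of_int k + b)\<^sup>2)"]
        summable_on_gaussian[of "Re w / 2" b] w by simp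
    have "uniform_limit (cball w (Re w / 2)) (\<lambda>N z. \<Sum>n<N. ?t z (int_decode n)) (\<lambda>z. \<Sum>n. ?t z (int_decode n)) sequentially"
      by (rule Weierstrass_m_test[OF _ s]) (use norm_gaussian_term assms ge in blast)
    moreover have "cball w (Re w / 2) \<subseteq> {w. 0 < Re w}" using ge w by force
    ultimately show "\<exists>d>0. cball w d \<subseteq> {w. 0 < Re w} \<and>
        uniform_limit (cball w d) (\<lambda>N z. \<Sum>n<N. ?t z (int_decode n)) (\<lambda>z. \<Sum>n. ?t z (int_decode n)) sequentially"
      using w by (intro exI[of _ "Re w / 2"]) auto
  qed
  moreover have "(\<Sum>\<^sub>\<infinity>k. ?t w k) = (\<Sum>n. ?t w (int_decode n))" if "w \<in> {w. Re w > 0}" for w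
    by (rule infsum_int_eq_suminf(2), rule abs_summable_gaussian) (use assms that in auto)
  ultimately show ?thesis by (subst holomorphic_cong[OF refl]) auto
qed

text \<open>Both sides are holomorphic in \<open>c\<close> on the right half plane and agree at the
  positive rationals, which accumulate at 1. The shift \<open>b\<close> stays rational, as it is in
  the application.\<close>

theorem theta_inversion:
  fixes c :: complex and b :: real
  assumes b: "b \<in> \<rat>" and c: "Re c > 0"
  shows "(\<Sum>\<^sub>\<infinity>k::int. exp (- (1 / c) * of_real ((of_int k + b)\<^sup>2))) =
    csqrt (of_real pi * c) * (\<Sum>\<^sub>\<infinity>j::int. cis (- (2 * pi * of_int j * b)) * exp (- (of_real (pi\<^sup>2) * c) * of_real ((of_int j)\<^sup>2)))"
proof -
  let ?S = "{w :: complex. Re w > 0}"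
  let ?L = "\<lambda>c. \<Sum>\<^sub>\<infinity>k::int. exp (- (1 / c) * of_real ((of_int k + b)\<^sup>2))"
  let ?R = "\<lambda>c. csqrt (of_real pi * c) * (\<Sum>\<^sub>\<infinity>j::int. cis (- (2 * pi * of_int j * b)) * exp (- (of_real (pi\<^sup>2) * c) * of_real ((of_int j)\<^sup>2)))"
  have "?L c - ?R c = 0"
  proof (rule analytic_continuation[where f = "\<lambda>c. ?L c - ?R c" and U = "of_real ` {c. c \<in> \<rat> \<and> c > 0}" and \<xi> = 1])
    have "((\<lambda>w. \<Sum>\<^sub>\<infinity>k::int. 1 * exp (- w * of_real ((of_int k + b)\<^sup>2))) \<circ> (\<lambda>c. 1 / c)) holomorphic_on ?S"
    proof (rule holomorphic_on_compose_gen[OF _ holomorphic_gaussian_sum])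
      show "(\<lambda>c. 1 / c) holomorphic_on ?S" by (intro holomorphic_intros) auto
      show "(\<lambda>c. 1 / c) ` ?S \<subseteq> ?S"
      proof clarify
        fix c :: complex assume "Re c > 0"
        moreover have "c \<noteq> 0" using calculation by auto
        ultimately show "Re (1 / c) > 0" by (simp add: Re_divide cmod_power2[symmetric])
      qed
    qed auto
    then have L: "?L holomorphic_on ?S" by (simp add: o_def)
    have "((\<lambda>w. \<Sum>\<^sub>\<infinity>j::int. cis (- (2 * pi * of_int j * b)) * exp (- w * of_real ((of_int j + 0)\<^sup>2))) \<circ> (\<lambda>c. of_real (pi\<^sup>2) * c)) holomorphic_on ?S"
      by (rule holomorphic_on_compose_gen[OF _ holomorphic_gaussian_sum]) (auto intro!: holomorphic_intros)
    then have R: "(\<lambda>c. \<Sum>\<^sub>\<infinity>j::int. cis (- (2 * pi * of_int j * b)) * exp (- (of_real (pi\<^sup>2) * c) * of_real ((of_int j)\<^sup>2))) holomorphic_on ?S"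
      by (simp add: o_def)
    have "(\<lambda>c. csqrt (of_real pi * c)) holomorphic_on ?S"
    proof (intro holomorphic_intros)
      fix c :: complex assume "c \<in> ?S"
      then have "0 < pi * Re c" using pi_gt_zero by simp
      then show "of_real pi * c \<notin> \<real>\<^sub>\<le>\<^sub>0" by (auto simp: complex_nonpos_Reals_iff)
    qed
    then show "(\<lambda>c. ?L c - ?R c) holomorphic_on ?S"
      by (intro holomorphic_on_diff holomorphic_on_mult L R)
    show "open ?S" by (rule open_halfspace_Re_gt)
    show "connected ?S" by (intro convex_connected convex_halfspace_Re_gt)
    show "of_real ` {c. c \<in> \<rat> \<and> c > 0} \<subseteq> ?S" by auto
    show "1 islimpt (of_real ` {c. c \<in> \<rat> \<and> c > 0} :: complex set)"
      unfolding islimpt_sequential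
    proof (intro exI conjI allI)
      fix n :: nat
      show "complex_of_real (1 + 1 / real (Suc n)) \<in> of_real ` {c. c \<in> \<rat> \<and> c > 0} - {1}"
      proof
        show "complex_of_real (1 + 1 / real (Suc n)) \<in> of_real ` {c. c \<in> \<rat> \<and> c > 0}"
          by (rule imageI) (auto intro!: Rats_add Rats_divide simp: add_pos_pos simp del: of_nat_Suc)
        have "1 + 1 / real (Suc n) \<noteq> 1" by simp
        then show "complex_of_real (1 + 1 / real (Suc n)) \<notin> {1}" by (metis of_real_eq_1_iff singletonD)
      qed
      have "(\<lambda>n. 1 + 1 / real (Suc n)) \<longlonglongrightarrow> 1" by real_asymp
      then have "(\<lambda>n. complex_of_real (1 + 1 / real (Suc n))) \<longlonglongrightarrow> of_real 1" by (intro tendsto_of_real)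
      then show "(\<lambda>n. complex_of_real (1 + 1 / real (Suc n))) \<longlonglongrightarrow> 1" by simp
    qed
    fix z :: complex assume "z \<in> of_real ` {c. c \<in> \<rat> \<and> c > 0}"
    then obtain r where r: "z = of_real r" "r \<in> \<rat>" "r > 0" by auto
    have e1: "exp (- (1 / complex_of_real r) * of_real ((of_int k + b)\<^sup>2)) = of_real (exp (- ((of_int k + b)\<^sup>2 / r)))" for k :: int
      by (simp flip: exp_of_real)
    have e2: "exp (- (complex_of_real (pi\<^sup>2) * of_real r) * of_real ((of_int j)\<^sup>2)) = of_real (exp (- (pi\<^sup>2 * r * (of_int j)\<^sup>2)))" for j :: int
      by (simp flip: exp_of_real)
    have e3: "csqrt (of_real pi * complex_of_real r) = of_real (sqrt (pi * r))"
      using r by (simp add: csqrt_of_real_nonneg flip: of_real_mult)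
    have s: "(\<lambda>k::int. exp (- ((of_int k + b)\<^sup>2 / r))) summable_on UNIV"
      using summable_on_gaussian[of "1 / r" b] r by simp
    have "(\<Sum>\<^sub>\<infinity>k::int. complex_of_real (exp (- ((of_int k + b)\<^sup>2 / r)))) = of_real (\<Sum>\<^sub>\<infinity>k::int. exp (- ((of_int k + b)\<^sup>2 / r)))"
      by (intro infsumI has_sum_of_real_iff[THEN iffD2] has_sum_infsum s)
    then show "?L z - ?R z = 0"
      unfolding r(1) e1 e2 e3 theta_inversion_rational[OF b r(2,3)] by simp
  qed (use c in auto)
  then show ?thesis by simp
qed

section \<open>Euler's function near roots of unity\<close>

lemma infsum_int_split:
  fixes f :: "int \<Rightarrow> complex"
  assumes "(\<lambda>k. norm (f k)) summable_on UNIV"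
  shows "infsum f UNIV = f 0 + (\<Sum>n. f (int (Suc n)) + f (- int (Suc n)))"
proof -
  have s: "(\<lambda>k. norm (f k)) summable_on A" for A
    using summable_on_subset_banach[OF assms, of A] by simp
  have side: "(\<Sum>\<^sub>\<infinity>k\<in>range g. f k) = (\<Sum>n. f (g n))" "summable (\<lambda>n. f (g n))" if "inj g" for g :: "nat \<Rightarrow> int"
  proof -
    have "(\<lambda>n. norm (f (g n))) summable_on UNIV"
      using summable_on_reindex[OF that, of "\<lambda>k. norm (f k)"] s by (simp add: o_def)
    then have *: "summable (\<lambda>n. norm (f (g n)))"
      by (subst (asm) summable_on_UNIV_nonneg_real_iff) auto
    then show "summable (\<lambda>n. f (g n))" by (rule summable_norm_cancel)
    have "(\<Sum>\<^sub>\<infinity>k\<in>range g. f k) = (\<Sum>\<^sub>\<infinity>n. f (g n))" using infsum_reindex[OF that, of f] by (simp add: o_def)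
    also have "\<dots> = (\<Sum>n. f (g n))"
      by (intro infsumI norm_summable_imp_has_sum * summable_sums summable_norm_cancel)
    finally show "(\<Sum>\<^sub>\<infinity>k\<in>range g. f k) = (\<Sum>n. f (g n))" .
  qed
  let ?p = "\<lambda>n. int (Suc n)" and ?m = "\<lambda>n. - int (Suc n)"
  have inj: "inj ?p" "inj ?m" by (auto simp: inj_on_def)
  have U: "UNIV = {0} \<union> (range ?p \<union> range ?m)"
  proof (intro set_eqI iffI UNIV_I)
    fix k :: int
    consider "k = 0" | "k = ?p (nat (k - 1))" | "k = ?m (nat (- k - 1))" by linarith
    then show "k \<in> {0} \<union> (range ?p \<union> range ?m)" by cases blast+
  qed
  have sf: "f summable_on A" for A using abs_summable_summable[OF s] .
  have "infsum f UNIV = infsum f {0} + (infsum f (range ?p) + infsum f (range ?m))"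
    unfolding U by (subst infsum_Un_disjoint[OF sf sf], force, subst infsum_Un_disjoint[OF sf sf], force, simp)
  then show ?thesis using side[OF inj(1)] side[OF inj(2)] by (simp add: suminf_add)
qed

definition pent :: "int \<Rightarrow> nat" where
  "pent n = nat (n * (3 * n + 1) div 2)"

lemma pent_eq: "2 * int (pent n) = n * (3 * n + 1)"
proof -
  have "even (n * (3 * n + 1))" by auto
  moreover have "0 \<le> n * (3 * n + 1)"
    by (cases "n \<ge> 0") (auto simp: zero_le_mult_iff)
  ultimately show ?thesis by (simp add: pent_def)
qed

text \<open>The completed square: the 1/24 becomes the factor \<open>exp (z / 24)\<close>, and the
  1/6 becomes the rational shift in theta inversion.\<close>

lemma pent_real: "real (pent n) = 3 / 2 * (of_int n + 1 / 6)\<^sup>2 - 1 / 24"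
proof -
  have "2 * real (pent n) = of_int n * (3 * of_int n + 1)"
    using arg_cong[OF pent_eq[of n], of real_of_int] by simp
  then show ?thesis by (simp add: power2_eq_square algebra_simps)
qed

lemma sum_atMost_double: "2 * \<Sum>{..n} = n * (n + 1)" for n :: nat
  by (induction n) auto

lemma double_int_cancel: "2 * x = 2 * y \<Longrightarrow> x = y" for x y :: int
  by simp

lemma Re_inverse_pos:
  assumes "Re w > 0" shows "Re (1 / w) > 0"
proof -
  have "w \<noteq> 0" using assms by auto
  then have "Re (1 / w) = Re w / (cmod w)\<^sup>2" by (simp add: Re_divide cmod_power2)
  then show ?thesis using assms \<open>w \<noteq> 0\<close> by simp
qed

lemma pent_Suc:
  "pent (- int (Suc k)) = Suc k * Suc k + \<Sum>{..k}" "pent (int (Suc k)) = Suc k * Suc k + \<Sum>{..Suc k}"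
proof -
  have "2 * int (pent (- int (Suc k))) = 2 * int (Suc k * Suc k + \<Sum>{..k})"
    unfolding pent_eq using arg_cong[OF sum_atMost_double[of k], of int] by (simp add: algebra_simps)
  then show "pent (- int (Suc k)) = Suc k * Suc k + \<Sum>{..k}"
    by (rule double_int_cancel[THEN of_nat_eq_iff[THEN iffD1]])
  have "2 * int (pent (int (Suc k))) = 2 * int (Suc k * Suc k + \<Sum>{..Suc k})"
    unfolding pent_eq using arg_cong[OF sum_atMost_double[of "Suc k"], of int] by (simp add: algebra_simps)
  then show "pent (int (Suc k)) = Suc k * Suc k + \<Sum>{..Suc k}"
    by (rule double_int_cancel[THEN of_nat_eq_iff[THEN iffD1]])
qed

lemma nat_abs_le_pent: "nat \<bar>n\<bar> \<le> pent n"
proof -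
  have "\<bar>n\<bar> \<le> n\<^sup>2"
  proof (cases "n = 0")
    case False
    then have "\<bar>n\<bar> * 1 \<le> \<bar>n\<bar> * \<bar>n\<bar>" by (intro mult_left_mono) auto
    then show ?thesis by (simp add: power2_eq_square)
  qed simp
  then have "2 * \<bar>n\<bar> \<le> 2 * int (pent n)" unfolding pent_eq by (simp add: power2_eq_square algebra_simps)
  then show ?thesis by linarith
qed

lemma abs_summable_pentagonal:
  fixes q :: complex
  assumes "norm q < 1"
  shows "(\<lambda>n::int. norm ((- 1) ^ nat \<bar>n\<bar> * q ^ pent n)) summable_on UNIV"
proof (rule Infinite_Sum.abs_summable_on_comparison_test'[OF summable_on_int_power_abs])
  show "norm ((- 1) ^ nat \<bar>n\<bar> * q ^ pent n) \<le> norm q ^ nat \<bar>n\<bar>" for n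
    using assms nat_abs_le_pent[of n] by (simp add: norm_mult norm_power power_decreasing)
qed (use assms in auto)

lemma euler_fun_eq_infsum:
  assumes "norm q < 1"
  shows "euler_fun q = (\<Sum>\<^sub>\<infinity>n::int. (- 1) ^ nat \<bar>n\<bar> * q ^ pent n)"
proof -
  have "(- 1) ^ Suc k * (q ^ (Suc k * Suc k + \<Sum>{..k}) + q ^ (Suc k * Suc k + \<Sum>{..Suc k})) =
      (- 1) ^ nat \<bar>int (Suc k)\<bar> * q ^ pent (int (Suc k)) + (- 1) ^ nat \<bar>- int (Suc k)\<bar> * q ^ pent (- int (Suc k))" for k
    unfolding pent_Suc by (simp add: distrib_left del: of_nat_Suc)
  then show ?thesis
    using infsum_int_split[OF abs_summable_pentagonal[OF assms]] pentagonal_number_theorem[OF assms]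
    by (simp add: sums_iff pent_def del: of_nat_Suc)
qed

lemma infsum_finite_sum:
  fixes f :: "'a \<Rightarrow> 'b \<Rightarrow> 'c :: {topological_comm_monoid_add, t2_space}"
  assumes "\<And>a. a \<in> A \<Longrightarrow> f a summable_on S"
  shows "infsum (\<lambda>j. \<Sum>a\<in>A. f a j) S = (\<Sum>a\<in>A. infsum (f a) S)"
proof -
  have "((\<lambda>j. \<Sum>a\<in>A. f a j) has_sum (\<Sum>a\<in>A. infsum (f a) S)) S"
    using assms by (induction A rule: infinite_finite_induct) (auto intro!: has_sum_add has_sum_infsum)
  then show ?thesis by (rule infsumI)
qed

text \<open>Theta inversion on each residue class of \<open>{..<2 * k}\<close> turns the pentagonal series at
  \<open>\<zeta> * exp (- z)\<close> into a series over frequencies \<open>j\<close> with these coefficients.\<close>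

definition gauss_coeff :: "complex \<Rightarrow> nat \<Rightarrow> int \<Rightarrow> complex" where
  "gauss_coeff \<zeta> k j = (\<Sum>a<2 * k. (- 1) ^ a * \<zeta> ^ pent (int a) * cis (- (2 * pi * of_int j * ((6 * real a + 1) / (12 * real k)))))"

lemma norm_gauss_coeff_le:
  assumes "norm \<zeta> = 1" shows "norm (gauss_coeff \<zeta> k j) \<le> real (2 * k)"
proof -
  have "norm (gauss_coeff \<zeta> k j) \<le> (\<Sum>a<2 * k. 1)"
    unfolding gauss_coeff_def by (rule sum_norm_le) (simp add: norm_mult norm_power assms)
  then show ?thesis by simp
qed

lemma euler_fun_modular:
  assumes k: "k > 0" and \<zeta>: "\<zeta> ^ k = 1" and z: "Re z > 0"
  shows "euler_fun (\<zeta> * exp (- z)) = exp (z / 24) * csqrt (of_real pi * (1 / (of_nat (6 * k\<^sup>2) * z))) *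
     (\<Sum>\<^sub>\<infinity>j::int. gauss_coeff \<zeta> k j * exp (- (of_real (pi\<^sup>2) * (1 / (of_nat (6 * k\<^sup>2) * z))) * of_real ((of_int j)\<^sup>2)))"
proof -
  let ?q = "\<zeta> * exp (- z)"
  let ?f = "\<lambda>n::int. (- 1) ^ nat \<bar>n\<bar> * ?q ^ pent n"
  let ?g = "\<lambda>(a, m). int a + 2 * int k * m"
  let ?c = "1 / (of_nat (6 * k\<^sup>2) * z)"
  define b where "b a = (6 * real a + 1) / (12 * real k)" for a :: nat
  have n\<zeta>: "norm \<zeta> = 1" using power_eq_1_iff[OF \<zeta>] k by simp
  have q: "norm ?q < 1" using z by (simp add: norm_mult n\<zeta>)
  have z0: "z \<noteq> 0" using z by auto
  have bij: "bij_betw ?g ({..<2 * k} \<times> UNIV) UNIV"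
  proof (rule bij_betw_byWitness[of _ "\<lambda>n. (nat (n mod (2 * int k)), n div (2 * int k))"])
    show "\<forall>p\<in>{..<2 * k} \<times> UNIV. (\<lambda>n. (nat (n mod (2 * int k)), n div (2 * int k))) (?g p) = p"
      using k by (auto simp: mod_pos_pos_trivial div_pos_pos_trivial)
    show "\<forall>n\<in>UNIV. ?g (nat (n mod (2 * int k)), n div (2 * int k)) = n"
      using k by (auto simp: pos_mod_sign)
    show "(\<lambda>n. (nat (n mod (2 * int k)), n div (2 * int k))) ` UNIV \<subseteq> {..<2 * k} \<times> UNIV"
    proof clarify
      fix n :: int
      have "0 \<le> n mod (2 * int k)" "n mod (2 * int k) < 2 * int k" using k by auto
      then show "nat (n mod (2 * int k)) \<in> {..<2 * k} \<and> n div (2 * int k) \<in> UNIV" by auto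
    qed
  qed auto
  \<comment> \<open>The period is \<open>2 * k\<close> rather than \<open>k\<close>, because of the
    sign and because \<open>pent\<close> halves an even number.\<close>
  have per: "(- 1) ^ nat \<bar>int a + 2 * int k * m\<bar> * \<zeta> ^ pent (int a + 2 * int k * m) = (- 1) ^ a * \<zeta> ^ pent (int a)" for a m
  proof -
    have "even (int a + 2 * int k * m) \<longleftrightarrow> even a" by simp
    then have "even (nat \<bar>int a + 2 * int k * m\<bar>) \<longleftrightarrow> even a" by (simp add: even_nat_iff)
    then have 1: "(- 1) ^ nat \<bar>int a + 2 * int k * m\<bar> = (- 1 :: complex) ^ a" by (simp add: minus_one_power_iff)
    have "2 * int (pent (int a + 2 * int k * m)) = 2 * (int (pent (int a)) + int k * (m * (6 * int a + 6 * int k * m + 1)))"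
      unfolding pent_eq distrib_left by (simp add: pent_eq algebra_simps)
    from double_int_cancel[OF this]
    have "int (pent (int a + 2 * int k * m)) - int (pent (int a)) = int k * (m * (6 * int a + 6 * int k * m + 1))"
      by (simp only: add_diff_cancel_left')
    then have "int (pent (int a + 2 * int k * m)) mod int k = int (pent (int a)) mod int k"
      by (simp add: mod_eq_dvd_iff)
    then have "pent (int a + 2 * int k * m) mod k = pent (int a) mod k" by (metis of_nat_eq_iff zmod_int)
    moreover have "\<zeta> ^ n = \<zeta> ^ (n mod k)" for n
    proof -
      have "\<zeta> ^ n = \<zeta> ^ (k * (n div k) + n mod k)" by simp
      then show ?thesis by (simp only: power_add power_mult \<zeta> power_one mult_1)
    qed
    ultimately show ?thesis unfolding 1 by metis
  qed
  have term_eq: "?f (int a + 2 * int k * m) = (- 1) ^ a * \<zeta> ^ pent (int a) * (exp (z / 24) * exp (- (1 / ?c) * of_real ((of_int m + b a)\<^sup>2)))" for a m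
  proof -
    have "of_nat (pent (int a + 2 * int k * m)) = complex_of_real (3 / 2 * (of_int (int a + 2 * int k * m) + 1 / 6)\<^sup>2 - 1 / 24)"
      by (metis of_real_of_nat_eq pent_real)
    also have "3 / 2 * (of_int (int a + 2 * int k * m) + 1 / 6)\<^sup>2 - 1 / 24 = real (6 * k\<^sup>2) * (of_int m + b a)\<^sup>2 - 1 / 24"
    proof -
      have "of_int (int a + 2 * int k * m) + 1 / 6 = 2 * real k * (of_int m + b a)"
        using k by (simp add: b_def field_simps)
      then show ?thesis by (simp add: power_mult_distrib)
    qed
    finally have N: "of_nat (pent (int a + 2 * int k * m)) = complex_of_real (real (6 * k\<^sup>2) * (of_int m + b a)\<^sup>2 - 1 / 24)" .
    have ic: "1 / ?c = of_nat (6 * k\<^sup>2) * z" by simp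
    have "of_nat (pent (int a + 2 * int k * m)) * (- z) = z / 24 + (- (1 / ?c) * of_real ((of_int m + b a)\<^sup>2))"
      unfolding N ic by (simp add: algebra_simps)
    then have "exp (- z) ^ pent (int a + 2 * int k * m) = exp (z / 24) * exp (- (1 / ?c) * of_real ((of_int m + b a)\<^sup>2))"
      by (simp only: exp_of_nat_mult[symmetric] exp_add[symmetric])
    then show ?thesis unfolding per[of a m, symmetric] by (simp only: power_mult_distrib mult.assoc)
  qed
  have c: "Re ?c > 0"
    by (rule Re_inverse_pos) (use z k in simp)
  have bQ: "b a \<in> \<rat>" for a unfolding b_def by (intro Rats_divide Rats_add Rats_mult) auto
  have "euler_fun ?q = infsum ?f UNIV" by (rule euler_fun_eq_infsum[OF q])
  also have "\<dots> = infsum (\<lambda>p. ?f (?g p)) ({..<2 * k} \<times> UNIV)"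
    by (rule infsum_reindex_bij_betw[OF bij, symmetric])
  also have "\<dots> = infsum (\<lambda>(a, m). ?f (?g (a, m))) ({..<2 * k} \<times> UNIV)"
    by (rule infsum_cong) (simp add: case_prod_unfold)
  also have "\<dots> = infsum (\<lambda>a. infsum (\<lambda>m. ?f (?g (a, m))) UNIV) {..<2 * k}"
  proof (rule infsum_Sigma'_banach[symmetric])
    have "?f summable_on UNIV" using abs_summable_summable[OF abs_summable_pentagonal[OF q]] .
    then have "(\<lambda>p. ?f (?g p)) summable_on {..<2 * k} \<times> UNIV"
      using summable_on_reindex_bij_betw[OF bij, of ?f] by blast
    then show "(\<lambda>(a, m). ?f (?g (a, m))) summable_on {..<2 * k} \<times> UNIV"
      by (rule summable_on_cong[THEN iffD1, rotated]) (simp add: case_prod_unfold)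
  qed
  also have "\<dots> = (\<Sum>a<2 * k. infsum (\<lambda>m. ?f (?g (a, m))) UNIV)" by simp
  also have "\<dots> = (\<Sum>a<2 * k. (- 1) ^ a * \<zeta> ^ pent (int a) * (exp (z / 24) * (csqrt (of_real pi * ?c) *
       (\<Sum>\<^sub>\<infinity>j::int. cis (- (2 * pi * of_int j * b a)) * exp (- (of_real (pi\<^sup>2) * ?c) * of_real ((of_int j)\<^sup>2))))))"
  proof (rule sum.cong)
    fix a
    have "infsum (\<lambda>m. ?f (?g (a, m))) UNIV = infsum (\<lambda>m. (- 1) ^ a * \<zeta> ^ pent (int a) * (exp (z / 24) * exp (- (1 / ?c) * of_real ((of_int m + b a)\<^sup>2)))) UNIV"
      by (simp only: term_eq case_prod_conv)
    also have "\<dots> = (- 1) ^ a * \<zeta> ^ pent (int a) * (exp (z / 24) * (\<Sum>\<^sub>\<infinity>m::int. exp (- (1 / ?c) * of_real ((of_int m + b a)\<^sup>2))))"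
      by (simp only: infsum_cmult_right')
    finally show "infsum (\<lambda>m. ?f (?g (a, m))) UNIV = (- 1) ^ a * \<zeta> ^ pent (int a) * (exp (z / 24) * (csqrt (of_real pi * ?c) *
       (\<Sum>\<^sub>\<infinity>j::int. cis (- (2 * pi * of_int j * b a)) * exp (- (of_real (pi\<^sup>2) * ?c) * of_real ((of_int j)\<^sup>2)))))"
      unfolding theta_inversion[OF bQ c] .
  qed simp
  also have "\<dots> = exp (z / 24) * csqrt (of_real pi * ?c) * (\<Sum>a<2 * k. \<Sum>\<^sub>\<infinity>j::int. (- 1) ^ a * \<zeta> ^ pent (int a) *
       (cis (- (2 * pi * of_int j * b a)) * exp (- (of_real (pi\<^sup>2) * ?c) * of_real ((of_int j)\<^sup>2))))"
    unfolding infsum_cmult_right' sum_distrib_left by (simp only: mult_ac)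
  also have "(\<Sum>a<2 * k. \<Sum>\<^sub>\<infinity>j::int. (- 1) ^ a * \<zeta> ^ pent (int a) *
       (cis (- (2 * pi * of_int j * b a)) * exp (- (of_real (pi\<^sup>2) * ?c) * of_real ((of_int j)\<^sup>2)))) =
    (\<Sum>\<^sub>\<infinity>j::int. \<Sum>a<2 * k. (- 1) ^ a * \<zeta> ^ pent (int a) *
       (cis (- (2 * pi * of_int j * b a)) * exp (- (of_real (pi\<^sup>2) * ?c) * of_real ((of_int j)\<^sup>2))))"
  proof (rule infsum_finite_sum[symmetric])
    fix a
    have "Re (of_real (pi\<^sup>2) * w) = pi\<^sup>2 * Re w" for w by simp
    then have "Re (of_real (pi\<^sup>2) * ?c) > 0" using c by (simp only:) simp
    from abs_summable_gaussian[of "\<lambda>j. cis (- (2 * pi * of_int j * b a))", OF _ this, of 0]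
    have "(\<lambda>j::int. cis (- (2 * pi * of_int j * b a)) * exp (- (of_real (pi\<^sup>2) * ?c) * of_real ((of_int j)\<^sup>2))) summable_on UNIV"
      by - (rule abs_summable_summable, simp only: add_0_right norm_cis order_refl)
    then show "(\<lambda>j::int. (- 1) ^ a * \<zeta> ^ pent (int a) * (cis (- (2 * pi * of_int j * b a)) * exp (- (of_real (pi\<^sup>2) * ?c) * of_real ((of_int j)\<^sup>2)))) summable_on UNIV"
      by (rule summable_on_cmult_right)
  qed
  also have "\<dots> = (\<Sum>\<^sub>\<infinity>j::int. gauss_coeff \<zeta> k j * exp (- (of_real (pi\<^sup>2) * ?c) * of_real ((of_int j)\<^sup>2)))"
    by (simp only: gauss_coeff_def b_def sum_distrib_right mult.assoc)
  finally show ?thesis .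
qed

text \<open>In this cone \<open>Re (1 / z)\<close> is comparable to 1 / |z|, so it tends to infinity
  at 0, which fails in the whole half plane. The arc of half-width \<open>y\<close> at distance
  \<open>y\<close> from the imaginary axis lies in it.\<close>

definition sector :: "complex set" where
  "sector = {z. Re z > 0 \<and> \<bar>Im z\<bar> \<le> Re z}"

lemma norm_sector_le: "z \<in> sector \<Longrightarrow> norm z \<le> 2 * Re z"
  using cmod_le[of z] by (simp add: sector_def)

lemma Re_inverse_sector:
  assumes "z \<in> sector" shows "1 / (2 * Re z) \<le> Re (1 / z)"
proof -
  have z: "Re z > 0" "(Im z)\<^sup>2 \<le> (Re z)\<^sup>2"
    using assms by (auto simp: sector_def abs_le_square_iff[symmetric])
  then have "z \<noteq> 0" by auto
  have "1 / (2 * Re z) = Re z / (2 * (Re z)\<^sup>2)" using z by (simp add: power2_eq_square)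
  also have "\<dots> \<le> Re z / ((Re z)\<^sup>2 + (Im z)\<^sup>2)"
    using z by (intro divide_left_mono mult_pos_pos add_pos_nonneg) auto
  also have "\<dots> = Re (1 / z)" by (simp add: Re_divide)
  finally show ?thesis .
qed

lemma filterlim_Re_inverse_sector: "filterlim (\<lambda>z. Re (1 / z)) at_top (at 0 within sector)"
proof (rule filterlim_at_top_mono)
  show "filterlim (\<lambda>z::complex. inverse (2 * norm z)) at_top (at 0 within sector)"
  proof (rule filterlim_inverse_at_top)
    show "((\<lambda>z::complex. 2 * norm z) \<longlongrightarrow> 0) (at 0 within sector)" by (auto intro!: tendsto_eq_intros)
    show "\<forall>\<^sub>F z::complex in at 0 within sector. 0 < 2 * norm z" by (auto simp: eventually_at_filter)
  qed
  show "\<forall>\<^sub>F z in at 0 within sector. inverse (2 * norm z) \<le> Re (1 / z)"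
    unfolding eventually_at_filter
  proof (intro always_eventually allI impI)
    fix z :: complex assume z: "z \<noteq> 0" "z \<in> sector"
    then have "Re z > 0" by (simp add: sector_def)
    then have "inverse (2 * norm z) \<le> 1 / (2 * Re z)"
      using complex_Re_le_cmod[of z] z by (simp add: inverse_eq_divide frac_le)
    then show "inverse (2 * norm z) \<le> Re (1 / z)" using Re_inverse_sector[OF z(2)] by linarith
  qed
qed

lemma sector_nontrivial: "at 0 within sector \<noteq> bot"
proof -
  have "0 islimpt sector"
    unfolding islimpt_sequential
  proof (intro exI conjI allI)
    show "complex_of_real (1 / real (Suc n)) \<in> sector - {0}" for n by (simp add: sector_def del: of_nat_Suc)
    have "(\<lambda>n. 1 / real (Suc n)) \<longlonglongrightarrow> 0" by real_asymp
    then have "(\<lambda>n. complex_of_real (1 / real (Suc n))) \<longlonglongrightarrow> of_real 0" by (intro tendsto_of_real)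
    then show "(\<lambda>n. complex_of_real (1 / real (Suc n))) \<longlonglongrightarrow> 0" by simp
  qed
  then show ?thesis by (simp add: trivial_limit_within)
qed

lemma csqrt_divide:
  assumes "Re z > 0" "r > 0"
  shows "csqrt (of_real r * (1 / z)) = of_real (sqrt r) / csqrt z" "csqrt z \<noteq> 0" "Re (csqrt z) > 0"
proof -
  show nz: "csqrt z \<noteq> 0" using assms(1) by auto
  show pos: "Re (csqrt z) > 0" using assms(1) by (simp add: add_nonneg_pos)
  show "csqrt (of_real r * (1 / z)) = of_real (sqrt r) / csqrt z"
  proof (rule csqrt_unique)
    show "(of_real (sqrt r) / csqrt z)\<^sup>2 = of_real r * (1 / z)"
      using assms by (simp add: power_divide flip: of_real_power)
    have "Re (of_real (sqrt r) / csqrt z) = sqrt r * Re (1 / csqrt z)"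
      by (simp add: Re_divide)
    then show "0 < Re (of_real (sqrt r) / csqrt z) \<or> Re (of_real (sqrt r) / csqrt z) = 0 \<and> 0 \<le> Im (of_real (sqrt r) / csqrt z)"
      using Re_inverse_pos[OF pos] assms(2) by simp
  qed
qed

text \<open>Once frequency 0 is absent, the frequencies 1 and -1 dominate. The exponential factor
  normalises these two to constants and makes all the others decay.\<close>

lemma euler_fun_asymptotics:
  assumes k: "k > 0" and \<zeta>: "\<zeta> ^ k = 1" and \<Gamma>0: "gauss_coeff \<zeta> k 0 = 0"
  shows "((\<lambda>z. euler_fun (\<zeta> * exp (- z)) * csqrt z * exp (of_real (pi\<^sup>2 / (6 * (real k)\<^sup>2)) / z)) \<longlongrightarrow>
     of_real (sqrt (pi / (6 * (real k)\<^sup>2))) * (gauss_coeff \<zeta> k 1 + gauss_coeff \<zeta> k (- 1))) (at 0 within sector)"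
proof -
  define P where "P = pi\<^sup>2 / (6 * (real k)\<^sup>2)"
  have P: "P > 0" using k by (simp add: P_def)
  let ?F = "at 0 within sector"
  let ?\<Gamma> = "gauss_coeff \<zeta> k"
  define a where "a j z = ?\<Gamma> j * exp (- (of_real P / z) * of_real ((of_int j)\<^sup>2 - 1))" for j :: int and z
  have n\<zeta>: "norm \<zeta> = 1" using power_eq_1_iff[OF \<zeta>] k by simp
  have norm_a: "norm (a j z) = norm (?\<Gamma> j) * exp (- (P * Re (1 / z) * ((of_int j)\<^sup>2 - 1)))" for j z
  proof -
    have re: "Re (of_real r * w) = r * Re w" for r w by simp
    have "- (of_real P / z) * of_real ((of_int j)\<^sup>2 - 1) = of_real (- (P * ((of_int j)\<^sup>2 - 1))) * (1 / z)" by simp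
    then have "Re (- (of_real P / z) * of_real ((of_int j)\<^sup>2 - 1)) = - (P * ((of_int j)\<^sup>2 - 1)) * Re (1 / z)"
      by (simp only: re)
    then show ?thesis by (simp add: a_def norm_mult mult_ac)
  qed
  have big: "filterlim (\<lambda>z. P * Re (1 / z)) at_top ?F"
    by (rule filterlim_tendsto_pos_mult_at_top[OF tendsto_const P filterlim_Re_inverse_sector])
  have lim: "((\<lambda>z. \<Sum>\<^sub>\<infinity>j. a j z) \<longlongrightarrow> (\<Sum>\<^sub>\<infinity>j. if j \<in> {- 1, 1} then ?\<Gamma> j else 0)) ?F"
  proof (rule tannery_int)
    fix j :: int
    consider "j \<in> {- 1, 1}" | "j = 0" | "\<bar>j\<bar> \<ge> 2" by fastforce
    then show "(a j \<longlongrightarrow> (if j \<in> {- 1, 1} then ?\<Gamma> j else 0)) ?F"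
    proof cases
      case 1
      then have "a j = (\<lambda>z. ?\<Gamma> j)" by (auto simp: a_def)
      then show ?thesis using 1 by simp
    next
      case 2
      then have "a j = (\<lambda>z. 0)" using \<Gamma>0 by (auto simp: a_def)
      then show ?thesis using 2 by simp
    next
      case 3
      then have "\<bar>real_of_int j\<bar> \<ge> 2" by linarith
      then have "(2::real)\<^sup>2 \<le> (of_int j)\<^sup>2" using power_mono[of 2 "\<bar>real_of_int j\<bar>" 2] by simp
      then have j: "(of_int j)\<^sup>2 - 1 > (0::real)" by simp
      have "filterlim (\<lambda>z. P * Re (1 / z) * ((of_int j)\<^sup>2 - 1)) at_top ?F"
        by (rule filterlim_at_top_mult_tendsto_pos[OF tendsto_const j big])
      then have "((\<lambda>z. exp (- (P * Re (1 / z) * ((of_int j)\<^sup>2 - 1)))) \<longlongrightarrow> 0) ?F"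
        by (intro filterlim_compose[OF exp_at_bot] filterlim_uminus_at_bot[THEN iffD2]) simp
      then have "((\<lambda>z. norm (a j z)) \<longlongrightarrow> norm (?\<Gamma> j) * 0) ?F" unfolding norm_a by (intro tendsto_mult tendsto_const)
      then have "(a j \<longlongrightarrow> 0) ?F" by (simp add: tendsto_norm_zero_iff)
      then show ?thesis using 3 by auto
    qed
  next
    \<comment> \<open>As soon as \<open>P * Re (1 / z)\<close> is at least 1, the decay is at least
      exp (1 - j^2) for every nonzero j; this is the origin of \<open>exp 1\<close>.\<close>
    show "\<forall>\<^sub>F z in ?F. \<forall>j. norm (a j z) \<le> real (2 * k) * exp 1 * exp (- 1 * (of_int j + 0)\<^sup>2)"
      using filterlim_at_top[THEN iffD1, OF big, rule_format, of 1]
    proof eventually_elim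
      case (elim z)
      show ?case
      proof
        fix j :: int
        show "norm (a j z) \<le> real (2 * k) * exp 1 * exp (- 1 * (of_int j + 0)\<^sup>2)"
        proof (cases "j = 0")
          case True
          then show ?thesis using \<Gamma>0 by (simp add: a_def)
        next
          case False
          then have "\<bar>real_of_int j\<bar> \<ge> 1" by linarith
          then have "(1::real)\<^sup>2 \<le> (of_int j)\<^sup>2" using power_mono[of 1 "\<bar>real_of_int j\<bar>" 2] by simp
          then have "1 * ((of_int j)\<^sup>2 - 1) \<le> P * Re (1 / z) * ((of_int j)\<^sup>2 - 1)"
            using elim by (intro mult_right_mono) auto
          then have "exp (- (P * Re (1 / z) * ((of_int j)\<^sup>2 - 1))) \<le> exp (1 + - 1 * (of_int j + 0)\<^sup>2)" by simp
          then have "norm (a j z) \<le> real (2 * k) * exp (1 + - 1 * (of_int j + 0)\<^sup>2)"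
            unfolding norm_a using norm_gauss_coeff_le[OF n\<zeta>] by (intro mult_mono) auto
          then show ?thesis by (simp only: exp_add mult.assoc)
        qed
      qed
    qed
    show "(\<lambda>j::int. real (2 * k) * exp 1 * exp (- 1 * (of_int j + 0)\<^sup>2)) summable_on UNIV"
      by (intro summable_on_cmult_right summable_on_gaussian) simp
  qed (rule sector_nontrivial)
  have b: "(\<Sum>\<^sub>\<infinity>j. if j \<in> {- 1, 1} then ?\<Gamma> j else 0) = ?\<Gamma> 1 + ?\<Gamma> (- 1)"
  proof -
    have "(\<Sum>\<^sub>\<infinity>j. if j \<in> {- 1, 1} then ?\<Gamma> j else 0) = infsum ?\<Gamma> {- 1, 1}"
      by (rule infsum_cong_neutral) auto
    then show ?thesis by simp
  qed
  have e1: "((\<lambda>z::complex. exp (z / 24)) \<longlongrightarrow> 1) ?F" by (auto intro!: tendsto_eq_intros)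
  have "((\<lambda>z. exp (z / 24) * of_real (sqrt (pi / (6 * (real k)\<^sup>2))) * (\<Sum>\<^sub>\<infinity>j. a j z)) \<longlongrightarrow>
      1 * of_real (sqrt (pi / (6 * (real k)\<^sup>2))) * (?\<Gamma> 1 + ?\<Gamma> (- 1))) ?F"
    using lim unfolding b by (intro tendsto_mult e1 tendsto_const)
  moreover have "\<forall>\<^sub>F z in ?F. exp (z / 24) * of_real (sqrt (pi / (6 * (real k)\<^sup>2))) * (\<Sum>\<^sub>\<infinity>j. a j z) =
      euler_fun (\<zeta> * exp (- z)) * csqrt z * exp (of_real P / z)"
    unfolding eventually_at_filter
  proof (intro always_eventually allI impI)
    fix z assume "z \<in> sector"
    then have z: "Re z > 0" by (simp add: sector_def)
    have r: "pi / (6 * (real k)\<^sup>2) > 0" using k by simp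
    have "of_real pi * (1 / (of_nat (6 * k\<^sup>2) * z)) = of_real (pi / (6 * (real k)\<^sup>2)) * (1 / z)" by simp
    then have cs: "csqrt (of_real pi * (1 / (of_nat (6 * k\<^sup>2) * z))) * csqrt z = of_real (sqrt (pi / (6 * (real k)\<^sup>2)))"
      using csqrt_divide(1,2)[OF z r] by simp
    have "(\<Sum>\<^sub>\<infinity>j. a j z) = (\<Sum>\<^sub>\<infinity>j. ?\<Gamma> j * exp (- (of_real (pi\<^sup>2) * (1 / (of_nat (6 * k\<^sup>2) * z))) * of_real ((of_int j)\<^sup>2)) * exp (of_real P / z))"
    proof (rule infsum_cong)
      fix j :: int
      have gen: "- A * of_real (x - 1) = - A * of_real x + A" for A :: complex and x
        by (simp add: algebra_simps)
      have A: "of_real P / z = of_real (pi\<^sup>2) * (1 / (of_nat (6 * k\<^sup>2) * z))" by (simp add: P_def)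
      have "- (of_real P / z) * of_real ((of_int j)\<^sup>2 - 1) =
         - (of_real (pi\<^sup>2) * (1 / (of_nat (6 * k\<^sup>2) * z))) * of_real ((of_int j)\<^sup>2) + of_real P / z"
        unfolding A by (rule gen)
      then show "a j z = ?\<Gamma> j * exp (- (of_real (pi\<^sup>2) * (1 / (of_nat (6 * k\<^sup>2) * z))) * of_real ((of_int j)\<^sup>2)) * exp (of_real P / z)"
        unfolding a_def by (simp only: exp_add mult.assoc)
    qed
    then have "(\<Sum>\<^sub>\<infinity>j. a j z) = (\<Sum>\<^sub>\<infinity>j. ?\<Gamma> j * exp (- (of_real (pi\<^sup>2) * (1 / (of_nat (6 * k\<^sup>2) * z))) * of_real ((of_int j)\<^sup>2))) * exp (of_real P / z)"
      by (simp only: infsum_cmult_left')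
    then show "exp (z / 24) * of_real (sqrt (pi / (6 * (real k)\<^sup>2))) * (\<Sum>\<^sub>\<infinity>j. a j z) =
      euler_fun (\<zeta> * exp (- z)) * csqrt z * exp (of_real P / z)"
      unfolding euler_fun_modular[OF k \<zeta> z] cs[symmetric] by (simp only: mult_ac)
  qed
  ultimately show ?thesis unfolding P_def mult_1_left by (rule Lim_transform_eventually)
qed

section \<open>Gauss sums\<close>

lemma pent_nat: "2 * pent (int a) = a * (3 * a + 1)"
proof -
  have "int (2 * pent (int a)) = int (a * (3 * a + 1))" using pent_eq[of "int a"] by (simp add: algebra_simps)
  then show ?thesis by (simp only: of_nat_eq_iff)
qed

text \<open>Polarisation: the cross term \<open>3 * a * d\<close> makes products of shifted Gauss
  terms linear characters in \<open>a\<close>.\<close>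

lemma pent_add: "pent (int (a + d)) = pent (int a) + pent (int d) + 3 * a * d"
proof -
  have "2 * pent (int (a + d)) = 2 * (pent (int a) + pent (int d) + 3 * a * d)"
    unfolding distrib_left pent_nat by (simp add: algebra_simps)
  then show ?thesis by simp
qed

lemma sum_cis_multiples:
  fixes m :: int
  assumes "k > 0" "n > 0"
  shows "(\<Sum>a<n * k. cis (2 * pi * of_int m * real a / real k)) = (if int k dvd m then of_nat (n * k) else 0)"
proof -
  define \<rho> where "\<rho> = cis (2 * pi * of_int m / real k)"
  have "cis (2 * pi * of_int m * real a / real k) = \<rho> ^ a" for a
    by (simp add: \<rho>_def Complex.DeMoivre mult_ac)
  then have eq: "(\<Sum>a<n * k. cis (2 * pi * of_int m * real a / real k)) = (\<Sum>a<n * k. \<rho> ^ a)" by simp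
  have \<rho>1: "\<rho> = 1 \<longleftrightarrow> int k dvd m"
  proof
    assume "\<rho> = 1"
    then obtain i :: int where "2 * pi * of_int m / real k = of_int i * (2 * pi)"
      unfolding \<rho>_def cis_eq_1_iff by blast
    then have "real_of_int m = of_int (int k * i)" using assms by (simp add: field_simps)
    then have "m = int k * i" by linarith
    then show "int k dvd m" by simp
  next
    assume "int k dvd m"
    then obtain i where "m = int k * i" by auto
    then have "2 * pi * of_int m / real k = 2 * pi * of_int i" using assms by simp
    then show "\<rho> = 1" by (simp only: \<rho>_def cis_multiple_2pi Ints_of_int)
  qed
  have "\<rho> ^ (n * k) = 1"
  proof -
    have "real (n * k) * (2 * pi * of_int m / real k) = 2 * pi * of_int (int n * m)" using assms by simp
    then show ?thesis by (simp only: \<rho>_def Complex.DeMoivre cis_multiple_2pi Ints_of_int)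
  qed
  then show ?thesis unfolding eq using \<rho>1 by (auto simp: sum_gp_strict)
qed

lemma sum_periodic_shift:
  fixes F :: "nat \<Rightarrow> 'a :: comm_ring_1"
  assumes "\<And>a. F (a + N) = F a"
  shows "(\<Sum>d<N. F (a + d)) = (\<Sum>d<N. F d)"
proof (induction a)
  case (Suc a)
  have "(\<Sum>d<N. F (Suc a + d)) + F a = (\<Sum>d<N. F (a + d)) + F (a + N)"
    using sum.lessThan_Suc_shift[of "\<lambda>d. F (a + d)" N] by (simp add: add.commute)
  then show ?case using Suc assms by simp
qed simp

context
  fixes s h :: nat and k :: nat and \<zeta> :: complex
  assumes k_def: "k = 2 ^ (s + 1)" and h: "odd h" and \<zeta>_def: "\<zeta> = cis (2 * pi * real h / real k)"
begin

lemma k_pos: "k > 0" and even_k: "even k"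
  by (simp_all add: k_def)

lemma zeta_power: "\<zeta> ^ n = cis (2 * pi * real (h * n) / real k)"
  by (simp add: \<zeta>_def Complex.DeMoivre mult_ac)

lemma zeta_k: "\<zeta> ^ k = 1"
proof -
  have "2 * pi * real (h * k) / real k = 2 * pi * of_int (int h)" using k_pos by simp
  then show ?thesis by (simp only: zeta_power cis_multiple_2pi Ints_of_int)
qed

lemma zeta_half: "\<zeta> ^ (2 ^ s) = - 1"
proof -
  have "2 * pi * real (h * 2 ^ s) / real k = pi * real h" by (simp add: k_def)
  then have "\<zeta> ^ (2 ^ s) = cis (pi * real h)" by (simp only: zeta_power)
  also have "\<dots> = cis pi ^ h" by (simp only: Complex.DeMoivre mult.commute)
  finally show ?thesis using h by simp
qed

definition gchar :: "nat \<Rightarrow> complex" where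
  "gchar a = (- 1) ^ a * \<zeta> ^ pent (int a)"

lemma gchar_add: "gchar (a + d) = gchar a * gchar d * \<zeta> ^ (3 * a * d)"
  unfolding gchar_def pent_add by (simp add: power_add)

lemma gchar_k: "gchar k = - 1"
proof -
  have "2 * pent (int k) = 2 * (2 ^ s * (3 * k + 1))" unfolding pent_nat by (simp add: k_def)
  then have "pent (int k) = 2 ^ s * (3 * k + 1)" by (simp only: mult_cancel_left) simp
  then have "\<zeta> ^ pent (int k) = (- 1) ^ (3 * k + 1)" by (simp only: power_mult zeta_half)
  then show ?thesis using even_k by (simp add: gchar_def)
qed

lemma gchar_add_k: "gchar (a + k) = - gchar a"
proof -
  have "\<zeta> ^ (3 * a * k) = 1"
    using zeta_k by (metis mult.commute power_mult power_one)
  then show ?thesis by (simp add: gchar_add gchar_k)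
qed

lemma norm_gchar: "norm (gchar a) = 1"
proof -
  have "norm \<zeta> = 1" by (simp add: \<zeta>_def)
  then show ?thesis by (simp add: gchar_def norm_mult norm_power)
qed

definition gterm :: "int \<Rightarrow> nat \<Rightarrow> complex" where
  "gterm j a = gchar a * cis (- (2 * pi * of_int j * ((6 * real a + 1) / (12 * real k))))"

lemma gauss_coeff_eq: "gauss_coeff \<zeta> k j = (\<Sum>a<2 * k. gterm j a)"
  by (simp add: gauss_coeff_def gterm_def gchar_def)

lemma gterm_add_k: "gterm j (a + k) = - (cis (- (pi * of_int j)) * gterm j a)"
proof -
  have "- (2 * pi * of_int j * ((6 * real (a + k) + 1) / (12 * real k))) =
     - (2 * pi * of_int j * ((6 * real a + 1) / (12 * real k))) + - (pi * of_int j)"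
    using k_pos by (simp add: field_simps)
  then show ?thesis unfolding gterm_def gchar_add_k by (simp only: cis_mult[symmetric]) simp
qed

lemma gterm_add_2k: "gterm j (a + 2 * k) = gterm j a"
proof -
  have "cis (- (pi * of_int j)) * cis (- (pi * of_int j)) = cis (2 * pi * of_int (- j))"
    unfolding cis_mult by (rule arg_cong[of _ _ cis]) simp
  also have "\<dots> = 1" by (simp only: cis_multiple_2pi Ints_of_int)
  finally have "cis (- (pi * of_int j)) * cis (- (pi * of_int j)) = 1" .
  then have "cis (- (pi * of_int j)) * (cis (- (pi * of_int j)) * gterm j a) = gterm j a"
    by (metis mult.assoc mult_1)
  then show ?thesis
    using gterm_add_k[of j "a + k"] gterm_add_k[of j a] by (simp add: mult_2 add.assoc)
qed

lemma sum_gterm_split: "(\<Sum>a<2 * k. F a) = (\<Sum>a<k. F a + F (a + k))" for F :: "nat \<Rightarrow> complex"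
proof -
  have "(\<Sum>a<k + n. F a) = (\<Sum>a<k. F a) + (\<Sum>a<n. F (a + k))" for n
    by (induction n) (auto simp: add.commute add.assoc)
  then show ?thesis by (simp add: mult_2 sum.distrib)
qed

text \<open>The character changes sign under a shift by \<open>k\<close>, so the two halves of the
  period cancel. This is the hypothesis of \<open>euler_fun_asymptotics\<close>.\<close>

lemma gauss_coeff_0: "gauss_coeff \<zeta> k 0 = 0"
  unfolding gauss_coeff_eq sum_gterm_split gterm_add_k by simp

text \<open>The usual treatment of a quadratic Gauss sum: shifting one index by periodicity makes
  the inner sum over \<open>a\<close> a sum of roots of unity.\<close>

lemma gauss_coeff_mult_cnj:
  "gauss_coeff \<zeta> k i * cnj (gauss_coeff \<zeta> k j) = (\<Sum>d<2 * k. \<Sum>a<2 * k. gterm i (a + d) * cnj (gterm j a))"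
proof -
  have "gauss_coeff \<zeta> k i * cnj (gauss_coeff \<zeta> k j) = (\<Sum>a<2 * k. (\<Sum>d<2 * k. gterm i d) * cnj (gterm j a))"
    by (simp add: gauss_coeff_eq sum_distrib_left)
  also have "\<dots> = (\<Sum>a<2 * k. (\<Sum>d<2 * k. gterm i (a + d)) * cnj (gterm j a))"
    by (simp only: sum_periodic_shift[of "gterm i", OF gterm_add_2k])
  also have "\<dots> = (\<Sum>a<2 * k. \<Sum>d<2 * k. gterm i (a + d) * cnj (gterm j a))"
    by (simp add: sum_distrib_right)
  finally show ?thesis by (subst sum.swap)
qed

lemma gterm_mult_cnj:
  "gterm i (a + d) * cnj (gterm j a) = gchar d * \<zeta> ^ (3 * a * d) *
     cis (- (2 * pi * of_int i * ((6 * real (a + d) + 1) / (12 * real k))) + 2 * pi * of_int j * ((6 * real a + 1) / (12 * real k)))"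
proof -
  have "gchar a * cnj (gchar a) = 1"
    using norm_gchar[of a] complex_norm_square[of "gchar a"] by simp
  moreover have "(x * y * z * c) * (x' * c') = (x * x') * (y * z * (c * c'))" for x y z c x' c' :: complex
    by (simp only: mult_ac)
  ultimately show ?thesis
    unfolding gterm_def gchar_add complex_cnj_mult cis_cnj by (simp only: mult_1 cis_mult minus_minus)
qed

lemma coprime_3h_k: "coprime (3 * h) k"
  using h by (simp add: k_def coprime_power_right_iff)

text \<open>The inner sum vanishes unless \<open>k\<close> divides \<open>3 * h * d\<close>, that is
  unless \<open>k\<close> divides \<open>d\<close>, since \<open>k\<close> is a power of 2 and
  \<open>h\<close> is odd. The two survivors \<open>d = 0\<close> and \<open>d = k\<close>
  contribute equally.\<close>

lemma norm_gauss_coeff_square: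
  assumes "j \<in> {- 1, 1}" shows "gauss_coeff \<zeta> k j * cnj (gauss_coeff \<zeta> k j) = of_nat (4 * k)"
proof -
  have "(\<Sum>a<2 * k. gterm j (a + d) * cnj (gterm j a)) =
      gchar d * cis (- (pi * of_int j * real d / real k)) * (if k dvd d then of_nat (2 * k) else 0)" for d
  proof -
    have "gterm j (a + d) * cnj (gterm j a) = gchar d * cis (- (pi * of_int j * real d / real k)) *
       cis (2 * pi * of_int (int (3 * h * d)) * real a / real k)" for a
    proof -
      have "- (2 * pi * of_int j * ((6 * real (a + d) + 1) / (12 * real k))) + 2 * pi * of_int j * ((6 * real a + 1) / (12 * real k)) =
        - (pi * of_int j * real d / real k)" using k_pos by (simp add: field_simps)
      moreover have "\<zeta> ^ (3 * a * d) = cis (2 * pi * of_int (int (3 * h * d)) * real a / real k)"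
        by (simp add: zeta_power mult_ac)
      ultimately show ?thesis unfolding gterm_mult_cnj by (simp only: mult_ac)
    qed
    then have "(\<Sum>a<2 * k. gterm j (a + d) * cnj (gterm j a)) = gchar d * cis (- (pi * of_int j * real d / real k)) *
       (\<Sum>a<2 * k. cis (2 * pi * of_int (int (3 * h * d)) * real a / real k))"
      by (simp only: sum_distrib_left)
    also have "(\<Sum>a<2 * k. cis (2 * pi * of_int (int (3 * h * d)) * real a / real k)) = (if int k dvd int (3 * h * d) then of_nat (2 * k) else 0)"
      by (rule sum_cis_multiples) (use k_pos in auto)
    also have "int k dvd int (3 * h * d) \<longleftrightarrow> k dvd d"
      unfolding int_dvd_int_iff using coprime_3h_k by (simp add: coprime_commute coprime_dvd_mult_right_iff)
    finally show ?thesis .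
  qed
  then have "gauss_coeff \<zeta> k j * cnj (gauss_coeff \<zeta> k j) =
      (\<Sum>d<2 * k. gchar d * cis (- (pi * of_int j * real d / real k)) * (if k dvd d then of_nat (2 * k) else 0))"
    unfolding gauss_coeff_mult_cnj by simp
  also have "\<dots> = (\<Sum>d\<in>{0, k}. gchar d * cis (- (pi * of_int j * real d / real k)) * of_nat (2 * k))"
  proof (rule sum.mono_neutral_cong_right)
    show "\<forall>d\<in>{..<2 * k} - {0, k}. gchar d * cis (- (pi * of_int j * real d / real k)) * (if k dvd d then of_nat (2 * k) else 0) = 0"
    proof
      fix d assume d: "d \<in> {..<2 * k} - {0, k}"
      have "\<not> k dvd d"
      proof
        assume "k dvd d"
        then obtain m where m: "d = k * m" by auto
        then have "m < 2" "m \<noteq> 0" "m \<noteq> 1" using d by auto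
        then show False by linarith
      qed
      then show "gchar d * cis (- (pi * of_int j * real d / real k)) * (if k dvd d then of_nat (2 * k) else 0) = 0" by simp
    qed
  qed (use k_pos in auto)
  also have "\<dots> = of_nat (4 * k)"
  proof -
    have "cis (- (pi * of_int j * real k / real k)) = - 1" using assms k_pos by (auto simp: cis.ctr complex_eq_iff)
    then show ?thesis using k_pos by (simp add: gchar_k) (simp add: gchar_def pent_def)
  qed
  finally show ?thesis .
qed

text \<open>Now the surviving shifts are those inverse to \<open>3 * h\<close> mod \<open>k\<close>.
  The exact value of \<open>j\<close> is left open: for the squared modulus of the sum it only
  matters that 3 does not divide it.\<close>

lemma gauss_coeff_cross:
  "\<exists>j::nat. \<not> 3 dvd j \<and> gauss_coeff \<zeta> k 1 * cnj (gauss_coeff \<zeta> k (- 1)) = of_nat (4 * k) * (- ((- 1) ^ j * cis (pi * real j / 3)))"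
proof -
  obtain d1 where d1: "[3 * h * d1 = 1] (mod k)" using cong_solve_coprime_nat[OF coprime_3h_k] by auto
  define d0 where "d0 = d1 mod k"
  have d0: "[3 * h * d0 = 1] (mod k)" using d1 by (simp add: d0_def cong_def mod_mult_right_eq)
  have d0k: "d0 < k" using k_pos by (simp add: d0_def)
  \<comment> \<open>The quotient in 3 h d0 = k j + 1; a factor 3 in \<open>j\<close> would make 3
    divide 1.\<close>
  define j where "j = 3 * h * d0 div k"
  have k2: "k \<ge> 2" by (simp add: k_def)
  then have "3 * h * d0 mod k = 1" using d0 by (simp add: cong_def)
  then have j: "3 * h * d0 = k * j + 1" unfolding j_def by (metis mult_div_mod_eq)
  have j3: "\<not> 3 dvd j"
  proof
    assume "3 dvd j"
    then have "3 dvd k * j" by simp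
    moreover have "3 dvd k * j + 1" using j by (metis dvd_triv_left mult.assoc)
    ultimately show False by (metis dvd_add_right_iff nat_dvd_1_iff_1 numeral_One num.distinct(3) numeral_eq_iff)
  qed
  have odd_d0: "odd d0" using arg_cong[OF j, of even] even_k by auto
  have "(\<Sum>a<2 * k. gterm 1 (a + d) * cnj (gterm (- 1) a)) =
      gchar d * cis (- (pi * (3 * real d + 1) / (3 * real k))) * (if int k dvd int (3 * h * d) - 1 then of_nat (2 * k) else 0)" for d
  proof -
    have "gterm 1 (a + d) * cnj (gterm (- 1) a) = gchar d * cis (- (pi * (3 * real d + 1) / (3 * real k))) *
       cis (2 * pi * of_int (int (3 * h * d) - 1) * real a / real k)" for a
    proof -
      have A: "- (2 * pi * of_int 1 * ((6 * real (a + d) + 1) / (12 * real k))) + 2 * pi * of_int (- 1) * ((6 * real a + 1) / (12 * real k)) =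
        - (pi * (3 * real d + 1) / (3 * real k)) + - (2 * pi * real a / real k)" using k_pos by (simp add: field_simps)
      have Z: "\<zeta> ^ (3 * a * d) * cis (- (2 * pi * real a / real k)) = cis (2 * pi * of_int (int (3 * h * d) - 1) * real a / real k)"
        unfolding zeta_power cis_mult by (simp add: algebra_simps diff_divide_distrib)
      show ?thesis unfolding gterm_mult_cnj A cis_mult[symmetric] Z[symmetric] by (simp only: mult_ac)
    qed
    then have "(\<Sum>a<2 * k. gterm 1 (a + d) * cnj (gterm (- 1) a)) = gchar d * cis (- (pi * (3 * real d + 1) / (3 * real k))) *
       (\<Sum>a<2 * k. cis (2 * pi * of_int (int (3 * h * d) - 1) * real a / real k))"
      by (simp only: sum_distrib_left)
    also have "(\<Sum>a<2 * k. cis (2 * pi * of_int (int (3 * h * d) - 1) * real a / real k)) = (if int k dvd int (3 * h * d) - 1 then of_nat (2 * k) else 0)"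
      by (rule sum_cis_multiples) (use k_pos in auto)
    finally show ?thesis .
  qed
  then have "gauss_coeff \<zeta> k 1 * cnj (gauss_coeff \<zeta> k (- 1)) =
      (\<Sum>d<2 * k. gchar d * cis (- (pi * (3 * real d + 1) / (3 * real k))) * (if int k dvd int (3 * h * d) - 1 then of_nat (2 * k) else 0))"
    unfolding gauss_coeff_mult_cnj by simp
  also have "\<dots> = (\<Sum>d\<in>{d0, d0 + k}. gchar d * cis (- (pi * (3 * real d + 1) / (3 * real k))) * of_nat (2 * k))"
  proof (rule sum.mono_neutral_cong_right)
    have iff: "int k dvd int (3 * h * d) - 1 \<longleftrightarrow> d mod k = d0" for d
    proof -
      have "int k dvd int (3 * h * d) - 1 \<longleftrightarrow> [int (3 * h * d) = int 1] (mod int k)" by (simp add: cong_iff_dvd_diff)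
      also have "\<dots> \<longleftrightarrow> [3 * h * d = 1] (mod k)" by (rule cong_int_iff)
      also have "\<dots> \<longleftrightarrow> [3 * h * d = 3 * h * d0] (mod k)" using d0 cong_sym cong_trans by blast
      also have "\<dots> \<longleftrightarrow> [d = d0] (mod k)" using coprime_3h_k by (simp add: cong_mult_lcancel_nat coprime_commute)
      finally show ?thesis using d0k by (simp add: cong_def)
    qed
    show "\<forall>d\<in>{..<2 * k} - {d0, d0 + k}. gchar d * cis (- (pi * (3 * real d + 1) / (3 * real k))) * (if int k dvd int (3 * h * d) - 1 then of_nat (2 * k) else 0) = 0"
    proof
      fix d assume d: "d \<in> {..<2 * k} - {d0, d0 + k}"
      have "d mod k \<noteq> d0"
      proof (cases "d < k")
        case False
        moreover from this have "d - k < k" using d by auto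
        ultimately have "d mod k = d - k" by (simp add: le_mod_geq)
        then show ?thesis using d False by auto
      qed (use d in auto)
      then show "gchar d * cis (- (pi * (3 * real d + 1) / (3 * real k))) * (if int k dvd int (3 * h * d) - 1 then of_nat (2 * k) else 0) = 0"
        using iff by simp
    qed
    show "gchar d * cis (- (pi * (3 * real d + 1) / (3 * real k))) * (if int k dvd int (3 * h * d) - 1 then of_nat (2 * k) else 0) =
      gchar d * cis (- (pi * (3 * real d + 1) / (3 * real k))) * of_nat (2 * k)" if "d \<in> {d0, d0 + k}" for d
    proof -
      have "d mod k = d0" using that d0k by auto
      then show ?thesis using iff by simp
    qed
  qed (use d0k in auto)
  also have "\<dots> = of_nat (4 * k) * (gchar d0 * cis (- (pi * (3 * real d0 + 1) / (3 * real k))))"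
  proof -
    have "- (pi * (3 * real (d0 + k) + 1) / (3 * real k)) = - (pi * (3 * real d0 + 1) / (3 * real k)) + - pi"
      using k_pos by (simp add: field_simps)
    then have "cis (- (pi * (3 * real (d0 + k) + 1) / (3 * real k))) = - cis (- (pi * (3 * real d0 + 1) / (3 * real k)))"
      by (simp only: cis_mult[symmetric]) (simp add: complex_eq_iff)
    then show ?thesis using k_pos by (simp add: gchar_add_k)
  qed
  also have "gchar d0 * cis (- (pi * (3 * real d0 + 1) / (3 * real k))) = - ((- 1) ^ j * cis (pi * real j / 3))"
  proof -
    have rj: "3 * real h * real d0 = real k * real j + 1"
      using arg_cong[OF j, of real] by simp
    have "2 * real (pent (int d0)) = real d0 * (3 * real d0 + 1)" using arg_cong[OF pent_nat[of d0], of real] by (simp add: algebra_simps)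
    then have "2 * pi * real (h * pent (int d0)) / real k = pi * (real h * (real d0 * (3 * real d0 + 1))) / real k"
      by (simp add: mult_ac)
    \<comment> \<open>Writing the product as 3 h d0 (d0 + 1/3) brings in the defining relation of
      \<open>d0\<close>; the part without \<open>k\<close> cancels against the other phase.\<close>
    also have "real h * (real d0 * (3 * real d0 + 1)) = (real k * real j + 1) * (real d0 + 1 / 3)"
      using rj by algebra
    also have "pi * \<dots> / real k + - (pi * (3 * real d0 + 1) / (3 * real k)) = pi * real (j * d0) + pi * real j / 3"
      using k_pos by (simp add: field_simps)
    finally have "2 * pi * real (h * pent (int d0)) / real k + - (pi * (3 * real d0 + 1) / (3 * real k)) = pi * real (j * d0) + pi * real j / 3" .
    then have "\<zeta> ^ pent (int d0) * cis (- (pi * (3 * real d0 + 1) / (3 * real k))) = cis (pi * real (j * d0)) * cis (pi * real j / 3)"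
      unfolding zeta_power cis_mult by (simp only:)
    also have "cis (pi * real (j * d0)) = cis pi ^ (j * d0)" by (simp only: Complex.DeMoivre mult.commute)
    also have "\<dots> = (- 1) ^ j" using odd_d0 by (simp add: power_mult minus_one_power_iff)
    finally show ?thesis using odd_d0 by (simp add: gchar_def)
  qed
  finally show ?thesis using j3 by blast
qed

text \<open>Whatever \<open>j\<close> is, as long as 3 does not divide it, the phase of the cross
  term has real part 1/2; checking residues mod 6 suffices. The contributions are 4 k from each
  square and 4 k from the cross terms.\<close>

lemma theta_const_square:
  defines "D \<equiv> gauss_coeff \<zeta> k 1 + gauss_coeff \<zeta> k (- 1)"
  shows "D * cnj D = of_nat (12 * k)"
proof -
  let ?A = "gauss_coeff \<zeta> k 1" and ?B = "gauss_coeff \<zeta> k (- 1)"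
  obtain j :: nat where j: "\<not> 3 dvd j" "?A * cnj ?B = of_nat (4 * k) * (- ((- 1) ^ j * cis (pi * real j / 3)))"
    using gauss_coeff_cross by blast
  define w where "w = - ((- 1) ^ j * cis (pi * real j / 3))"
  have w: "w + cnj w = 1"
  proof -
    obtain u v where uv: "j = 6 * u + v" "v < 6" by (metis mod_less_divisor mult_div_mod_eq zero_less_numeral)
    have "cis (pi * real j / 3) = cis (2 * pi * of_int (int u)) * cis (pi * real v / 3)"
      unfolding cis_mult by (rule arg_cong[of _ _ cis]) (simp add: uv field_simps)
    also have "cis (2 * pi * of_int (int u)) = 1" by (simp only: cis_multiple_2pi Ints_of_int)
    finally have "cis (pi * real j / 3) = cis (pi * real v / 3)" by simp
    moreover have "(- 1) ^ j = ((- 1) ^ v :: complex)" by (simp add: uv power_add power_mult)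
    ultimately have "w = - ((- 1) ^ v * cis (pi * real v / 3))" by (simp add: w_def)
    moreover have "v \<in> {1, 2, 4, 5}"
    proof -
      have "v \<noteq> 0" "v \<noteq> 3" using j(1) uv(1) by presburger+
      then show ?thesis using uv(2) by auto
    qed
    moreover have "cos (pi * 4 / 3) = - (1 / 2)" "cos (pi * 5 / 3) = 1 / 2" "cos (pi * 2 / 3) = - (1 / 2)"
    proof -
      have "pi * 4 / 3 = pi / 3 + pi" "pi * 5 / 3 = 2 * pi - pi / 3" "pi * 2 / 3 = pi - pi / 3" by simp_all
      then show "cos (pi * 4 / 3) = - (1 / 2)" "cos (pi * 5 / 3) = 1 / 2" "cos (pi * 2 / 3) = - (1 / 2)"
        by (simp_all only: cos_periodic_pi cos_2pi_minus cos_pi_minus cos_60)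
    qed
    ultimately show ?thesis by (auto simp: complex_eq_iff cos_60)
  qed
  have "D * cnj D = ?A * cnj ?A + ?B * cnj ?B + (?A * cnj ?B + cnj (?A * cnj ?B))"
    by (simp add: D_def algebra_simps)
  also have "\<dots> = of_nat (4 * k) + of_nat (4 * k) + of_nat (4 * k) * (w + cnj w)"
    unfolding j(2) w_def[symmetric] using norm_gauss_coeff_square[of 1] norm_gauss_coeff_square[of "- 1"]
    by (simp add: algebra_simps)
  finally show ?thesis unfolding w by simp
qed

end

section \<open>Non-vanishing of the twisted sum over primitive roots\<close>

lemma sum_lessThan_double: "(\<Sum>a<2 * k. F a) = (\<Sum>a<k. F a + F (a + k))"
  for F :: "nat \<Rightarrow> 'a :: comm_monoid_add"
proof -
  have "(\<Sum>a<k + n. F a) = (\<Sum>a<k. F a) + (\<Sum>a<n. F (a + k))" for n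
    by (induction n) (simp_all add: ac_simps)
  then show ?thesis by (simp add: mult_2 sum.distrib)
qed

lemma sum_even_odd: "(\<Sum>a<2 * n. F a) = (\<Sum>x<n. F (2 * x)) + (\<Sum>x<n. F (2 * x + 1))"
  for F :: "nat \<Rightarrow> 'a :: comm_monoid_add"
  by (induction n) (simp_all add: ac_simps)

lemma unique_root_mod:
  fixes f :: "nat \<Rightarrow> nat"
  assumes "N > 0" and inj: "\<And>x y. int N dvd int (f x) - int (f y) \<Longrightarrow> int N dvd int x - int y"
  shows "\<exists>x<N. N dvd f x \<and> (\<forall>y<N. N dvd f y \<longrightarrow> y = x)"
proof -
  let ?g = "\<lambda>x. f x mod N"
  have *: "x = y" if "x < N" "y < N" "?g x = ?g y" for x y
  proof -
    have "int N dvd int (f x) - int (f y)"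
      using that(3) by (metis mod_eq_dvd_iff zmod_int)
    then have "int N dvd int x - int y" by (rule inj)
    then have "int x mod int N = int y mod int N" by (simp add: mod_eq_dvd_iff)
    then have "int (x mod N) = int (y mod N)" by (simp only: zmod_int)
    then show "x = y" using that by simp
  qed
  have "inj_on ?g {..<N}"
  proof (rule inj_onI)
    fix x y assume "x \<in> {..<N}" "y \<in> {..<N}" "?g x = ?g y"
    then show "x = y" by - (rule *, simp_all only: lessThan_iff)
  qed
  moreover have "?g ` {..<N} \<subseteq> {..<N}" using assms(1) by auto
  ultimately have "?g ` {..<N} = {..<N}" by (intro endo_inj_surj) auto
  then have "0 \<in> ?g ` {..<N}" using assms(1) by simp
  then obtain x where "0 = ?g x" "x \<in> {..<N}" by (rule imageE)
  then have x: "x < N" "?g x = 0" by simp_all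
  have "y = x" if y: "y < N" "N dvd f y" for y
  proof (rule *[OF y(1) x(1)])
    show "?g y = ?g x" using y(2) unfolding x(2) by (rule dvd_imp_mod_0)
  qed
  moreover have "N dvd f x" using x(2) by (rule mod_0_imp_dvd)
  ultimately show ?thesis using x(1) by metis
qed

text \<open>On even arguments \<open>pent\<close> is x (6 x + 1), and the difference of two values
  is x - y times an odd number. So it permutes the residues mod \<open>2 ^ s\<close>, and the value
  \<open>- n\<close> is taken exactly once; the odd arguments behave likewise.\<close>

lemma pent_root_even:
  "\<exists>x<2 ^ s. 2 ^ s dvd n + pent (int (2 * x)) \<and> (\<forall>y<2 ^ s. 2 ^ s dvd n + pent (int (2 * y)) \<longrightarrow> y = x)"
proof (rule unique_root_mod)
  fix x y :: nat
  have p: "int (pent (int (2 * x))) = int x * (6 * int x + 1)" for x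
    using pent_eq[of "int (2 * x)"] by (simp add: algebra_simps)
  assume "int (2 ^ s) dvd int (n + pent (int (2 * x))) - int (n + pent (int (2 * y)))"
  moreover have "int (n + pent (int (2 * x))) - int (n + pent (int (2 * y))) = (int x - int y) * (6 * (int x + int y) + 1)"
    unfolding of_nat_add p by (simp add: algebra_simps)
  ultimately have "2 ^ s dvd (int x - int y) * (6 * (int x + int y) + 1)" by simp
  moreover have "coprime (2 ^ s) (6 * (int x + int y) + 1)" by (simp add: coprime_power_left_iff)
  ultimately show "int (2 ^ s) dvd int x - int y" by (simp add: coprime_dvd_mult_left_iff)
qed simp

lemma pent_root_odd:
  "\<exists>x<2 ^ s. 2 ^ s dvd n + pent (int (2 * x + 1)) \<and> (\<forall>y<2 ^ s. 2 ^ s dvd n + pent (int (2 * y + 1)) \<longrightarrow> y = x)"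
proof (rule unique_root_mod)
  fix x y :: nat
  have p: "int (pent (int (2 * x + 1))) = (2 * int x + 1) * (3 * int x + 2)" for x
    using pent_eq[of "int (2 * x + 1)"] by (simp add: algebra_simps)
  assume "int (2 ^ s) dvd int (n + pent (int (2 * x + 1))) - int (n + pent (int (2 * y + 1)))"
  moreover have "int (n + pent (int (2 * x + 1))) - int (n + pent (int (2 * y + 1))) = (int x - int y) * (6 * (int x + int y) + 7)"
    unfolding of_nat_add[of n] p by (simp add: algebra_simps)
  ultimately have "2 ^ s dvd (int x - int y) * (6 * (int x + int y) + 7)" by simp
  moreover have "coprime (2 ^ s) (6 * (int x + int y) + 7)" by (simp add: coprime_power_left_iff)
  ultimately show "int (2 ^ s) dvd int x - int y" by (simp add: coprime_dvd_mult_left_iff)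
qed simp

lemma cos_add_pi_mult_int: "cos (x + pi * of_int c) = (if even c then cos x else - cos x)"
proof -
  have "cos (x + pi * of_int c) = cos x * cos (pi * of_int c) - sin x * sin (pi * of_int c)" by (rule cos_add)
  then show ?thesis by (simp add: cos_int_times_real mult.commute sin_int_times_real)
qed

text \<open>Divisibility links the two angles: 3 (a + b) + 1 = k c for an integer c, so they add up
  to pi c / 3, and the parity of c is that of z - y. A cancellation would thus equate two cosines,
  and both ways of doing so contradict arithmetic.\<close>

lemma cos_sum_nonzero:
  fixes a b n y z :: nat
  assumes "even b" "odd a" and y: "n + pent (int b) = 2 ^ s * y" and z: "n + pent (int a) = 2 ^ s * z"
  defines "k \<equiv> 2 ^ (s + 1) :: nat"
  shows "(- 1) ^ b * cos (pi * (6 * real b + 1) / (6 * real k)) * (- 1) ^ y +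
    (- 1) ^ a * cos (pi * (6 * real a + 1) / (6 * real k)) * (- 1) ^ z \<noteq> (0 :: real)"
proof
  have k: "k > 0" "even k" by (simp_all add: k_def)
  let ?\<theta> = "pi * (6 * real b + 1) / (6 * real k)"
  have "2 * (int (2 ^ s * z) - int (2 ^ s * y)) = 2 * int (pent (int a)) - 2 * int (pent (int b))"
    unfolding y[symmetric] z[symmetric] by simp
  also have "\<dots> = (int a - int b) * (3 * (int a + int b) + 1)" unfolding pent_eq by (simp add: algebra_simps)
  finally have e: "int k * (int z - int y) = (int a - int b) * (3 * (int a + int b) + 1)"
    by (simp add: k_def algebra_simps)
  have "coprime (int k) (int a - int b)" using assms(1,2) by (simp add: k_def coprime_power_left_iff)
  moreover have "int k dvd (int a - int b) * (3 * (int a + int b) + 1)" using e by (metis dvd_triv_left)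
  ultimately have "int k dvd 3 * (int a + int b) + 1" by (simp add: coprime_dvd_mult_right_iff)
  then obtain c where c: "3 * (int a + int b) + 1 = int k * c" by auto
  have "int k * (int z - int y) = int k * ((int a - int b) * c)" using e c by (simp add: mult.left_commute)
  then have zy: "int z - int y = (int a - int b) * c" using k by simp
  then have par: "even c \<longleftrightarrow> even (int z - int y)" using assms(1,2) by simp
  have c3: "\<not> 3 dvd c"
  proof
    assume "3 dvd c"
    then obtain i where "c = 3 * i" by auto
    then have "3 * (int a + int b) + 1 = 3 * (int k * i)" using c by simp
    then show False by presburger
  qed
  have "real_of_int (3 * (int a + int b) + 1) = of_int (int k * c)" using c by simp
  then have rc: "3 * (real a + real b) + 1 = real k * of_int c" by simp
  define X where "X = (6 * real b + 1) / (6 * real k)"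
  have \<theta>: "?\<theta> = pi * X" by (simp add: X_def)
  have \<theta>a: "pi * (6 * real a + 1) / (6 * real k) = pi * of_int c / 3 - ?\<theta>"
  proof -
    have e: "6 * real a + 1 = 2 * (real k * of_int c) - (6 * real b + 1)" unfolding rc[symmetric] by simp
    show ?thesis unfolding e using k by (simp add: field_simps)
  qed
  assume "(- 1) ^ b * cos ?\<theta> * (- 1) ^ y +
    (- 1) ^ a * cos (pi * (6 * real a + 1) / (6 * real k)) * (- 1) ^ z = 0"
  then have "cos ?\<theta> * (- 1) ^ y = cos (pi * of_int c / 3 - ?\<theta>) * (- 1) ^ z"
    unfolding \<theta>a using assms(1,2) by simp
  then have "cos ?\<theta> = (if even c then cos (pi * of_int c / 3 - ?\<theta>) else - cos (pi * of_int c / 3 - ?\<theta>))"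
    unfolding par by (cases "even y"; cases "even z") auto
  also have "\<dots> = cos (pi * of_int c / 3 - ?\<theta> + pi * of_int c)" by (rule cos_add_pi_mult_int[symmetric])
  finally have "cos ?\<theta> = cos (pi * of_int c / 3 - ?\<theta> + pi * of_int c)" .
  then obtain m where m: "m \<in> \<int>" "?\<theta> = pi * of_int c / 3 - ?\<theta> + pi * of_int c + 2 * m * pi \<or>
      ?\<theta> = - (pi * of_int c / 3 - ?\<theta> + pi * of_int c) + 2 * m * pi" unfolding cos_eq by blast
  then obtain i :: int where i: "m = of_int i" by (auto elim: Ints_cases)
  \<comment> \<open>Equal angles would make the odd number 6 b + 1 a multiple of the even
    \<open>k\<close>; opposite angles would make 3 divide \<open>c\<close>.\<close>
  from m(2) show False
  proof
    assume "?\<theta> = pi * of_int c / 3 - ?\<theta> + pi * of_int c + 2 * m * pi"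
    then have "pi * (2 * X) = pi * (4 * of_int c / 3 + 2 * m)"
      unfolding \<theta> by (simp add: algebra_simps)
    then have "2 * X = 4 * of_int c / 3 + 2 * m" unfolding mult_cancel_left by simp
    then have "6 * real b + 1 = real k * (4 * of_int c + 6 * m)" using k by (simp add: X_def field_simps)
    then have "real_of_int (6 * int b + 1) = of_int (int k * (4 * c + 6 * i))" by (simp add: i)
    then have "6 * int b + 1 = int k * (4 * c + 6 * i)" by linarith
    then have "odd (int k * (4 * c + 6 * i))" by (metis even_add even_mult_iff odd_numeral odd_one even_numeral)
    then show False using k by simp
  next
    assume "?\<theta> = - (pi * of_int c / 3 - ?\<theta> + pi * of_int c) + 2 * m * pi"
    then have "pi * (4 * of_int c) = pi * (6 * m)" unfolding \<theta> by (simp add: algebra_simps)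
    then have "4 * of_int c = 6 * m" unfolding mult_cancel_left by simp
    then have "real_of_int (4 * c) = of_int (6 * i)" by (simp add: i)
    then have "4 * c = 6 * i" by linarith
    then have "3 dvd c" by presburger
    then show False using c3 by simp
  qed
qed

definition zeta :: "nat \<Rightarrow> nat \<Rightarrow> complex" where
  "zeta k h = cis (2 * pi * real h / real k)"

definition theta_const :: "nat \<Rightarrow> nat \<Rightarrow> complex" where
  "theta_const k h = gauss_coeff (zeta k h) k 1 + gauss_coeff (zeta k h) k (- 1)"

lemma theta_const_eq:
  "theta_const k h = (\<Sum>a<2 * k. of_real (2 * ((- 1) ^ a * cos (pi * (6 * real a + 1) / (6 * real k)))) * zeta k h ^ pent (int a))"
  unfolding theta_const_def gauss_coeff_def sum.distrib[symmetric]
proof (rule sum.cong)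
  fix a
  let ?x = "pi * (6 * real a + 1) / (6 * real k)"
  have "2 * pi * ((6 * real a + 1) / (12 * real k)) = ?x" by simp
  then have "cis (- (2 * pi * of_int 1 * ((6 * real a + 1) / (12 * real k)))) + cis (- (2 * pi * of_int (- 1) * ((6 * real a + 1) / (12 * real k)))) = of_real (2 * cos ?x)"
    by (simp add: complex_eq_iff)
  moreover have "u * z * c + u * z * c' = u * z * (c + c')" for u z c c' :: complex by (simp add: algebra_simps)
  ultimately show "(- 1) ^ a * zeta k h ^ pent (int a) * cis (- (2 * pi * of_int 1 * ((6 * real a + 1) / (12 * real k)))) +
        (- 1) ^ a * zeta k h ^ pent (int a) * cis (- (2 * pi * of_int (- 1) * ((6 * real a + 1) / (12 * real k)))) =
      of_real (2 * ((- 1) ^ a * cos ?x)) * zeta k h ^ pent (int a)"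
    by (simp only:) simp
qed simp

lemma cnj_theta_const:
  "cnj (theta_const k h) = (\<Sum>a<2 * k. of_real (2 * ((- 1) ^ a * cos (pi * (6 * real a + 1) / (6 * real k)))) *
      cis (- (2 * pi * real (h * pent (int a)) / real k)))"
  unfolding theta_const_eq cnj_sum complex_cnj_mult complex_cnj_complex_of_real complex_cnj_power
  by (intro sum.cong) (simp_all add: zeta_def cis_cnj Complex.DeMoivre mult_ac)

text \<open>The odd numbers \<open>2 * u + 1\<close> below \<open>k\<close> index the primitive
  \<open>k\<close>-th roots of unity. Splitting off the factor for \<open>u = 0\<close> leaves a
  geometric sum of order \<open>2 ^ s\<close>.\<close>

lemma ramanujan_sum:
  fixes s x :: nat
  defines "k \<equiv> 2 ^ (s + 1) :: nat"
  shows "(\<Sum>u<2 ^ s. cis (- (2 * pi * real ((2 * u + 1) * x) / real k))) =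
    of_real (2 ^ s * (if 2 ^ s dvd x then (- 1) ^ (x div 2 ^ s) else 0))"
proof -
  have "(\<Sum>u<2 ^ s. cis (- (2 * pi * real ((2 * u + 1) * x) / real k))) =
    cis (- (2 * pi * real x / real k)) * (\<Sum>u<1 * 2 ^ s. cis (2 * pi * of_int (- int x) * real u / real (2 ^ s)))"
    unfolding sum_distrib_left cis_mult
    by (intro sum.cong arg_cong[of _ _ cis]) (simp_all add: k_def field_simps)
  also have "(\<Sum>u<1 * 2 ^ s. cis (2 * pi * of_int (- int x) * real u / real (2 ^ s))) =
     (if int (2 ^ s) dvd - int x then of_nat (1 * 2 ^ s) else 0)"
    by (rule sum_cis_multiples) auto
  also have "int (2 ^ s) dvd - int x \<longleftrightarrow> 2 ^ s dvd x" by (simp only: dvd_minus_iff int_dvd_int_iff)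
  finally have 1: "(\<Sum>u<2 ^ s. cis (- (2 * pi * real ((2 * u + 1) * x) / real k))) =
     cis (- (2 * pi * real x / real k)) * (if 2 ^ s dvd x then of_nat (1 * 2 ^ s) else 0)" .
  show ?thesis
  proof (cases "2 ^ s dvd x")
    case True
    then obtain y where y: "x = 2 ^ s * y" by auto
    have "- (2 * pi * real x / real k) = real y * (- pi)" by (simp add: y k_def)
    then have "cis (- (2 * pi * real x / real k)) = cis (- pi) ^ y" by (simp only: Complex.DeMoivre)
    also have "cis (- pi) = - 1" by (simp add: complex_eq_iff)
    finally show ?thesis unfolding 1 using True by (simp add: y)
  next
    case False
    then show ?thesis unfolding 1 by simp
  qed
qed

text \<open>Since the squared modulus of \<open>theta_const\<close> is the same for all these roots,
  division is multiplication by the conjugate up to a constant. The conjugates expand into Ramanujan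
  sums, which leave one even and one odd index \<open>a\<close> below \<open>k\<close>.\<close>

theorem twisted_sum_nonzero:
  fixes s n :: nat
  defines "k \<equiv> 2 ^ (s + 1) :: nat"
  shows "(\<Sum>u<2 ^ s. cis (- (2 * pi * real ((2 * u + 1) * n) / real k)) / theta_const k (2 * u + 1)) \<noteq> 0"
proof -
  have k: "k > 0" by (simp add: k_def)
  define C where "C a = (- 1) ^ a * cos (pi * (6 * real a + 1) / (6 * real k))" for a
  define R where "R a = (if 2 ^ s dvd n + pent (int a) then (- 1) ^ ((n + pent (int a)) div 2 ^ s) else (0 :: real))" for a
  define T where "T a = C a * R a" for a
  have sq: "theta_const k (2 * u + 1) * cnj (theta_const k (2 * u + 1)) = of_nat (12 * k)" for u
    unfolding theta_const_def by (rule theta_const_square[of k s "2 * u + 1"]) (simp_all add: k_def zeta_def)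
  have inv: "z / theta_const k (2 * u + 1) = z * cnj (theta_const k (2 * u + 1)) / of_nat (12 * k)" for z u
  proof -
    have "theta_const k (2 * u + 1) \<noteq> 0" using sq[of u] k by auto
    then show ?thesis using sq[of u] k by (simp add: divide_simps) (metis mult.commute mult.left_commute)
  qed
  have "(\<Sum>u<2 ^ s. cis (- (2 * pi * real ((2 * u + 1) * n) / real k)) * cnj (theta_const k (2 * u + 1))) =
      (\<Sum>u<2 ^ s. \<Sum>a<2 * k. of_real (2 * C a) * cis (- (2 * pi * real ((2 * u + 1) * (n + pent (int a))) / real k)))"
    unfolding cnj_theta_const sum_distrib_left
  proof (intro sum.cong refl)
    fix u a
    have E: "cis (- (2 * pi * real ((2 * u + 1) * n) / real k)) * cis (- (2 * pi * real ((2 * u + 1) * pent (int a)) / real k)) =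
       cis (- (2 * pi * real ((2 * u + 1) * (n + pent (int a))) / real k))"
    proof -
      have "- (2 * pi * real (h * p) / c) + - (2 * pi * real (h * q) / c) = - (2 * pi * real (h * (p + q)) / c)"
        for h p q :: nat and c
        by (simp add: distrib_left add_divide_distrib)
      then show ?thesis unfolding cis_mult by (rule arg_cong[of _ _ cis])
    qed
    show "cis (- (2 * pi * real ((2 * u + 1) * n) / real k)) * (of_real (2 * ((- 1) ^ a * cos (pi * (6 * real a + 1) / (6 * real k)))) *
          cis (- (2 * pi * real ((2 * u + 1) * pent (int a)) / real k))) =
        of_real (2 * C a) * cis (- (2 * pi * real ((2 * u + 1) * (n + pent (int a))) / real k))"
      unfolding C_def[symmetric] E[symmetric] by (rule mult.left_commute)
  qed
  also have "\<dots> = (\<Sum>a<2 * k. of_real (2 * C a) * (\<Sum>u<2 ^ s. cis (- (2 * pi * real ((2 * u + 1) * (n + pent (int a))) / real k))))"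
    unfolding sum_distrib_left by (rule sum.swap)
  also have "\<dots> = of_real (2 * 2 ^ s * (\<Sum>a<2 * k. T a))"
    unfolding ramanujan_sum[where s = s, folded k_def] R_def[symmetric] T_def
    by (simp add: sum_distrib_left mult_ac)
  \<comment> \<open>Both factors of \<open>T\<close> change sign under a shift by \<open>k\<close>:
    the cosine by half a turn, \<open>R\<close> because the exponent moves by an odd number.\<close>
  also have "(\<Sum>a<2 * k. T a) = 2 * (\<Sum>a<k. T a)"
  proof -
    have "T (a + k) = T a" for a
    proof -
      have "2 * pent (int k) = 2 * (2 ^ s * (3 * k + 1))" unfolding pent_nat by (simp add: k_def)
      then have pk: "n + pent (int (a + k)) = n + pent (int a) + 2 ^ s * (3 * k + 1 + 6 * a)"
        unfolding pent_add by (simp add: k_def algebra_simps)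
      have "R (a + k) = - R a"
      proof (cases "2 ^ s dvd n + pent (int a)")
        case True
        then obtain y where y: "n + pent (int a) = 2 ^ s * y" by auto
        have "even k" by (simp add: k_def)
        moreover have "n + pent (int (a + k)) = 2 ^ s * (y + (3 * k + 1 + 6 * a))" unfolding pk y by (simp add: algebra_simps)
        ultimately show ?thesis using y unfolding R_def by (simp add: minus_one_power_iff)
      next
        case False
        then have "\<not> 2 ^ s dvd n + pent (int (a + k))"
          unfolding pk by (metis dvd_add_left_iff dvd_triv_left)
        then show ?thesis using False by (simp add: R_def)
      qed
      moreover have "C (a + k) = - C a"
      proof -
        have "pi * (6 * real (a + k) + 1) / (6 * real k) = pi * (6 * real a + 1) / (6 * real k) + pi"
          using k by (simp add: field_simps)
        then have "cos (pi * (6 * real (a + k) + 1) / (6 * real k)) = - cos (pi * (6 * real a + 1) / (6 * real k))"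
          by (simp only: cos_periodic_pi)
        moreover have "even k" by (simp add: k_def)
        ultimately show ?thesis by (simp add: C_def power_add)
      qed
      ultimately show ?thesis by (simp add: T_def)
    qed
    then show ?thesis unfolding sum_lessThan_double by (simp add: sum_distrib_left)
  qed
  also have "(\<Sum>a<k. T a) = (\<Sum>x<2 ^ s. T (2 * x)) + (\<Sum>x<2 ^ s. T (2 * x + 1))"
    using sum_even_odd[of T "2 ^ s"] by (simp add: k_def)
  finally have main: "(\<Sum>u<2 ^ s. cis (- (2 * pi * real ((2 * u + 1) * n) / real k)) * cnj (theta_const k (2 * u + 1))) =
      of_real (2 * 2 ^ s * (2 * ((\<Sum>x<2 ^ s. T (2 * x)) + (\<Sum>x<2 ^ s. T (2 * x + 1)))))" .
  obtain x where x: "x < 2 ^ s" "2 ^ s dvd n + pent (int (2 * x))" "\<forall>y<2 ^ s. 2 ^ s dvd n + pent (int (2 * y)) \<longrightarrow> y = x"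
    using pent_root_even by blast
  obtain x' where x': "x' < 2 ^ s" "2 ^ s dvd n + pent (int (2 * x' + 1))" "\<forall>y<2 ^ s. 2 ^ s dvd n + pent (int (2 * y + 1)) \<longrightarrow> y = x'"
    using pent_root_odd by blast
  have "(\<Sum>x<2 ^ s. T (2 * x)) = (\<Sum>y\<in>{x}. T (2 * y))"
  proof (intro sum.mono_neutral_right ballI)
    fix y assume "y \<in> {..<2 ^ s} - {x}"
    then have "\<not> 2 ^ s dvd n + pent (int (2 * y))" using x(3) by blast
    then show "T (2 * y) = 0" by (simp only: T_def R_def if_False mult_zero_right)
  qed (use x(1) in simp_all)
  moreover have "(\<Sum>x<2 ^ s. T (2 * x + 1)) = (\<Sum>y\<in>{x'}. T (2 * y + 1))"
  proof (intro sum.mono_neutral_right ballI)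
    fix y assume "y \<in> {..<2 ^ s} - {x'}"
    then have "\<not> 2 ^ s dvd n + pent (int (2 * y + 1))" using x'(3) by blast
    then show "T (2 * y + 1) = 0" by (simp only: T_def R_def if_False mult_zero_right)
  qed (use x'(1) in simp_all)
  moreover have "T (2 * x) + T (2 * x' + 1) \<noteq> 0"
  proof -
    obtain y z where yz: "n + pent (int (2 * x)) = 2 ^ s * y" "n + pent (int (2 * x' + 1)) = 2 ^ s * z"
      using x(2) x'(2) by (elim dvdE)
    have "R (2 * x) = (- 1) ^ y" "R (2 * x' + 1) = (- 1) ^ z"
      unfolding R_def yz by simp_all
    then show ?thesis unfolding T_def C_def k_def
      using cos_sum_nonzero[of "2 * x" "2 * x' + 1", OF _ _ yz] by simp
  qed
  ultimately have "(\<Sum>u<2 ^ s. cis (- (2 * pi * real ((2 * u + 1) * n) / real k)) * cnj (theta_const k (2 * u + 1))) \<noteq> 0"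
    unfolding main of_real_eq_0_iff by simp
  then show ?thesis unfolding inv sum_divide_distrib[symmetric] using k by simp
qed

lemma theta_const_nonzero:
  assumes "odd h" shows "theta_const (2 ^ (s + 1)) h \<noteq> 0"
proof
  assume *: "theta_const (2 ^ (s + 1)) h = 0"
  have "theta_const (2 ^ (s + 1)) h * cnj (theta_const (2 ^ (s + 1)) h) = of_nat (12 * 2 ^ (s + 1))"
    unfolding theta_const_def by (rule theta_const_square[OF refl assms]) (simp add: zeta_def)
  then show False using * by simp
qed

text \<open>The point 1, needed for the factor \<open>euler_fun (q ^ t)\<close> on a dominant arc,
  has order 1 and lies outside the family \<open>2 ^ (s + 1)\<close>; its two terms are evaluated by
  hand.\<close>

lemma theta_const_one: "theta_const 1 0 \<noteq> 0" "gauss_coeff 1 1 0 = 0"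
proof -
  have "pi * 7 / 6 = pi + pi / 6" by simp
  then have "cos (pi * 7 / 6) = - cos (pi / 6)" by (simp only: cos_periodic_pi2)
  then have "theta_const 1 0 = of_real (4 * cos (pi / 6))"
    unfolding theta_const_eq by (simp add: zeta_def numeral_2_eq_2)
  moreover have "cos (pi / 6) > 0" by (simp add: cos_30)
  ultimately show "theta_const 1 0 \<noteq> 0" by simp
  show "gauss_coeff 1 1 0 = 0" by (simp add: gauss_coeff_def numeral_2_eq_2)
qed

section \<open>Minor arcs\<close>

text \<open>Limit of \<open>z\<close> times the Lambert series of the logarithm of Euler's function at \<open>\<xi> * exp (- z)\<close>.\<close>

definition root_sum :: "complex \<Rightarrow> real" where
  "root_sum \<xi> = (\<Sum>j. if \<xi> ^ Suc j = 1 then 1 / (real (Suc j))\<^sup>2 else 0)"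

lemma sums_inverse_squares: "(\<lambda>j. 1 / (real (Suc j))\<^sup>2) sums (pi\<^sup>2 / 6)"
  using inverse_squares_sums by (simp add: add.commute)

lemma summable_inverse_squares: "summable (\<lambda>j. 1 / (real (Suc j))\<^sup>2)"
  by (rule sums_summable[OF sums_inverse_squares])

lemma summable_if_inverse_squares: "summable (\<lambda>j. if P j then 1 / (real (Suc j))\<^sup>2 else 0)"
  by (rule summable_comparison_test'[OF summable_inverse_squares, of 0]) auto

lemma tendsto_div_exp_minus_one: "((\<lambda>z::complex. z / (exp z - 1)) \<longlongrightarrow> 1) (at 0)"
proof -
  have "((\<lambda>z::complex. (exp z - exp 0) / (z - 0)) \<longlongrightarrow> exp 0) (at 0)"
    using DERIV_exp[of "0::complex"] by (simp only: has_field_derivative_iff)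
  then have "((\<lambda>z::complex. (exp z - 1) / z) \<longlongrightarrow> 1) (at 0)" by simp
  from tendsto_inverse[OF this] show ?thesis by (simp add: inverse_eq_divide)
qed

text \<open>Only the terms with \<open>\<xi> ^ Suc j = 1\<close> have a pole at w = 0, and they tend
  to u / (m (j + 1)^2). Recording the direction of approach in \<open>u\<close> covers tangential
  approach to the circle, where \<open>u = 0\<close>.\<close>

lemma lambert_scaled_limit:
  fixes w :: "nat \<Rightarrow> complex" and m :: nat
  assumes w0: "w \<longlonglongrightarrow> 0" and wpos: "\<And>n. Re (w n) > 0" and u: "(\<lambda>n. of_real (Re (w n)) / w n) \<longlonglongrightarrow> u"
    and m: "m > 0" and \<xi>: "norm \<xi> = 1"
  shows "(\<lambda>n. of_real (Re (w n)) * (\<Sum>j. lambert_term (\<xi> * exp (- (of_nat m * w n))) j)) \<longlonglongrightarrow> u / of_nat m * of_real (root_sum \<xi>)"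
proof -
  let ?q = "\<lambda>n. \<xi> * exp (- (of_nat m * w n))"
  have wnz: "w n \<noteq> 0" for n using wpos[of n] by auto
  have q: "norm (?q n) = exp (- (real m * Re (w n)))" for n by (simp add: norm_mult \<xi>)
  have q1: "norm (?q n) < 1" for n using wpos m by (simp add: q)
  have pw: "?q n ^ Suc j = \<xi> ^ Suc j * exp (- (of_nat (Suc j * m) * w n))" for n j
  proof -
    have "of_nat (Suc j) * - (of_nat m * w n) = - (of_nat (Suc j * m) * w n)"
      by (simp only: of_nat_mult mult_minus_right mult.assoc)
    then show ?thesis by (simp only: power_mult_distrib exp_of_nat_mult[symmetric])
  qed
  have lim: "(\<lambda>n. of_real (Re (w n)) * lambert_term (?q n) j) \<longlonglongrightarrow>
      u / of_nat m * of_real (if \<xi> ^ Suc j = 1 then 1 / (real (Suc j))\<^sup>2 else 0)" for j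
  proof (cases "\<xi> ^ Suc j = 1")
    case True
    define J where "J = complex_of_nat (Suc j)"
    define N where "N = complex_of_nat (Suc j * m)"
    define v where "v = (\<lambda>n. N * w n)"
    have Nz: "J \<noteq> 0" "N \<noteq> 0" "complex_of_nat m \<noteq> 0"
      unfolding J_def N_def of_nat_eq_0_iff using m by simp_all
    have vnz: "v n \<noteq> 0" for n unfolding v_def using wnz Nz by simp
    have v0: "v \<longlonglongrightarrow> 0" unfolding v_def using tendsto_mult_right_zero[OF w0] by blast
    then have "filterlim v (at 0) sequentially"
      unfolding filterlim_at using vnz by auto
    then have l: "(\<lambda>n. v n / (exp (v n) - 1)) \<longlonglongrightarrow> 1" by (rule filterlim_compose[OF tendsto_div_exp_minus_one])
    have e1: "exp (v n) \<noteq> 1" for n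
    proof
      assume "exp (v n) = 1"
      then have "exp (Re (v n)) = 1" by (metis norm_exp_eq_Re norm_one)
      then have "Re (v n) = 0" by simp
      moreover have "Re (of_nat p * z) = real p * Re z" for p z by simp
      then have "Re (v n) = real (Suc j * m) * Re (w n)" unfolding v_def N_def by blast
      moreover have "real (Suc j * m) > 0" unfolding of_nat_0_less_iff using m by simp
      ultimately show False using wpos[of n] by simp
    qed
    have eq: "of_real (Re (w n)) / w n * (v n / (exp (v n) - 1)) * (1 / J * (1 / N)) = of_real (Re (w n)) * lambert_term (?q n) j" for n
    proof -
      have e: "?q n ^ Suc j = 1 / exp (v n)"
        unfolding pw True v_def N_def by (simp only: mult_1 exp_minus inverse_eq_divide)
      have "lambert_term (?q n) j = 1 / (J * (exp (v n) - 1))"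
        unfolding lambert_term_def e J_def[symmetric] using e1[of n] Nz by (simp add: divide_simps)
      moreover have "y / x * ((N * x) / d) * (1 / J * (1 / N)) = y * (1 / (J * d))" if "x \<noteq> 0" for x y d
        using that Nz by simp
      ultimately show ?thesis using wnz[of n] unfolding v_def by simp
    qed
    have "(\<lambda>n. of_real (Re (w n)) / w n * (v n / (exp (v n) - 1)) * (1 / J * (1 / N))) \<longlonglongrightarrow> u * 1 * (1 / J * (1 / N))"
      by (intro tendsto_mult u l tendsto_const)
    moreover have "u * 1 * (1 / J * (1 / N)) = u / of_nat m * of_real (1 / (real (Suc j))\<^sup>2)"
    proof -
      have "complex_of_real (1 / (real (Suc j))\<^sup>2) = 1 / J\<^sup>2" by (simp add: J_def)
      moreover have "N = J * of_nat m" by (simp only: N_def J_def of_nat_mult)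
      ultimately show ?thesis by (simp add: power2_eq_square)
    qed
    ultimately show ?thesis unfolding eq using True by (simp only: if_True simp_thms)
  next
    case False
    have d: "(\<lambda>n. exp (- (of_nat (Suc j * m) * w n))) \<longlonglongrightarrow> exp (- (of_nat (Suc j * m) * 0))"
      by (intro tendsto_intros w0)
    then have d': "(\<lambda>n. ?q n ^ Suc j) \<longlonglongrightarrow> \<xi> ^ Suc j * 1"
      unfolding pw by (intro tendsto_mult tendsto_const) simp
    have "(\<lambda>n. lambert_term (?q n) j) \<longlonglongrightarrow> (\<xi> ^ Suc j * 1) / (of_nat (Suc j) * (1 - \<xi> ^ Suc j * 1))"
      unfolding lambert_term_def using False of_nat_neq_0 by (intro tendsto_divide tendsto_mult tendsto_diff tendsto_const d') auto
    moreover have "(\<lambda>n. complex_of_real (Re (w n))) \<longlonglongrightarrow> of_real (Re 0)" by (intro tendsto_of_real tendsto_Re w0)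
    ultimately have "(\<lambda>n. of_real (Re (w n)) * lambert_term (?q n) j) \<longlonglongrightarrow> of_real (Re 0) * ((\<xi> ^ Suc j * 1) / (of_nat (Suc j) * (1 - \<xi> ^ Suc j * 1)))"
      by (intro tendsto_mult)
    then show ?thesis using False by simp
  qed
  \<comment> \<open>The bound is uniform in the direction because only the real part enters: exp
    (-a) a <= 1 - exp (-a), with a = (j + 1) m Re w.\<close>
  have bound: "norm (of_real (Re (w n)) * lambert_term (?q n) j) \<le> 1 / (real (Suc j))\<^sup>2" for n j
  proof -
    let ?a = "real (Suc j) * (real m * Re (w n))"
    have a: "?a > 0" using wpos m by simp
    have nq: "norm (?q n ^ Suc j) = exp (- ?a)"
      by (simp only: norm_power q exp_of_nat_mult[symmetric]) simp
    have "1 - exp (- ?a) \<le> norm (1 - ?q n ^ Suc j)" using norm_triangle_ineq2[of 1 "?q n ^ Suc j"] nq by simp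
    moreover have "exp (- ?a) * ?a \<le> 1 - exp (- ?a)"
    proof -
      have "exp (- ?a) * (1 + ?a) \<le> exp (- ?a) * exp ?a" by (intro mult_left_mono exp_ge_add_one_self) auto
      then show ?thesis by (simp add: algebra_simps flip: exp_add)
    qed
    ultimately have ge: "exp (- ?a) * ?a \<le> norm (1 - ?q n ^ Suc j)" by linarith
    have pos: "0 < exp (- ?a) * ?a" using a by simp
    have "norm (of_real (Re (w n)) * lambert_term (?q n) j) = Re (w n) * (exp (- ?a) / (real (Suc j) * norm (1 - ?q n ^ Suc j)))"
      unfolding lambert_term_def norm_mult norm_divide nq norm_of_nat norm_of_real using wpos[of n] by simp
    also have "\<dots> \<le> Re (w n) * (exp (- ?a) / (real (Suc j) * (exp (- ?a) * ?a)))"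
    proof -
      have "e / (c * X) \<le> e / (c * Y)" if "Y \<le> X" "0 < Y" "0 < c" "0 < e" for e c X Y :: real
        using that by (intro divide_left_mono mult_left_mono mult_pos_pos) auto
      from this[OF ge pos, of "real (Suc j)" "exp (- ?a)"]
      have "exp (- ?a) / (real (Suc j) * norm (1 - ?q n ^ Suc j)) \<le> exp (- ?a) / (real (Suc j) * (exp (- ?a) * ?a))"
        by (metis exp_gt_zero of_nat_0_less_iff zero_less_Suc)
      then show ?thesis by (rule mult_left_mono) (use wpos[of n] in simp)
    qed
    also have "\<dots> = 1 / (real m * (real (Suc j))\<^sup>2)"
      using wpos[of n] m by (simp add: power2_eq_square divide_simps del: of_nat_Suc)
    also have "\<dots> \<le> 1 / (1 * (real (Suc j))\<^sup>2)"
      using m by (intro divide_left_mono mult_right_mono) auto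
    finally show ?thesis by simp
  qed
  have "(\<lambda>n. \<Sum>j. of_real (Re (w n)) * lambert_term (?q n) j) \<longlonglongrightarrow> (\<Sum>j. u / of_nat m * of_real (if \<xi> ^ Suc j = 1 then 1 / (real (Suc j))\<^sup>2 else 0))"
  proof (rule tannerys_theorem[THEN conjunct2, THEN conjunct2])
    show "\<forall>\<^sub>F (j, n) in at_top \<times>\<^sub>F sequentially. norm (of_real (Re (w n)) * lambert_term (?q n) j) \<le> 1 / (real (Suc j))\<^sup>2"
      by (rule always_eventually) (use bound in auto)
  qed (use lim summable_inverse_squares in auto)
  moreover have "(\<Sum>j. of_real (Re (w n)) * lambert_term (?q n) j) = of_real (Re (w n)) * (\<Sum>j. lambert_term (?q n) j)" for n
    by (rule suminf_mult[OF summable_lambert_term(1)[OF q1]])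
  moreover have "(\<Sum>j. u / of_nat m * of_real (if \<xi> ^ Suc j = 1 then 1 / (real (Suc j))\<^sup>2 else 0)) = u / of_nat m * of_real (root_sum \<xi>)"
    unfolding root_sum_def
    by (subst suminf_mult[OF summable_of_real[OF summable_if_inverse_squares]], subst suminf_of_real[OF summable_if_inverse_squares]) simp
  ultimately show ?thesis by simp
qed

lemma sum_inverse_squares_multiples:
  assumes "k > 0"
  shows "(\<lambda>j. if k dvd Suc j then 1 / (real (Suc j))\<^sup>2 else 0) sums (pi\<^sup>2 / 6 / (real k)\<^sup>2)"
proof -
  have mono: "strict_mono (\<lambda>i. k * Suc i - 1)"
    using assms by (intro strict_monoI_Suc) auto
  have S: "Suc (k * Suc i - 1) = k * Suc i" for i using assms by simp
  have "(\<lambda>i. 1 / (real k)\<^sup>2 * (1 / (real (Suc i))\<^sup>2)) sums (1 / (real k)\<^sup>2 * (pi\<^sup>2 / 6))"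
    by (intro sums_mult sums_inverse_squares)
  moreover have "1 / (real k)\<^sup>2 * (1 / (real (Suc i))\<^sup>2) = (if k dvd Suc (k * Suc i - 1) then 1 / (real (Suc (k * Suc i - 1)))\<^sup>2 else 0)" for i
    unfolding S by (simp only: dvd_triv_left if_True of_nat_mult power_mult_distrib times_divide_times_eq mult_1_right)
  moreover have "1 / (real k)\<^sup>2 * (pi\<^sup>2 / 6) = pi\<^sup>2 / 6 / (real k)\<^sup>2" by simp
  ultimately have "(\<lambda>i. if k dvd Suc (k * Suc i - 1) then 1 / (real (Suc (k * Suc i - 1)))\<^sup>2 else 0) sums (pi\<^sup>2 / 6 / (real k)\<^sup>2)"
    by (simp only:)
  then show ?thesis
  proof (subst (asm) sums_mono_reindex[OF mono, of "\<lambda>j. if k dvd Suc j then 1 / (real (Suc j))\<^sup>2 else 0"])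
    fix n assume n: "n \<notin> range (\<lambda>i. k * Suc i - 1)"
    have "\<not> k dvd Suc n"
    proof
      assume "k dvd Suc n"
      then obtain i where i: "Suc n = k * i" by auto
      then have "i > 0" by (cases i) auto
      then have "n = k * Suc (i - 1) - 1" using i by (metis Suc_pred' diff_Suc_1)
      then show False using n by blast
    qed
    then show "(if k dvd Suc n then 1 / (real (Suc n))\<^sup>2 else 0) = 0" by simp
  qed
qed

lemma sum_inverse_squares_odd:
  "(\<lambda>j. if odd (Suc j) then 1 / (real (Suc j))\<^sup>2 else 0) sums (3 / 4 * (pi\<^sup>2 / 6))"
proof -
  have "(\<lambda>j. 1 / (real (Suc j))\<^sup>2 - (if 2 dvd Suc j then 1 / (real (Suc j))\<^sup>2 else 0)) sums (pi\<^sup>2 / 6 - pi\<^sup>2 / 6 / (real 2)\<^sup>2)"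
    by (intro sums_diff sums_inverse_squares sum_inverse_squares_multiples) simp
  moreover have "1 / (real (Suc j))\<^sup>2 - (if 2 dvd Suc j then 1 / (real (Suc j))\<^sup>2 else 0) = (if odd (Suc j) then 1 / (real (Suc j))\<^sup>2 else 0)" for j
    by simp
  moreover have "pi\<^sup>2 / 6 - pi\<^sup>2 / 6 / (real 2)\<^sup>2 = 3 / 4 * (pi\<^sup>2 / 6)" by (simp add: power2_eq_square)
  ultimately show ?thesis by (simp only:)
qed

text \<open>Even powers do not see the sign of \<xi> and cancel.\<close>

lemma root_sum_diff:
  "root_sum (- \<xi>) - root_sum \<xi> = (\<Sum>j. if odd (Suc j) then ((if \<xi> ^ Suc j = - 1 then 1 else 0) - (if \<xi> ^ Suc j = 1 then 1 else 0)) / (real (Suc j))\<^sup>2 else 0)"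
proof -
  have "root_sum (- \<xi>) - root_sum \<xi> = (\<Sum>j. (if (- \<xi>) ^ Suc j = 1 then 1 / (real (Suc j))\<^sup>2 else 0) - (if \<xi> ^ Suc j = 1 then 1 / (real (Suc j))\<^sup>2 else 0))"
    unfolding root_sum_def by (rule suminf_diff[OF summable_if_inverse_squares summable_if_inverse_squares])
  also have "\<dots> = (\<Sum>j. if odd (Suc j) then ((if \<xi> ^ Suc j = - 1 then 1 else 0) - (if \<xi> ^ Suc j = 1 then 1 else 0)) / (real (Suc j))\<^sup>2 else 0)"
  proof (rule suminf_cong)
    fix j
    have neg: "(- \<xi>) ^ Suc j = (if odd (Suc j) then - (\<xi> ^ Suc j) else \<xi> ^ Suc j)"
      by (simp add: power_minus_odd power_minus_even del: power_Suc)
    have "- (\<xi> ^ Suc j) = 1 \<longleftrightarrow> \<xi> ^ Suc j = - 1" by (simp only: equation_minus_iff[of _ "\<xi> ^ Suc j"] minus_equation_iff) (auto simp del: power_Suc)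
    then show "(if (- \<xi>) ^ Suc j = 1 then 1 / (real (Suc j))\<^sup>2 else 0) - (if \<xi> ^ Suc j = 1 then 1 / (real (Suc j))\<^sup>2 else 0) =
       (if odd (Suc j) then ((if \<xi> ^ Suc j = - 1 then 1 else 0) - (if \<xi> ^ Suc j = 1 then 1 else 0)) / (real (Suc j))\<^sup>2 else 0)"
      unfolding neg by (cases "odd (Suc j)"; cases "\<xi> ^ Suc j = 1"; cases "\<xi> ^ Suc j = - 1") (simp_all del: power_Suc of_nat_Suc even_Suc)
  qed
  finally show ?thesis .
qed

text \<open>Compare powers of 2: if 2 divided \<open>j\<close> at most \<open>s\<close> times, an
  odd multiple of \<open>t * j0\<close> would be a multiple of \<open>j\<close>, and the same power
  of \<zeta> would be both 1 and -1.\<close>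

lemma two_power_dvd_of_power_eq_one:
  fixes \<zeta> :: complex
  assumes t: "t = 2 ^ s * l" and j0: "odd j0" "\<zeta> ^ (t * j0) = - 1" and j: "\<zeta> ^ j = 1" "j > 0"
  shows "2 ^ (s + 1) dvd j"
proof (rule ccontr)
  assume n: "\<not> 2 ^ (s + 1) dvd j"
  have "\<exists>v o'. j = 2 ^ v * o' \<and> odd o'" using j(2)
  proof (induction j rule: less_induct)
    case (less j)
    show ?case
    proof (cases "even j")
      case True
      then obtain i where i: "j = 2 * i" by auto
      then obtain v o' where "i = 2 ^ v * o'" "odd o'" using less.IH[of i] less.prems by auto
      then have "j = 2 ^ Suc v * o'" using i by simp
      then show ?thesis using \<open>odd o'\<close> by blast
    next
      case False
      then show ?thesis by (intro exI[of _ 0] exI[of _ j]) simp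
    qed
  qed
  then obtain v o' where v: "j = 2 ^ v * o'" "odd o'" by blast
  have "v \<le> s"
  proof (rule ccontr)
    assume "\<not> v \<le> s"
    then have "2 ^ (s + 1) dvd (2 ^ v :: nat)" by (intro le_imp_power_dvd) simp
    then show False using n v by simp
  qed
  then have "t * j0 * o' = j * (2 ^ (s - v) * l * j0)"
    unfolding t v(1) by (simp add: mult_ac flip: power_add)
  then have "\<zeta> ^ (t * j0 * o') = 1" by (simp only: power_mult j(1) power_one)
  moreover have "\<zeta> ^ (t * j0 * o') = (- 1) ^ o'" by (simp only: power_mult[of \<zeta> "t * j0"] j0(2))
  ultimately show False using v(2) by simp
qed

text \<open>Either some odd power of \<open>\<zeta> ^ t\<close> is -1, and then the order of \<zeta>
  is a multiple of \<open>k\<close> or infinite, or the difference of the last two root sums has no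
  positive term. The second case stays below 3/4 alone.\<close>

lemma exponent_bound:
  fixes \<zeta> :: complex
  assumes t: "t = 2 ^ s * l" "odd l"
  defines "k \<equiv> 2 ^ (s + 1) :: nat" and "L \<equiv> root_sum \<zeta> - root_sum (\<zeta> ^ t) + root_sum (- (\<zeta> ^ t))"
  shows "L \<le> pi\<^sup>2 / 6 * (3 / 4 + 1 / (real k)\<^sup>2)"
    "\<zeta> ^ (2 ^ s) \<noteq> - 1 \<Longrightarrow> L < pi\<^sup>2 / 6 * (3 / 4 + 1 / (real k)\<^sup>2)"
proof -
  let ?\<alpha> = "pi\<^sup>2 / 6"
  have k: "k > 0" by (simp add: k_def)
  \<comment> \<open>Equivalent to \<alpha> - 1 < 3/4 \<alpha> for \<alpha> = pi^2 / 6, the form in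
    which it is used for \<zeta> other than 1.\<close>
  have pi4: "?\<alpha> < 4" using pi_less_4 power_strict_mono[of pi 4 2] by simp
  have "pi\<^sup>2 > 0" by simp
  define D where "D j = (if odd (Suc j) then ((if (\<zeta> ^ t) ^ Suc j = - 1 then 1 else 0) - (if (\<zeta> ^ t) ^ Suc j = 1 then 1 else 0)) / (real (Suc j))\<^sup>2 else 0)" for j
  have L: "L = root_sum \<zeta> + (\<Sum>j. D j)" unfolding L_def D_def root_sum_diff[symmetric] by simp
  have Dle: "\<bar>D j\<bar> \<le> 1 / (real (Suc j))\<^sup>2" for j unfolding D_def by (simp del: power_Suc of_nat_Suc even_Suc)
  have sD: "summable D" by (rule summable_comparison_test'[OF summable_inverse_squares, of 0]) (use Dle in simp)
  have odd_sum: "(\<Sum>j. if odd (Suc j) then 1 / (real (Suc j))\<^sup>2 else 0) = 3 / 4 * ?\<alpha>"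
    using sum_inverse_squares_odd by (simp only: sums_iff)
  have D_le: "(\<Sum>j. D j) \<le> 3 / 4 * ?\<alpha>"
    unfolding odd_sum[symmetric]
    by (rule suminf_le[OF _ sD summable_if_inverse_squares]) (auto simp: D_def divide_right_mono simp del: power_Suc of_nat_Suc even_Suc)
  have goal: "L \<le> ?\<alpha> * (3 / 4 + 1 / (real k)\<^sup>2) \<and> (\<zeta> ^ (2 ^ s) \<noteq> - 1 \<longrightarrow> L < ?\<alpha> * (3 / 4 + 1 / (real k)\<^sup>2))"
  proof (cases "\<exists>j0. odd j0 \<and> \<zeta> ^ (t * j0) = - 1")
    case True
    then obtain j0 where j0: "odd j0" "\<zeta> ^ (t * j0) = - 1" by blast
    have kdvd: "k dvd Suc j" if "\<zeta> ^ Suc j = 1" for j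
      unfolding k_def by (rule two_power_dvd_of_power_eq_one[OF t(1) j0 that]) simp
    have mult_sum: "(\<Sum>j. if k dvd Suc j then 1 / (real (Suc j))\<^sup>2 else 0) = ?\<alpha> / (real k)\<^sup>2"
      using sum_inverse_squares_multiples[OF k] by (simp only: sums_iff)
    have R1: "root_sum \<zeta> \<le> ?\<alpha> / (real k)\<^sup>2"
      unfolding mult_sum[symmetric] root_sum_def
      by (rule suminf_le[OF _ summable_if_inverse_squares summable_if_inverse_squares]) (use kdvd in \<open>auto simp del: power_Suc of_nat_Suc\<close>)
    \<comment> \<open>Away from the extremal points the term \<open>j = k - 1\<close> is missing
      from the root sum, which gives the strict gain 1 / k^2.\<close>
    have R2: "root_sum \<zeta> \<le> ?\<alpha> / (real k)\<^sup>2 - 1 / (real k)\<^sup>2" if ne: "\<zeta> ^ (2 ^ s) \<noteq> - 1"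
    proof -
      have "\<zeta> ^ k \<noteq> 1"
      proof
        assume "\<zeta> ^ k = 1"
        then have "(\<zeta> ^ (2 ^ s))\<^sup>2 = 1" by (simp add: k_def mult.commute flip: power_mult)
        then have "\<zeta> ^ (2 ^ s) = 1" using ne by (simp add: power2_eq_1_iff)
        then have "\<zeta> ^ (t * j0) = 1" unfolding t(1) power_mult by simp
        then show False using j0 by simp
      qed
      then have "\<zeta> ^ Suc (k - 1) \<noteq> 1" using k by simp
      then have le: "(if \<zeta> ^ Suc j = 1 then 1 / (real (Suc j))\<^sup>2 else 0) \<le> (if k dvd Suc j then 1 / (real (Suc j))\<^sup>2 else 0) - (if j = k - 1 then 1 / (real (Suc j))\<^sup>2 else 0)" for j
        using kdvd[of j] k by (cases "j = k - 1") (auto simp del: power_Suc of_nat_Suc)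
      have s1: "(\<lambda>j. if j = k - 1 then 1 / (real (Suc j))\<^sup>2 else 0) sums (1 / (real (Suc (k - 1)))\<^sup>2)"
        by (rule sums_single)
      have s2: "(\<lambda>j. (if k dvd Suc j then 1 / (real (Suc j))\<^sup>2 else 0) - (if j = k - 1 then 1 / (real (Suc j))\<^sup>2 else 0)) sums (?\<alpha> / (real k)\<^sup>2 - 1 / (real (Suc (k - 1)))\<^sup>2)"
        by (intro sums_diff sum_inverse_squares_multiples k s1)
      have "root_sum \<zeta> \<le> (\<Sum>j. (if k dvd Suc j then 1 / (real (Suc j))\<^sup>2 else 0) - (if j = k - 1 then 1 / (real (Suc j))\<^sup>2 else 0))"
        unfolding root_sum_def by (rule suminf_le[OF le summable_if_inverse_squares sums_summable[OF s2]])
      also have "\<dots> = ?\<alpha> / (real k)\<^sup>2 - 1 / (real k)\<^sup>2" using s2 k by (simp add: sums_iff)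
      finally show ?thesis .
    qed
    have pos: "1 / (real k)\<^sup>2 > 0" using k by simp
    have e: "?\<alpha> * (3 / 4 + 1 / (real k)\<^sup>2) = 3 / 4 * ?\<alpha> + ?\<alpha> / (real k)\<^sup>2" by (simp add: distrib_left)
    show ?thesis unfolding e
    proof (intro conjI impI)
      show "L \<le> 3 / 4 * ?\<alpha> + ?\<alpha> / (real k)\<^sup>2" using R1 D_le L by linarith
      show "L < 3 / 4 * ?\<alpha> + ?\<alpha> / (real k)\<^sup>2" if "\<zeta> ^ 2 ^ s \<noteq> - 1" using R2[OF that] D_le L pos by linarith
    qed
  next
    case False
    have no: "\<not> (odd (Suc j) \<and> (\<zeta> ^ t) ^ Suc j = - 1)" for j
      using False by (metis power_mult)
    have kk: "?\<alpha> / (real k)\<^sup>2 > 0" using k by simp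
    have "L < ?\<alpha> * (3 / 4)"
    proof (cases "\<zeta> = 1")
      case True
      have "D j = - (if odd (Suc j) then 1 / (real (Suc j))\<^sup>2 else 0)" for j
        unfolding D_def True by (simp del: of_nat_Suc)
      then have "(\<Sum>j. D j) = - (3 / 4 * ?\<alpha>)"
        unfolding odd_sum[symmetric] by (simp only: suminf_minus[OF summable_if_inverse_squares])
      moreover have "root_sum \<zeta> = ?\<alpha>"
        using sums_inverse_squares by (simp add: root_sum_def True sums_iff)
      ultimately show ?thesis unfolding L using \<open>pi\<^sup>2 > 0\<close> by linarith
    next
      case \<zeta>: False
      have "D j \<le> 0" for j using no[of j] by (auto simp: D_def simp del: power_Suc of_nat_Suc even_Suc)
      then have "(\<Sum>j. D j) \<le> 0" using suminf_le[OF _ sD summable_zero] by simp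
      moreover have "root_sum \<zeta> \<le> ?\<alpha> - 1"
      proof -
        have s2: "(\<lambda>j. 1 / (real (Suc j))\<^sup>2 - (if j = 0 then 1 / (real (Suc j))\<^sup>2 else 0)) sums (?\<alpha> - 1 / (real (Suc 0))\<^sup>2)"
          by (intro sums_diff sums_inverse_squares sums_single)
        have le: "(if \<zeta> ^ Suc j = 1 then 1 / (real (Suc j))\<^sup>2 else 0) \<le> 1 / (real (Suc j))\<^sup>2 - (if j = 0 then 1 / (real (Suc j))\<^sup>2 else 0)" for j
          using \<zeta> by (cases "j = 0") auto
        have "root_sum \<zeta> \<le> (\<Sum>j. 1 / (real (Suc j))\<^sup>2 - (if j = 0 then 1 / (real (Suc j))\<^sup>2 else 0))"
          unfolding root_sum_def by (rule suminf_le[OF le summable_if_inverse_squares sums_summable[OF s2]])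
        also have "\<dots> = ?\<alpha> - 1" using s2 by (simp add: sums_iff)
        finally show ?thesis .
      qed
      ultimately show ?thesis unfolding L using pi4 by linarith
    qed
    then show ?thesis using kk by (auto simp: distrib_left)
  qed
  show "L \<le> ?\<alpha> * (3 / 4 + 1 / (real k)\<^sup>2)" using goal by blast
  show "L < ?\<alpha> * (3 / 4 + 1 / (real k)\<^sup>2)" if "\<zeta> ^ (2 ^ s) \<noteq> - 1" using goal that by blast
qed

lemma norm_euler_fun: "norm (euler_fun q) = exp (- Re (\<Sum>j. lambert_term q j))"
  by (simp add: euler_fun_def)

lemma norm_hook_gf:
  "norm (hook_gf t q) = exp (Re ((\<Sum>j. lambert_term q j) - of_nat t * (\<Sum>j. lambert_term (q ^ t) j) + of_nat t * (\<Sum>j. lambert_term (- (q ^ t)) j)))"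
proof -
  have "norm (hook_gf t q) = exp (- Re (\<Sum>j. lambert_term (q ^ t) j)) ^ t / (exp (- Re (\<Sum>j. lambert_term q j)) * exp (- Re (\<Sum>j. lambert_term (- (q ^ t)) j)) ^ t)"
    by (simp only: hook_gf_def norm_divide norm_mult norm_power norm_euler_fun)
  also have "\<dots> = exp (real t * - Re (\<Sum>j. lambert_term (q ^ t) j) - (- Re (\<Sum>j. lambert_term q j) + real t * - Re (\<Sum>j. lambert_term (- (q ^ t)) j)))"
    by (simp only: exp_of_nat_mult exp_diff exp_add)
  finally show ?thesis by simp
qed

text \<open>A sequence of violations for shrinking \<epsilon> has a subsequence with converging
  angle and converging direction of approach. In the limit the rate at the limit point, weighted by
  \<open>Re u\<close>, would reach the optimum, against \<open>exponent_bound\<close>. The bound 7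
  exceeds a full turn.\<close>

theorem minor_arc_bound:
  assumes t: "t > 0" "t = 2 ^ s * l" "odd l"
  defines "k \<equiv> 2 ^ (s + 1) :: nat"
  shows "\<exists>\<epsilon>>0. \<exists>y0>0. \<forall>y \<theta>. 0 < y \<and> y < y0 \<and> \<bar>\<theta>\<bar> \<le> 7 \<and> (\<forall>h::int. odd h \<longrightarrow> y \<le> \<bar>\<theta> - 2 * pi * of_int h / real k\<bar>) \<longrightarrow>
     norm (hook_gf t (exp (- Complex y (- \<theta>)))) \<le> exp (pi\<^sup>2 / 6 * (3 / 4 + 1 / (real k)\<^sup>2 - \<epsilon>) / y)"
proof (rule ccontr)
  let ?\<alpha> = "pi\<^sup>2 / 6" and ?M = "3 / 4 + 1 / (real k)\<^sup>2"
  let ?bad = "\<lambda>\<epsilon> y \<theta>. 0 < y \<and> y < \<epsilon> \<and> \<bar>\<theta>\<bar> \<le> 7 \<and> (\<forall>h::int. odd h \<longrightarrow> y \<le> \<bar>\<theta> - 2 * pi * of_int h / real k\<bar>) \<and>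
     norm (hook_gf t (exp (- Complex y (- \<theta>)))) > exp (?\<alpha> * (?M - \<epsilon>) / y)"
  let ?pre = "\<lambda>y0 y \<theta>. 0 < y \<and> y < y0 \<and> \<bar>\<theta>\<bar> \<le> 7 \<and> (\<forall>h::int. odd h \<longrightarrow> y \<le> \<bar>\<theta> - 2 * pi * of_int h / real k\<bar>)"
  let ?bnd = "\<lambda>\<epsilon> y \<theta>. norm (hook_gf t (exp (- Complex y (- \<theta>)))) \<le> exp (?\<alpha> * (?M - \<epsilon>) / y)"
  assume neg: "\<not> (\<exists>\<epsilon>>0. \<exists>y0>0. \<forall>y \<theta>. ?pre y0 y \<theta> \<longrightarrow> ?bnd \<epsilon> y \<theta>)"
  have "\<exists>y \<theta>. ?bad \<epsilon> y \<theta>" if "\<epsilon> > 0" for \<epsilon>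
  proof -
    have "\<not> (\<forall>y \<theta>. ?pre \<epsilon> y \<theta> \<longrightarrow> ?bnd \<epsilon> y \<theta>)" using neg that by blast
    then obtain y \<theta> where "?pre \<epsilon> y \<theta>" "\<not> ?bnd \<epsilon> y \<theta>" by blast
    then have "?bad \<epsilon> y \<theta>" unfolding not_le by blast
    then show ?thesis by blast
  qed
  then have "\<exists>p. ?bad (1 / real (Suc n)) (fst p) (snd p)" for n by simp
  then obtain p where p: "\<And>n. ?bad (1 / real (Suc n)) (fst (p n)) (snd (p n))" by metis
  define y0 where "y0 n = fst (p n)" for n
  define \<theta>0 where "\<theta>0 n = snd (p n)" for n
  have bad0: "?bad (1 / real (Suc n)) (y0 n) (\<theta>0 n)" for n using p by (simp add: y0_def \<theta>0_def)
  have "seq_compact {- 7..7::real}" by (simp add: compact_imp_seq_compact)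
  moreover have "\<forall>n. \<theta>0 n \<in> {- 7..7}"
  proof
    fix n
    have "\<bar>\<theta>0 n\<bar> \<le> 7" using bad0[of n] by blast
    then show "\<theta>0 n \<in> {- 7..7}" unfolding atLeastAtMost_iff by linarith
  qed
  ultimately obtain \<theta>s r1 where r1: "strict_mono r1" "(\<theta>0 \<circ> r1) \<longlonglongrightarrow> \<theta>s" by (metis seq_compact_def)
  \<comment> \<open>The direction of approach, kept in the unit disc so that a second compactness
    argument applies.\<close>
  define u0 where "u0 n = complex_of_real (y0 (r1 n)) / Complex (y0 (r1 n)) (- (\<theta>0 (r1 n) - \<theta>s))" for n
  have u0: "norm (u0 n) \<le> 1" for n
  proof -
    let ?z = "Complex (y0 (r1 n)) (- (\<theta>0 (r1 n) - \<theta>s))"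
    have y: "y0 (r1 n) > 0" using bad0 by blast
    have "\<bar>Re ?z\<bar> \<le> norm ?z" by (rule abs_Re_le_cmod)
    then have "y0 (r1 n) \<le> norm ?z" using y by simp
    moreover from this have "norm ?z > 0" using y by linarith
    ultimately show ?thesis using y by (simp add: u0_def norm_divide)
  qed
  have "seq_compact (cball (0::complex) 1)" by (simp add: compact_imp_seq_compact)
  moreover have "\<forall>n. u0 n \<in> cball 0 1" using u0 by simp
  ultimately obtain u r2 where r2: "strict_mono r2" "(u0 \<circ> r2) \<longlonglongrightarrow> u" by (metis seq_compact_def)
  define r where "r = r1 \<circ> r2"
  have r: "strict_mono r" using r1 r2 by (simp add: r_def strict_mono_o)
  define y where "y = (\<lambda>n. y0 (r n))"
  define \<theta> where "\<theta> = (\<lambda>n. \<theta>0 (r n))"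
  define \<epsilon> where "\<epsilon> = (\<lambda>n. 1 / real (Suc (r n)))"
  have bad: "?bad (\<epsilon> n) (y n) (\<theta> n)" for n unfolding y_def \<theta>_def \<epsilon>_def by (rule bad0)
  have \<epsilon>0: "\<epsilon> \<longlonglongrightarrow> 0"
    using LIMSEQ_subseq_LIMSEQ[OF LIMSEQ_inverse_real_of_nat r] by (simp add: \<epsilon>_def o_def inverse_eq_divide)
  have ypos: "y n > 0" for n using bad by blast
  have y0: "y \<longlonglongrightarrow> 0"
    by (rule tendsto_sandwich[OF _ _ tendsto_const \<epsilon>0]) (use bad in \<open>auto intro!: always_eventually less_imp_le\<close>)
  have \<theta>lim: "\<theta> \<longlonglongrightarrow> \<theta>s" using LIMSEQ_subseq_LIMSEQ[OF r1(2) r2(1)] by (simp add: \<theta>_def r_def o_def)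
  define w where "w = (\<lambda>n. Complex (y n) (- (\<theta> n - \<theta>s)))"
  have Rew: "Re (w n) = y n" for n by (simp add: w_def)
  have w0: "w \<longlonglongrightarrow> 0"
  proof -
    have "(\<lambda>n. \<theta> n - \<theta>s) \<longlonglongrightarrow> \<theta>s - \<theta>s" by (intro tendsto_intros \<theta>lim)
    then have "(\<lambda>n. - (\<theta> n - \<theta>s)) \<longlonglongrightarrow> - 0" by (intro tendsto_minus) simp
    from tendsto_Complex[OF y0 this] show ?thesis by (simp add: w_def zero_complex.code)
  qed
  have wpos: "Re (w n) > 0" for n using ypos Rew by simp
  have ulim: "(\<lambda>n. of_real (Re (w n)) / w n) \<longlonglongrightarrow> u"
    using r2(2) by (simp add: u0_def w_def y_def \<theta>_def r_def o_def)
  define \<zeta> where "\<zeta> = cis \<theta>s"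
  have q: "exp (- Complex (y n) (- \<theta> n)) = \<zeta> * exp (- w n)" for n
  proof -
    have "- Complex (y n) (- \<theta> n) = \<i> * of_real \<theta>s + - w n" by (simp add: w_def complex_eq_iff)
    then show ?thesis unfolding \<zeta>_def cis_conv_exp exp_add[symmetric] by (rule arg_cong)
  qed
  have n\<zeta>: "norm \<zeta> = 1" "norm (\<zeta> ^ t) = 1" "norm (- (\<zeta> ^ t)) = 1" by (simp_all add: \<zeta>_def norm_power)
  let ?L = "root_sum \<zeta> - root_sum (\<zeta> ^ t) + root_sum (- (\<zeta> ^ t))"
  let ?S = "\<lambda>n. (\<Sum>j. lambert_term (\<zeta> * exp (- w n)) j) - of_nat t * (\<Sum>j. lambert_term ((\<zeta> * exp (- w n)) ^ t) j) + of_nat t * (\<Sum>j. lambert_term (- ((\<zeta> * exp (- w n)) ^ t)) j)"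
  have S: "(\<lambda>n. of_real (Re (w n)) * ?S n) \<longlonglongrightarrow> u * of_real ?L"
  proof -
    have pt: "(\<zeta> * exp (- w n)) ^ t = \<zeta> ^ t * exp (- (of_nat t * w n))" "- (\<zeta> ^ t * exp (- (of_nat t * w n))) = - (\<zeta> ^ t) * exp (- (of_nat t * w n))" for n
      by (simp_all add: power_mult_distrib flip: exp_of_nat_mult)
    note l = lambert_scaled_limit[OF w0 wpos ulim]
    have "(\<lambda>n. of_real (Re (w n)) * (\<Sum>j. lambert_term (\<zeta> * exp (- (of_nat 1 * w n))) j) -
       of_nat t * (of_real (Re (w n)) * (\<Sum>j. lambert_term (\<zeta> ^ t * exp (- (of_nat t * w n))) j)) +
       of_nat t * (of_real (Re (w n)) * (\<Sum>j. lambert_term (- (\<zeta> ^ t) * exp (- (of_nat t * w n))) j)))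
      \<longlonglongrightarrow> u / of_nat 1 * of_real (root_sum \<zeta>) - of_nat t * (u / of_nat t * of_real (root_sum (\<zeta> ^ t))) + of_nat t * (u / of_nat t * of_real (root_sum (- (\<zeta> ^ t))))"
      by (intro tendsto_add tendsto_diff tendsto_mult[OF tendsto_const] l n\<zeta> t(1)) simp
    moreover have "u / of_nat 1 * of_real (root_sum \<zeta>) - of_nat t * (u / of_nat t * of_real (root_sum (\<zeta> ^ t))) + of_nat t * (u / of_nat t * of_real (root_sum (- (\<zeta> ^ t)))) = u * of_real ?L"
      using t(1) by (simp add: algebra_simps)
    moreover have "a * b - c * (a * d) + c * (a * e) = a * (b - c * d + c * e)" for a b c d e :: complex
      by (simp add: algebra_simps)
    ultimately show ?thesis unfolding pt by (simp only: of_nat_1 mult_1 div_by_1)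
  qed
  have "(\<lambda>n. Re (of_real (Re (w n)) * ?S n)) \<longlonglongrightarrow> Re (u * of_real ?L)" by (intro tendsto_Re S)
  then have lim: "(\<lambda>n. y n * Re (?S n)) \<longlonglongrightarrow> Re u * ?L" by (simp add: Rew)
  have "?\<alpha> * (?M - \<epsilon> n) \<le> y n * Re (?S n)" for n
  proof -
    have "exp (?\<alpha> * (?M - \<epsilon> n) / y n) < exp (Re (?S n))"
      using bad[of n] unfolding q norm_hook_gf by blast
    then have "?\<alpha> * (?M - \<epsilon> n) / y n < Re (?S n)" by simp
    then show ?thesis using ypos[of n] by (simp add: pos_divide_less_eq mult.commute)
  qed
  moreover have "(\<lambda>n. ?\<alpha> * (?M - \<epsilon> n)) \<longlonglongrightarrow> ?\<alpha> * (?M - 0)" by (intro tendsto_intros \<epsilon>0)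
  ultimately have ge: "?\<alpha> * (?M - 0) \<le> Re u * ?L" using lim by (intro LIMSEQ_le) auto
  have Mpos: "?\<alpha> * ?M > 0" by (simp add: add_pos_nonneg)
  have Reu: "Re (of_real (Re (w n)) / w n) = (y n)\<^sup>2 / ((y n)\<^sup>2 + (\<theta> n - \<theta>s)\<^sup>2)" for n
  proof -
    have "Re (of_real (Re (w n)) / w n) = Re (w n) * Re (w n) / ((Re (w n))\<^sup>2 + (Im (w n))\<^sup>2)" by (simp add: Re_divide)
    moreover have "(Im (w n))\<^sup>2 = (\<theta> n - \<theta>s)\<^sup>2" by (simp add: w_def power2_commute)
    ultimately show ?thesis by (simp add: Rew power2_eq_square)
  qed
  have Reulim: "(\<lambda>n. Re (of_real (Re (w n)) / w n)) \<longlonglongrightarrow> Re u" by (intro tendsto_Re ulim)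
  have u01: "0 \<le> Re u" "Re u \<le> 1"
  proof -
    show "0 \<le> Re u" by (rule LIMSEQ_le_const[OF Reulim]) (use Reu in simp)
    have "(y n)\<^sup>2 / ((y n)\<^sup>2 + (\<theta> n - \<theta>s)\<^sup>2) \<le> 1" for n using ypos[of n] by (simp add: divide_le_eq_1 add_pos_nonneg)
    then show "Re u \<le> 1" by (intro LIMSEQ_le_const2[OF Reulim]) (use Reu in simp)
  qed
  show False
  proof (cases "\<zeta> ^ (2 ^ s) = - 1")
    case False
    have "?L < ?\<alpha> * ?M" unfolding k_def by (rule exponent_bound(2)[OF t(2,3) False])
    moreover have "Re u * ?L \<le> max 0 ?L"
    proof (cases "?L \<ge> 0")
      case True
      then show ?thesis using mult_right_mono[OF u01(2) True] by simp
    next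
      case False
      then show ?thesis using u01(1) by (simp add: mult_le_0_iff)
    qed
    ultimately show False using ge Mpos by auto
  next
    case True
    have "cis (2 ^ s * \<theta>s) = cis pi" using True by (simp add: \<zeta>_def Complex.DeMoivre)
    then have "cis (2 ^ s * \<theta>s - pi) = 1" by (simp add: cis_divide[symmetric])
    then obtain i :: int where i: "2 ^ s * \<theta>s - pi = of_int i * (2 * pi)" unfolding cis_eq_1_iff by blast
    have \<theta>s: "\<theta>s = 2 * pi * of_int (2 * i + 1) / real k"
      using i by (simp add: k_def field_simps)
    \<comment> \<open>At an extremal point the excluded arcs keep the angle at distance at least
      \<open>y\<close>, so the weight \<open>Re u\<close> is at most 1/2 instead of 1.\<close>
    have "(y n)\<^sup>2 / ((y n)\<^sup>2 + (\<theta> n - \<theta>s)\<^sup>2) \<le> 1 / 2" for n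
    proof -
      have "odd (2 * i + 1)" by simp
      then have "y n \<le> \<bar>\<theta> n - \<theta>s\<bar>" using bad[of n] unfolding \<theta>s by blast
      then have "(y n)\<^sup>2 \<le> (\<theta> n - \<theta>s)\<^sup>2" using ypos[of n] by (simp add: abs_le_square_iff[symmetric])
      then show ?thesis using ypos[of n] by (simp add: divide_le_eq add_pos_nonneg)
    qed
    then have "Re u \<le> 1 / 2" by (intro LIMSEQ_le_const2[OF Reulim]) (use Reu in simp)
    moreover have L: "?L \<le> ?\<alpha> * ?M" unfolding k_def by (rule exponent_bound(1)[OF t(2,3)])
    moreover have "Re u * ?L \<le> Re u * (?\<alpha> * ?M)" by (rule mult_left_mono[OF L u01(1)])
    moreover have "Re u * (?\<alpha> * ?M) \<le> 1 / 2 * (?\<alpha> * ?M)" using \<open>Re u \<le> 1 / 2\<close> Mpos by (intro mult_right_mono) auto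
    ultimately have "?\<alpha> * ?M \<le> 1 / 2 * (?\<alpha> * ?M)"
      using order_trans[OF order_trans[OF ge[unfolded diff_zero]]] by blast
    then show False using Mpos by linarith
  qed
qed

section \<open>Saddle point and coefficient integrals\<close>

lemma gaussian_has_integral: "((\<lambda>x. exp (- x\<^sup>2)) has_integral sqrt pi) (UNIV :: real set)"
proof -
  have "has_bochner_integral lborel (\<lambda>x::real. exp (- x\<^sup>2)) (2 *\<^sub>R (sqrt pi / 2))"
    by (rule has_bochner_integral_even_function[OF gaussian_moment_0]) simp
  then show ?thesis using has_integral_integral_lborel[of "\<lambda>x::real. exp (- x\<^sup>2)"]
    by (auto simp: has_bochner_integral_iff)
qed

lemma gaussian_half_integrable: "(\<lambda>x::real. exp (- x\<^sup>2 / 2)) integrable_on UNIV"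
proof -
  have "has_bochner_integral lborel (\<lambda>x::real. exp (- x\<^sup>2)) (2 *\<^sub>R (sqrt pi / 2))"
    by (rule has_bochner_integral_even_function[OF gaussian_moment_0]) simp
  then have "integrable lborel (\<lambda>x::real. exp (- x\<^sup>2))" by (auto simp: has_bochner_integral_iff)
  then have "integrable lborel (\<lambda>x::real. exp (- (0 + 1 / sqrt 2 * x)\<^sup>2))"
    by (rule lborel_integrable_real_affine) simp
  moreover have "(0 + 1 / sqrt 2 * x)\<^sup>2 = x\<^sup>2 / 2" for x :: real by (simp add: power_divide)
  ultimately have "integrable lborel (\<lambda>x::real. exp (- (x\<^sup>2 / 2)))" by (simp only:)
  then have "integrable lborel (\<lambda>x::real. exp (- x\<^sup>2 / 2))" by simp
  then show ?thesis using has_integral_integral_lborel by blast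
qed

text \<open>An exact identity, so the saddle point method below has no Taylor remainder.\<close>

lemma saddle_exponent:
  fixes w :: complex
  assumes "w \<noteq> 0"
  shows "1 / w + w = 2 + (1 - w)\<^sup>2 / w"
  using assms by (simp add: field_simps power2_eq_square)

lemma csqrt_of_real_mult:
  assumes "r > 0" "Re w > 0"
  shows "csqrt (of_real r * w) = of_real (sqrt r) * csqrt w"
proof (rule csqrt_unique)
  show "(of_real (sqrt r) * csqrt w)\<^sup>2 = of_real r * w"
    using assms by (simp add: power_mult_distrib flip: of_real_power)
  have "0 < sqrt r * Re (csqrt w)"
    using csqrt_divide(3)[of w 1] assms by (intro mult_pos_pos) auto
  then show "0 < Re (of_real (sqrt r) * csqrt w) \<or>
      Re (of_real (sqrt r) * csqrt w) = 0 \<and> 0 \<le> Im (of_real (sqrt r) * csqrt w)" by simp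
qed

text \<open>\<open>y n\<close> minimises A / y + n y. With z = y w, w = 1 - i x / b and b^2 = A / y
  = n y, the exponent is exactly 2 b^2 - x^2 / w, and dominated convergence yields the Gaussian
  integral. The square root of z, the substitution and \<open>b\<close> together account for y^2 /
  sqrt A.\<close>

theorem saddle_point:
  fixes g :: "complex \<Rightarrow> complex" and A :: real
  assumes A: "A > 0"
    and lim: "((\<lambda>z. g z / (csqrt z * exp (of_real A / z))) \<longlongrightarrow> \<kappa>) (at 0 within sector)"
    and cont: "continuous_on {z. Re z > 0} g"
  defines "y \<equiv> \<lambda>n::nat. sqrt (A / real n)"
  shows "(\<lambda>n. of_real (exp (- (2 * A / y n)) / (y n)\<^sup>2) *
      integral {- y n..y n} (\<lambda>\<phi>. g (Complex (y n) (- \<phi>)) * exp (of_nat n * Complex (y n) (- \<phi>))))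
    \<longlonglongrightarrow> \<kappa> * of_real (sqrt (pi / A))"
proof -
  define R where "R = (\<lambda>z. g z / (csqrt z * exp (of_real A / z)))"
  define b where "b = (\<lambda>n. sqrt (A / y n))"
  define w where "w = (\<lambda>n x. Complex 1 (- (x / b n)))"
  define Z where "Z = (\<lambda>n x. of_real (y n) * w n x)"
  define F where "F = (\<lambda>n x. R (Z n x) * csqrt (w n x) * exp (- of_real (x\<^sup>2) / w n x))"
  define J where "J = (\<lambda>n. integral {- y n..y n}
      (\<lambda>\<phi>. g (Complex (y n) (- \<phi>)) * exp (of_nat n * Complex (y n) (- \<phi>))))"
  have y0: "y n > 0" if "n > 0" for n using A that by (simp add: y_def)
  have b0: "b n > 0" if "n > 0" for n using y0[OF that] A by (simp add: b_def)
  have b2: "(b n)\<^sup>2 = A / y n" if "n > 0" for n using y0[OF that] A by (simp add: b_def)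
  have ny: "real n * y n = (b n)\<^sup>2" if "n > 0" for n
  proof -
    have "(y n)\<^sup>2 = A / real n" using A by (simp add: y_def)
    then have "real n * (y n)\<^sup>2 = A" using that by simp
    then show ?thesis using b2[OF that] y0[OF that] by (auto simp: divide_simps power2_eq_square)
  qed
  have yb: "sqrt A = b n * sqrt (y n)" if "n > 0" for n
    using y0[OF that] by (simp add: b_def real_sqrt_divide)
  have ylim: "y \<longlonglongrightarrow> 0" unfolding y_def using A by real_asymp
  have blim: "filterlim b at_top sequentially" unfolding b_def y_def using A by real_asymp
  have wnz: "w n x \<noteq> 0" "Re (w n x) = 1" for n x by (auto simp: w_def complex_eq_iff)
  have key: "g (Complex (y n) (- (y n / b n * x))) * exp (of_nat n * Complex (y n) (- (y n / b n * x))) =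
      of_real (sqrt (y n) * exp (2 * A / y n)) * F n x" if n: "n > 0" for n x
  proof -
    have Zeq: "Complex (y n) (- (y n / b n * x)) = Z n x"
      by (simp add: Z_def w_def complex_eq_iff)
    have ReZ: "Re (Z n x) > 0" using y0[OF n] by (simp add: Z_def w_def)
    then have "csqrt (Z n x) \<noteq> 0" by auto
    then have g: "g (Z n x) = R (Z n x) * (csqrt (Z n x) * exp (of_real A / Z n x))" by (simp add: R_def)
    have cs: "csqrt (Z n x) = of_real (sqrt (y n)) * csqrt (w n x)"
      unfolding Z_def by (rule csqrt_of_real_mult) (use y0[OF n] wnz in auto)
    have "of_real A / Z n x + of_nat n * Z n x = of_real ((b n)\<^sup>2) * (1 / w n x + w n x)"
    proof -
      have "of_real A / Z n x = of_real ((b n)\<^sup>2) * (1 / w n x)" unfolding b2[OF n] Z_def by simp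
      moreover have "of_nat n * Z n x = of_real ((b n)\<^sup>2) * w n x"
        unfolding ny[OF n, symmetric] Z_def by simp
      ultimately show ?thesis by (simp add: distrib_left)
    qed
    also have "\<dots> = of_real (2 * (b n)\<^sup>2) + of_real ((b n)\<^sup>2) * (1 - w n x)\<^sup>2 / w n x"
      unfolding saddle_exponent[OF wnz(1)] by (simp add: distrib_left)
    also have "of_real ((b n)\<^sup>2) * (1 - w n x)\<^sup>2 = - complex_of_real (x\<^sup>2)"
      using b0[OF n] by (simp add: w_def complex_eq_iff power2_eq_square)
    finally have e: "of_real A / Z n x + of_nat n * Z n x = of_real (2 * (b n)\<^sup>2) + - of_real (x\<^sup>2) / w n x" .
    have "exp (of_real A / Z n x) * exp (of_nat n * Z n x) =
        of_real (exp (2 * A / y n)) * exp (- of_real (x\<^sup>2) / w n x)"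
      unfolding exp_add[symmetric] e b2[OF n] by (simp only: exp_add) (simp add: exp_of_real[symmetric])
    then show ?thesis unfolding Zeq g cs F_def by (simp add: ac_simps)
  qed
  have int: "(F n has_integral of_real (b n / (y n * sqrt (y n)) * exp (- (2 * A / y n))) * J n) {- b n..b n}"
    if n: "n > 0" for n
  proof -
    let ?f = "\<lambda>\<phi>. g (Complex (y n) (- \<phi>)) * exp (of_nat n * Complex (y n) (- \<phi>))"
    have c: "continuous_on {- y n..y n} (\<lambda>\<phi>. Complex (y n) (- \<phi>))"
      unfolding Complex_eq by (intro continuous_intros)
    have "continuous_on {- y n..y n} ?f"
      by (intro continuous_on_mult continuous_on_exp continuous_on_const c
            continuous_on_compose2[OF cont c]) (use y0[OF n] in auto)
    then have "(?f has_integral J n) (cbox (- y n) (y n))"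
      unfolding J_def cbox_interval by (intro integrable_integral integrable_continuous_interval)
    from has_integral_affinity'[OF this, of "y n / b n" 0]
    have "((\<lambda>x. ?f (y n / b n * x)) has_integral of_real (b n / y n) * J n) {- b n..b n}"
      using y0[OF n] b0[OF n] by (simp add: scaleR_conv_of_real field_simps)
    then have "((\<lambda>x. of_real (sqrt (y n) * exp (2 * A / y n)) * F n x) has_integral of_real (b n / y n) * J n) {- b n..b n}"
      unfolding key[OF n] .
    then have "((\<lambda>x. of_real (1 / (sqrt (y n) * exp (2 * A / y n))) * (of_real (sqrt (y n) * exp (2 * A / y n)) * F n x))
        has_integral of_real (1 / (sqrt (y n) * exp (2 * A / y n))) * (of_real (b n / y n) * J n)) {- b n..b n}"
      by (rule has_integral_mult_right)
    moreover have "of_real (1 / (sqrt (y n) * exp (2 * A / y n))) * (of_real (sqrt (y n) * exp (2 * A / y n)) * F n x) = F n x" for x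
      using y0[OF n] unfolding mult.assoc[symmetric] of_real_mult[symmetric] by (simp flip: of_real_mult)
    moreover have "of_real (1 / (sqrt (y n) * exp (2 * A / y n))) * (of_real (b n / y n) * J n) =
        of_real (b n / (y n * sqrt (y n)) * exp (- (2 * A / y n))) * J n"
      unfolding mult.assoc[symmetric] of_real_mult[symmetric] by (simp add: exp_minus field_simps)
    ultimately show ?thesis by simp
  qed
  have lim': "(R \<longlongrightarrow> \<kappa>) (at 0 within sector)" unfolding R_def by (rule lim)
  then have "\<forall>\<^sub>F z in at 0 within sector. dist (R z) \<kappa> < 1" by (rule tendstoD) simp
  then obtain d where d: "d > 0" "\<And>z. z \<in> sector \<Longrightarrow> z \<noteq> 0 \<Longrightarrow> norm z < d \<Longrightarrow> dist (R z) \<kappa> < 1"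
    unfolding eventually_at by (auto simp: dist_norm)
  have "\<forall>\<^sub>F n in sequentially. y n < d / 2" using ylim d(1) by (intro order_tendstoD(2)) auto
  then obtain N0 where N0: "\<And>n. n \<ge> N0 \<Longrightarrow> y n < d / 2" by (auto simp: eventually_sequentially)
  \<comment> \<open>Dominated convergence wants the majorant for every index, so the sequence is
    started late enough and the offset is undone at the end.\<close>
  define N where "N = Suc N0"
  have N: "y n < d / 2" "n > 0" if "n \<ge> N" for n using that N0 by (auto simp: N_def)
  have wsec: "w n x \<in> sector" if "n > 0" "x \<in> {- b n..b n}" for n x
    using that b0[OF that(1)] by (auto simp: w_def sector_def abs_le_iff field_simps)
  have Zsec: "Z n x \<in> sector" "Z n x \<noteq> 0" "norm (Z n x) \<le> 2 * y n" if "n > 0" "x \<in> {- b n..b n}" for n x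
  proof -
    have "\<bar>y n * Im (w n x)\<bar> \<le> y n * Re (w n x)"
      using wsec[OF that] y0[OF that(1)] unfolding abs_mult by (simp add: sector_def)
    then show Z: "Z n x \<in> sector" using y0[OF that(1)] wnz by (simp add: Z_def sector_def)
    show "Z n x \<noteq> 0" using y0[OF that(1)] wnz by (simp add: Z_def)
    show "norm (Z n x) \<le> 2 * y n" using norm_sector_le[OF Z] wnz by (simp add: Z_def)
  qed
  define G where "G = (\<lambda>n x. if x \<in> {- b (n + N)..b (n + N)} then F (n + N) x else 0)"
  have Gint: "(G n has_integral of_real (b (n + N) / (y (n + N) * sqrt (y (n + N))) * exp (- (2 * A / y (n + N)))) * J (n + N)) UNIV" for n
    unfolding G_def using int[OF N(2)[of "n + N"]] by (simp only: has_integral_restrict_UNIV)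
  have bound: "norm (G n x) \<le> (norm \<kappa> + 1) * 2 * exp (- x\<^sup>2 / 2)" for n x
  proof (cases "x \<in> {- b (n + N)..b (n + N)}")
    case True
    let ?m = "n + N"
    have m: "?m > 0" "y ?m < d / 2" using N[of ?m] by auto
    note z = Zsec[OF m(1) True] and s = wsec[OF m(1) True]
    have "dist (R (Z ?m x)) \<kappa> < 1" by (rule d(2)[OF z(1,2)]) (use z(3) m(2) in simp)
    then have 1: "norm (R (Z ?m x)) \<le> norm \<kappa> + 1"
      using norm_triangle_ineq2[of "R (Z ?m x)" \<kappa>] by (simp add: dist_norm)
    have "norm (csqrt (w ?m x)) ^ 2 \<le> 2 ^ 2"
      using norm_sector_le[OF s] wnz by (simp flip: norm_power)
    then have 2: "norm (csqrt (w ?m x)) \<le> 2" by (rule power2_le_imp_le) simp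
    have "1 / 2 \<le> Re (1 / w ?m x)" using Re_inverse_sector[OF s] wnz by simp
    then have "x\<^sup>2 * (1 / 2) \<le> x\<^sup>2 * Re (1 / w ?m x)" by (rule mult_left_mono) simp
    moreover have "Re (- of_real (x\<^sup>2) / w ?m x) = - (x\<^sup>2 * Re (1 / w ?m x))"
    proof -
      have "- of_real (x\<^sup>2) / w ?m x = of_real (- (x\<^sup>2)) * (1 / w ?m x)" by simp
      then show ?thesis by (simp only: Re_complex_of_real Im_complex_of_real times_complex.simps)
    qed
    ultimately have 3: "norm (exp (- of_real (x\<^sup>2) / w ?m x)) \<le> exp (- x\<^sup>2 / 2)" by simp
    have "norm (R (Z ?m x)) * norm (csqrt (w ?m x)) * norm (exp (- of_real (x\<^sup>2) / w ?m x))
        \<le> (norm \<kappa> + 1) * 2 * exp (- x\<^sup>2 / 2)"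
      by (intro mult_mono 1 2 3) auto
    then show ?thesis using True by (simp add: G_def F_def norm_mult)
  next
    case False
    then have "G n x = 0" unfolding G_def by (rule if_not_P)
    then show ?thesis by simp
  qed
  have conv: "(\<lambda>n. G n x) \<longlonglongrightarrow> \<kappa> * of_real (exp (- x\<^sup>2))" for x
  proof -
    have ev: "\<forall>\<^sub>F n in sequentially. n > 0 \<and> x \<in> {- b n..b n}"
    proof -
      have "\<forall>\<^sub>F n in sequentially. \<bar>x\<bar> \<le> b n" using blim by (simp add: filterlim_at_top)
      then show ?thesis using eventually_gt_at_top[of 0] by eventually_elim auto
    qed
    have xb: "(\<lambda>n. - (x / b n)) \<longlonglongrightarrow> 0"
      using tendsto_minus[OF tendsto_divide_0[OF tendsto_const filterlim_at_top_imp_at_infinity[OF blim]]] by simp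
    have w1: "(\<lambda>n. w n x) \<longlonglongrightarrow> 1"
      unfolding w_def using tendsto_Complex[OF tendsto_const[of 1] xb] by (simp add: one_complex.ctr)
    have Zl: "(\<lambda>n. Z n x) \<longlonglongrightarrow> 0"
      unfolding Z_def using tendsto_mult[OF tendsto_of_real[OF ylim] w1] by simp
    have "filterlim (\<lambda>n. Z n x) (at 0 within sector) sequentially"
      unfolding filterlim_at using Zl ev by (auto elim!: eventually_mono dest: Zsec)
    then have R1: "(\<lambda>n. R (Z n x)) \<longlonglongrightarrow> \<kappa>" by (rule filterlim_compose[OF lim'])
    have "isCont csqrt 1" by (rule continuous_at_csqrt) (simp add: complex_nonpos_Reals_iff)
    then have c1: "(\<lambda>n. csqrt (w n x)) \<longlonglongrightarrow> csqrt 1" by (rule isCont_tendsto_compose[OF _ w1])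
    have "(\<lambda>n. F n x) \<longlonglongrightarrow> \<kappa> * csqrt 1 * exp (- of_real (x\<^sup>2) / 1)"
      unfolding F_def by (intro tendsto_mult R1 c1 tendsto_exp tendsto_divide tendsto_const w1) simp
    then have "(\<lambda>n. F n x) \<longlonglongrightarrow> \<kappa> * of_real (exp (- x\<^sup>2))"
      by (simp add: exp_of_real[symmetric])
    then have "(\<lambda>n. if x \<in> {- b n..b n} then F n x else 0) \<longlonglongrightarrow> \<kappa> * of_real (exp (- x\<^sup>2))"
      by (rule Lim_transform_eventually) (use ev in \<open>auto elim!: eventually_mono\<close>)
    then show ?thesis unfolding G_def by (rule LIMSEQ_ignore_initial_segment)
  qed
  have "(\<lambda>n. integral UNIV (G n)) \<longlonglongrightarrow> integral UNIV (\<lambda>x. \<kappa> * of_real (exp (- x\<^sup>2)))"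
  proof (rule dominated_convergence)
    show "G n integrable_on UNIV" for n using Gint by blast
    show "(\<lambda>x. (norm \<kappa> + 1) * 2 * exp (- x\<^sup>2 / 2)) integrable_on UNIV"
      using integrable_on_mult_right[OF gaussian_half_integrable, of "(norm \<kappa> + 1) * 2"] .
    show "norm (G n x) \<le> (norm \<kappa> + 1) * 2 * exp (- x\<^sup>2 / 2)" for n x by (rule bound)
    show "(\<lambda>n. G n x) \<longlonglongrightarrow> \<kappa> * of_real (exp (- x\<^sup>2))" for x by (rule conv)
  qed
  also have "integral UNIV (\<lambda>x. \<kappa> * of_real (exp (- x\<^sup>2))) = \<kappa> * of_real (sqrt pi)"
    by (rule integral_unique[OF has_integral_mult_right[OF has_integral_of_real[OF gaussian_has_integral]]])
  finally have "(\<lambda>n. of_real (1 / sqrt A) * integral UNIV (G n)) \<longlonglongrightarrow> of_real (1 / sqrt A) * (\<kappa> * of_real (sqrt pi))"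
    by (rule tendsto_mult_left)
  moreover have "of_real (1 / sqrt A) * integral UNIV (G n) =
      of_real (exp (- (2 * A / y (n + N))) / (y (n + N))\<^sup>2) * J (n + N)" for n
  proof -
    let ?m = "n + N"
    have m: "?m > 0" using N[of ?m] by auto
    have yy: "y ?m = sqrt (y ?m) * sqrt (y ?m)" using y0[OF m] by simp
    have "1 / sqrt A * (b ?m / (y ?m * sqrt (y ?m)) * exp (- (2 * A / y ?m))) = exp (- (2 * A / y ?m)) / (y ?m)\<^sup>2"
      unfolding yb[OF m] using b0[OF m] y0[OF m] by (simp add: power2_eq_square)
    then show ?thesis unfolding integral_unique[OF Gint] mult.assoc[symmetric] of_real_mult[symmetric] by simp
  qed
  ultimately have "(\<lambda>n. of_real (exp (- (2 * A / y (n + N))) / (y (n + N))\<^sup>2) * J (n + N))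
      \<longlonglongrightarrow> of_real (1 / sqrt A) * (\<kappa> * of_real (sqrt pi))" by simp
  then have "(\<lambda>n. of_real (exp (- (2 * A / y n)) / (y n)\<^sup>2) * J n)
      \<longlonglongrightarrow> of_real (1 / sqrt A) * (\<kappa> * of_real (sqrt pi))"
    by (rule LIMSEQ_offset)
  then show ?thesis unfolding J_def by (simp add: real_sqrt_divide)
qed

section \<open>Extraction of coefficients\<close>

lemma integral_exp_period:
  fixes d :: int and k :: nat
  assumes d: "d \<noteq> 0" "int k dvd d" and k: "k > 0"
  shows "((\<lambda>\<phi>. exp (of_int d * Complex y (- \<phi>))) has_integral 0) {- (pi / real k)..pi / real k}"
proof -
  define F where "F = (\<lambda>w. exp (of_int d * (of_real y - \<i> * w)) / (- (of_int d * \<i>)))"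
  have D: "(F has_field_derivative exp (of_int d * (of_real y - \<i> * w))) (at w)" for w
    unfolding F_def using d(1) by (auto intro!: derivative_eq_intros simp: field_simps)
  have "((\<lambda>\<phi>. exp (of_int d * (of_real y - \<i> * of_real \<phi>))) has_integral
      F (of_real (pi / real k)) - F (of_real (- (pi / real k)))) {- (pi / real k)..pi / real k}"
    by (rule fundamental_theorem_of_calculus)
       (auto intro!: has_vector_derivative_real_field D order_trans[of _ 0])
  moreover have "F (of_real (pi / real k)) = F (of_real (- (pi / real k)))"
  proof -
    obtain e where e: "d = int k * e" using d(2) by blast
    have "of_int d * (of_real y - \<i> * of_real (- (pi / real k))) =
        of_int d * (of_real y - \<i> * of_real (pi / real k)) + of_int (2 * e) * (of_real pi * \<i>)"
      using k by (simp add: e field_simps)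
    then have "exp (of_int d * (of_real y - \<i> * of_real (- (pi / real k)))) =
        exp (of_int d * (of_real y - \<i> * of_real (pi / real k)))"
      unfolding exp_eq by (auto intro!: exI[of _ e])
    then show ?thesis unfolding F_def by (rule arg_cong[OF sym])
  qed
  moreover have "Complex y (- \<phi>) = of_real y - \<i> * of_real \<phi>" for \<phi> by (simp add: complex_eq_iff)
  ultimately show ?thesis by simp
qed

text \<open>Averaging over the \<open>k\<close>-th roots of unity folds Cauchy's integral over the whole circle
  onto a single arc of length \<open>2 * pi / k\<close>.\<close>

theorem coefficient_integral:
  fixes a :: "nat \<Rightarrow> complex"
  assumes sm: "summable (\<lambda>m. norm (a m) * exp (- y) ^ m)" and k: "k > 0"
  shows "integral {- (pi / real k)..pi / real k} (\<lambda>\<phi>. \<Sum>h<k. cis (- (2 * pi * real (h * n) / real k)) *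
      (\<Sum>m. a m * (zeta k h * exp (- Complex y (- \<phi>))) ^ m) * exp (of_nat n * Complex y (- \<phi>))) =
    2 * of_real pi * a n"
proof -
  let ?I = "{- (pi / real k)..pi / real k}"
  \<comment> \<open>The average over the \<open>k\<close>-th roots of unity leaves only exponents
    congruent to \<open>n\<close> mod \<open>k\<close>, and these have period 2 pi / k.\<close>
  define C where "C = (\<lambda>m. if int k dvd int m - int n then of_nat k else (0::complex))"
  define T where "T = (\<lambda>m \<phi>. a m * C m * exp (of_int (int n - int m) * Complex y (- \<phi>)))"
  have T: "(\<Sum>h<k. cis (- (2 * pi * real (h * n) / real k)) * (a m * (zeta k h * exp (- Complex y (- \<phi>))) ^ m) *
      exp (of_nat n * Complex y (- \<phi>))) = T m \<phi>" for m \<phi>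
  proof -
    have "cis (- (2 * pi * real (h * n) / real k)) * (a m * (zeta k h * exp (- Complex y (- \<phi>))) ^ m) *
      exp (of_nat n * Complex y (- \<phi>)) =
      a m * exp (of_int (int n - int m) * Complex y (- \<phi>)) * cis (2 * pi * of_int (int m - int n) * real h / real k)" for h
    proof -
      have 1: "cis (- (2 * pi * real (h * n) / real k)) * zeta k h ^ m =
          cis (2 * pi * of_int (int m - int n) * real h / real k)"
        unfolding zeta_def Complex.DeMoivre cis_mult
        by (rule arg_cong[where f = cis]) (use k in \<open>simp add: field_simps\<close>)
      have 2: "exp (- Complex y (- \<phi>)) ^ m * exp (of_nat n * Complex y (- \<phi>)) =
          exp (of_int (int n - int m) * Complex y (- \<phi>))"
        unfolding exp_of_nat_mult[symmetric] exp_add[symmetric]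
        by (rule arg_cong[where f = exp]) (simp add: algebra_simps)
      have "cis (- (2 * pi * real (h * n) / real k)) * (a m * (zeta k h * exp (- Complex y (- \<phi>))) ^ m) *
          exp (of_nat n * Complex y (- \<phi>)) =
          a m * (exp (- Complex y (- \<phi>)) ^ m * exp (of_nat n * Complex y (- \<phi>))) *
          (cis (- (2 * pi * real (h * n) / real k)) * zeta k h ^ m)"
        unfolding power_mult_distrib by (simp only: ac_simps)
      then show ?thesis unfolding 1 2 .
    qed
    moreover have "(\<Sum>h<k. cis (2 * pi * of_int (int m - int n) * real h / real k)) = C m"
      using sum_cis_multiples[OF k, of 1 "int m - int n"] by (simp add: C_def)
    ultimately show ?thesis unfolding T_def by (simp only: sum_distrib_left[symmetric]) (simp only: ac_simps)
  qed
  have nz: "norm (zeta k h * exp (- Complex y (- \<phi>))) = exp (- y)" for h \<phi>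
    by (simp add: zeta_def norm_mult)
  have sum: "summable (\<lambda>m. a m * (zeta k h * exp (- Complex y (- \<phi>))) ^ m)" for h \<phi>
    by (rule summable_norm_cancel) (simp only: norm_mult[of "a _"] norm_power nz sm)
  have sums: "(\<lambda>m. T m \<phi>) sums (\<Sum>h<k. cis (- (2 * pi * real (h * n) / real k)) *
      (\<Sum>m. a m * (zeta k h * exp (- Complex y (- \<phi>))) ^ m) * exp (of_nat n * Complex y (- \<phi>)))" for \<phi>
    unfolding T[symmetric]
    by (rule sums_sum, rule sums_mult2, rule sums_mult, rule summable_sums, rule sum)
  have cT: "continuous_on ?I (T m)" for m
    unfolding T_def Complex_eq by (intro continuous_intros)
  have bound: "norm (T m \<phi>) \<le> norm (a m) * exp (- y) ^ m * (real k * exp (real n * y))" for m \<phi>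
  proof -
    have "norm (exp (of_int (int n - int m) * Complex y (- \<phi>))) = exp (- y) ^ m * exp (real n * y)"
      by (simp add: exp_of_nat_mult[symmetric] exp_add[symmetric] algebra_simps)
    moreover have "norm (C m) \<le> real k" by (simp add: C_def)
    ultimately have "norm (T m \<phi>) \<le> norm (a m) * real k * (exp (- y) ^ m * exp (real n * y))"
      unfolding T_def norm_mult by (intro mult_mono) auto
    then show ?thesis by (simp only: ac_simps)
  qed
  have uni: "uniform_limit ?I (\<lambda>N \<phi>. \<Sum>m<N. T m \<phi>) (\<lambda>\<phi>. \<Sum>m. T m \<phi>) sequentially"
    by (rule Weierstrass_m_test[OF bound summable_mult2[OF sm]])
  have cS: "continuous_on ?I (\<lambda>\<phi>. \<Sum>m<N. T m \<phi>)" for N by (intro continuous_on_sum cT)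
  obtain I J where I: "\<And>N. ((\<lambda>\<phi>. \<Sum>m<N. T m \<phi>) has_integral I N) ?I"
    and J: "((\<lambda>\<phi>. \<Sum>m. T m \<phi>) has_integral J) ?I" and IJ: "I \<longlonglongrightarrow> J"
    by (rule uniform_limit_integral[OF uni cS sequentially_bot]) (rule that)
  have Tm: "(T m has_integral (if m = n then 2 * of_real pi * a n else 0)) ?I" for m
  proof (cases "m = n")
    case True
    have "((\<lambda>\<phi>. a n * of_nat k) has_integral (pi / real k - - (pi / real k)) *\<^sub>R (a n * of_nat k)) ?I"
      using k by (intro has_integral_const_real[THEN has_integral_eq_rhs]) (auto intro!: order_trans[of _ 0] simp: measure_def)
    then show ?thesis using True k by (simp add: T_def C_def scaleR_conv_of_real mult.assoc)
  next
    case False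
    then show ?thesis
    proof (cases "int k dvd int m - int n")
      case True
      have "((\<lambda>\<phi>. exp (of_int (int n - int m) * Complex y (- \<phi>))) has_integral 0) ?I"
        by (rule integral_exp_period) (use True False k in \<open>auto simp: dvd_diff_commute\<close>)
      from has_integral_mult_right[OF this, of "a m * C m"] False show ?thesis unfolding T_def by simp
    qed (simp add: T_def C_def)
  qed
  have "I N = 2 * of_real pi * a n" if "N > n" for N
  proof -
    have "((\<lambda>\<phi>. \<Sum>m<N. T m \<phi>) has_integral (\<Sum>m<N. if m = n then 2 * of_real pi * a n else 0)) ?I"
      by (intro has_integral_sum Tm) auto
    then have "I N = (\<Sum>m<N. if m = n then 2 * of_real pi * a n else 0)" by (rule has_integral_unique[OF I])
    then show ?thesis using that by simp
  qed
  then have "\<forall>\<^sub>F N in sequentially. I N = 2 * of_real pi * a n"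
    by (rule eventually_mono[OF eventually_gt_at_top])
  then have "I \<longlonglongrightarrow> 2 * of_real pi * a n" by (rule tendsto_eventually)
  then have "J = 2 * of_real pi * a n" using IJ LIMSEQ_unique by blast
  then show ?thesis using integral_unique[OF J] unfolding sums_unique[OF sums, symmetric] by simp
qed

text \<open>Read off the power series, not the Lambert series behind
  \<open>euler_fun\<close>.\<close>

lemma continuous_on_hook_gf:
  assumes "t > 0"
  shows "continuous_on (ball 0 1) (hook_gf t)"
proof -
  let ?f = "\<lambda>q. \<Sum>n. of_int (p_diff t n) * q ^ n :: complex"
  have "isCont ?f x" if "norm x < 1" for x
  proof (rule isCont_powser)
    let ?K = "of_real ((1 + norm x) / 2) :: complex"
    have nK: "norm ?K = (1 + norm x) / 2" by (simp del: of_real_add of_real_divide)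
    show "summable (\<lambda>n. of_int (p_diff t n) * ?K ^ n)"
      by (rule summable_norm_cancel, rule p_diff_gf(1)[OF assms]) (use nK that in simp)
    show "norm x < norm ?K" using nK that by simp
  qed
  then have "continuous_on (ball 0 1) ?f" by (auto intro!: continuous_at_imp_continuous_on)
  then show ?thesis
    by (rule continuous_on_eq) (simp add: p_diff_gf(2)[OF assms])
qed

theorem p_diff_integral:
  assumes t: "t > 0" and k: "k > 0" and y: "y > 0"
  shows "integral {- (pi / real k)..pi / real k} (\<lambda>\<phi>. \<Sum>h<k. cis (- (2 * pi * real (h * n) / real k)) *
      hook_gf t (zeta k h * exp (- Complex y (- \<phi>))) * exp (of_nat n * Complex y (- \<phi>))) =
    2 * of_real pi * of_int (p_diff t n)"
proof -
  have q: "norm (zeta k h * exp (- Complex y (- \<phi>))) < 1" for h \<phi>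
    using y by (simp add: zeta_def norm_mult)
  have "summable (\<lambda>m. norm (complex_of_int (p_diff t m)) * exp (- y) ^ m)"
    using p_diff_gf(1)[OF t, of "of_real (exp (- y))"] y by (simp add: norm_mult norm_power)
  from coefficient_integral[OF this k, of n] show ?thesis
    unfolding p_diff_gf(2)[OF t q] .
qed

section \<open>Asymptotics of the difference\<close>

text \<open>At a dominant root \<open>\<zeta> ^ t = - 1\<close>, so the other two factors are taken
  near -1 and 1 at t z. Their square roots cancel, and the \<open>t\<close>-th power undoes the t in
  1 / (t z); the rates 1, 1 / k^2 and -1/4 (times pi^2 / 6) add up.\<close>

lemma hook_gf_asymptotics:
  fixes t s l h :: nat
  assumes t: "t > 0" "t = 2 ^ s * l" "odd l" and h: "odd h"
  defines "k \<equiv> 2 ^ (s + 1) :: nat"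
  shows "((\<lambda>z. hook_gf t (zeta k h * exp (- z)) /
      (csqrt z * exp (of_real (pi\<^sup>2 / 6 * (3 / 4 + 1 / (real k)\<^sup>2)) / z))) \<longlongrightarrow>
    (theta_const 2 1 / (2 * theta_const 1 0)) ^ t / (of_real (sqrt (pi / 6) / real k) * theta_const k h))
    (at 0 within sector)"
proof -
  define E where "E = (\<lambda>m h z. euler_fun (zeta m h * exp (- z)) * csqrt z * exp (of_real (pi\<^sup>2 / (6 * (real m)\<^sup>2)) / z))"
  have E: "(E m h \<longlongrightarrow> of_real (sqrt (pi / 6) / real m) * theta_const m h) (at 0 within sector)"
    if "m > 0" "zeta m h ^ m = 1" "gauss_coeff (zeta m h) m 0 = 0" for m h
  proof -
    have "sqrt (pi / (6 * (real m)\<^sup>2)) = sqrt (pi / 6) / real m"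
      by (simp add: real_sqrt_divide real_sqrt_mult)
    then show ?thesis
      using euler_fun_asymptotics[OF that] unfolding E_def theta_const_def by simp
  qed
  have k: "k > 0" by (simp add: k_def)
  have Ek: "(E k h \<longlongrightarrow> of_real (sqrt (pi / 6) / real k) * theta_const k h) (at 0 within sector)"
    by (rule E[OF k zeta_k[OF k_def[THEN meta_eq_to_obj_eq] h zeta_def] gauss_coeff_0[OF k_def[THEN meta_eq_to_obj_eq] h zeta_def]])
  have two: "2 = (2::nat) ^ (0 + 1)" and odd1: "odd (1::nat)" by simp_all
  have E2: "(E 2 1 \<longlongrightarrow> of_real (sqrt (pi / 6) / real 2) * theta_const 2 1) (at 0 within sector)"
    by (rule E[OF _ zeta_k[OF two odd1 zeta_def] gauss_coeff_0[OF two odd1 zeta_def]]) simp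
  have E1: "(E 1 0 \<longlongrightarrow> of_real (sqrt (pi / 6) / real 1) * theta_const 1 0) (at 0 within sector)"
    by (rule E) (use theta_const_one(2) in \<open>simp_all add: zeta_def\<close>)
  have tz: "filterlim (\<lambda>z. of_nat t * z) (at 0 within sector) (at 0 within sector)"
    unfolding filterlim_at
  proof
    show "\<forall>\<^sub>F z in at 0 within sector. of_nat t * z \<in> sector \<and> of_nat t * z \<noteq> (0::complex)"
      using t(1) by (auto simp: eventually_at_filter sector_def abs_mult)
    show "((\<lambda>z::complex. of_nat t * z) \<longlongrightarrow> 0) (at 0 within sector)" by (auto intro!: tendsto_eq_intros)
  qed
  have "((\<lambda>z. (E 2 1 (of_nat t * z) / E 1 0 (of_nat t * z)) ^ t / E k h z) \<longlongrightarrow>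
      (of_real (sqrt (pi / 6) / real 2) * theta_const 2 1 / (of_real (sqrt (pi / 6) / real 1) * theta_const 1 0)) ^ t /
      (of_real (sqrt (pi / 6) / real k) * theta_const k h)) (at 0 within sector)"
    by (intro tendsto_divide tendsto_power Ek filterlim_compose[OF E2 tz] filterlim_compose[OF E1 tz])
       (use theta_const_one theta_const_nonzero[OF h, of s, folded k_def] k in simp_all)
  moreover have "of_real (sqrt (pi / 6) / real 2) * theta_const 2 1 / (of_real (sqrt (pi / 6) / real 1) * theta_const 1 0)
      = theta_const 2 1 / (2 * theta_const 1 0)" by simp
  moreover have "\<forall>\<^sub>F z in at 0 within sector. (E 2 1 (of_nat t * z) / E 1 0 (of_nat t * z)) ^ t / E k h z =
      hook_gf t (zeta k h * exp (- z)) / (csqrt z * exp (of_real (pi\<^sup>2 / 6 * (3 / 4 + 1 / (real k)\<^sup>2)) / z))"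
  proof -
    have "(E 2 1 (of_nat t * z) / E 1 0 (of_nat t * z)) ^ t / E k h z =
      hook_gf t (zeta k h * exp (- z)) / (csqrt z * exp (of_real (pi\<^sup>2 / 6 * (3 / 4 + 1 / (real k)\<^sup>2)) / z))"
      if "z \<in> sector" for z
    proof -
      define w where "w = of_nat t * z"
      define x where "x = of_real (pi\<^sup>2 / 6) / z"
      have "Re w > 0" using that t(1) by (simp add: w_def sector_def)
      then have cw: "csqrt w \<noteq> 0" by auto
      have z2: "zeta 2 1 = -1" using zeta_half[OF two odd1 zeta_def] by simp
      have z1: "zeta 1 0 = 1" by (simp add: zeta_def)
      have zt: "zeta k h ^ t = -1"
        unfolding t(2) power_mult zeta_half[OF k_def[THEN meta_eq_to_obj_eq] h zeta_def] using t(3) by simp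
      have ex: "exp (of_real c / w) ^ t = exp (of_real c / z)" for c
        unfolding w_def exp_of_nat_mult[symmetric] using t(1) by simp
      have "(zeta k h * exp (- z)) ^ t = - exp (- w)"
        unfolding power_mult_distrib zt by (simp add: w_def exp_of_nat_mult[symmetric])
      then have hk: "hook_gf t (zeta k h * exp (- z)) =
          euler_fun (- exp (- w)) ^ t / (euler_fun (zeta k h * exp (- z)) * euler_fun (exp (- w)) ^ t)"
        unfolding hook_gf_def by simp
      have E21: "E 2 1 w / E 1 0 w = euler_fun (- exp (- w)) / euler_fun (exp (- w)) *
          (exp (of_real (pi\<^sup>2 / 24) / w) / exp (of_real (pi\<^sup>2 / 6) / w))"
        using cw by (simp add: E_def z2 z1 del: One_nat_def)
      have "(E 2 1 w / E 1 0 w) ^ t = euler_fun (- exp (- w)) ^ t / euler_fun (exp (- w)) ^ t *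
          (exp (of_real (pi\<^sup>2 / 24) / z) / exp (of_real (pi\<^sup>2 / 6) / z))"
        unfolding E21 power_mult_distrib power_divide ex ..
      then have "(E 2 1 w / E 1 0 w) ^ t / E k h z = hook_gf t (zeta k h * exp (- z)) *
          (exp (of_real (pi\<^sup>2 / 24) / z) / exp (of_real (pi\<^sup>2 / 6) / z)) / (csqrt z * exp (of_real (pi\<^sup>2 / (6 * (real k)\<^sup>2)) / z))"
        unfolding hk E_def by simp
      also have "\<dots> = hook_gf t (zeta k h * exp (- z)) / (csqrt z *
          (exp (of_real (pi\<^sup>2 / 6) / z) * exp (of_real (pi\<^sup>2 / (6 * (real k)\<^sup>2)) / z) / exp (of_real (pi\<^sup>2 / 24) / z)))" by simp
      also have "exp (of_real (pi\<^sup>2 / 6) / z) * exp (of_real (pi\<^sup>2 / (6 * (real k)\<^sup>2)) / z) / exp (of_real (pi\<^sup>2 / 24) / z) =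
          exp (of_real (pi\<^sup>2 / 6 * (3 / 4 + 1 / (real k)\<^sup>2)) / z)"
      proof -
        have "pi\<^sup>2 / 6 * (3 / 4 + 1 / (real k)\<^sup>2) = pi\<^sup>2 / 6 + pi\<^sup>2 / (6 * (real k)\<^sup>2) - pi\<^sup>2 / 24"
          by (simp add: field_simps)
        then show ?thesis by (simp only: of_real_add of_real_diff add_divide_distrib diff_divide_distrib exp_add exp_diff)
      qed
      finally show ?thesis unfolding w_def .
    qed
    then show ?thesis by (auto simp: eventually_at_filter)
  qed
  ultimately show ?thesis by (simp only: filterlim_cong[OF refl refl])
qed

lemma integral_minus_middle:
  fixes f :: "real \<Rightarrow> complex"
  assumes c: "continuous_on {- a..a} f" and ra: "0 \<le> r" "r \<le> a"
    and B: "\<And>x. r \<le> \<bar>x\<bar> \<Longrightarrow> \<bar>x\<bar> \<le> a \<Longrightarrow> norm (f x) \<le> B"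
  shows "norm (integral {- a..a} f - integral {- r..r} f) \<le> 2 * a * B"
proof -
  have i: "f integrable_on {u..v}" if "{u..v} \<subseteq> {- a..a}" for u v
    by (rule integrable_continuous_interval) (rule continuous_on_subset[OF c that])
  have "integral {- a..- r} f + integral {- r..a} f = integral {- a..a} f"
    by (rule Henstock_Kurzweil_Integration.integral_combine) (use ra in \<open>auto intro!: i\<close>)
  moreover have "integral {- r..r} f + integral {r..a} f = integral {- r..a} f"
    by (rule Henstock_Kurzweil_Integration.integral_combine) (use ra in \<open>auto intro!: i\<close>)
  ultimately have "integral {- a..a} f = integral {- a..- r} f + (integral {- r..r} f + integral {r..a} f)" by simp
  then have eq: "integral {- a..a} f - integral {- r..r} f = integral {- a..- r} f + integral {r..a} f" by simp
  have 0: "B \<ge> 0" by (rule order_trans[OF norm_ge_zero B[of a]]) (use ra in auto)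
  have "norm (integral {- a..- r} f) \<le> B * (- r - - a)" "norm (integral {r..a} f) \<le> B * (a - r)"
    by (intro integral_bound continuous_on_subset[OF c] B; use ra in auto)+
  then have "norm (integral {- a..a} f - integral {- r..r} f) \<le> B * (a - r) + B * (a - r)"
    unfolding eq by (intro order_trans[OF norm_triangle_ineq]) simp
  also have "\<dots> \<le> 2 * a * B" using ra 0 by (simp add: algebra_simps)
  finally show ?thesis .
qed

text \<open>Along n + j k the comparison sequence is constant and approximated by reals, hence real.
  Being periodic and nonzero, its modulus is bounded below, so the sign of \<open>x n\<close> is
  eventually forced.\<close>

lemma sgn_eventually_periodic:
  fixes x :: "nat \<Rightarrow> real" and e :: "nat \<Rightarrow> complex"
  assumes k: "k > 0" and lim: "(\<lambda>n. of_real (x n) - e n) \<longlonglongrightarrow> 0"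
    and per: "\<And>n. e (n + k) = e n" and nz: "\<And>n. e n \<noteq> 0"
  shows "Re (e n) \<noteq> 0" "\<forall>\<^sub>F n in sequentially. sgn (x n) = sgn (Re (e n))"
proof -
  have mult: "e (n + j * k) = e n" for n j
    by (induction j) (simp_all add: per add.assoc[symmetric] add.commute[of k])
  have real: "Im (e n) = 0" for n
  proof -
    have "filterlim (\<lambda>j. n + j * k) at_top sequentially"
      by (rule filterlim_subseq) (use k in \<open>auto simp: strict_mono_def\<close>)
    from tendsto_Im[OF filterlim_compose[OF lim this]] show ?thesis
      by (simp add: mult LIMSEQ_const_iff)
  qed
  then have Re: "Re (e n) \<noteq> 0" for n using nz[of n] by (simp add: complex_eq_iff)
  then show "Re (e n) \<noteq> 0" .
  define \<delta> where "\<delta> = Min ((\<lambda>n. \<bar>Re (e n)\<bar>) ` {..<k})"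
  have ne: "(\<lambda>n. \<bar>Re (e n)\<bar>) ` {..<k} \<noteq> {}" using k by auto
  have "\<delta> > 0" unfolding \<delta>_def using ne Re by (subst Min_gr_iff) auto
  have \<delta>: "\<delta> \<le> \<bar>Re (e n)\<bar>" for n
  proof -
    have "e n = e (n mod k)" using mult[of "n mod k" "n div k"] by simp
    then show ?thesis unfolding \<delta>_def using k by (intro Min_le) auto
  qed
  have "\<forall>\<^sub>F n in sequentially. dist (of_real (x n) - e n) 0 < \<delta>" by (rule tendstoD[OF lim \<open>\<delta> > 0\<close>])
  then show "\<forall>\<^sub>F n in sequentially. sgn (x n) = sgn (Re (e n))"
  proof eventually_elim
    case (elim n)
    have "\<bar>x n - Re (e n)\<bar> < \<delta>" using elim abs_Re_le_cmod[of "of_real (x n) - e n"] by simp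
    then show ?case using \<delta>[of n] by (auto simp: sgn_if split: if_splits)
  qed
qed

text \<open>Cauchy's integral is folded onto \<open>k\<close> arcs. The middle parts of the arcs at
  odd \<open>h\<close> are evaluated by \<open>saddle_point\<close>, and everything else is bounded
  by \<open>minor_arc_bound\<close>.\<close>

theorem p_diff_asymptotics:
  fixes t s l :: nat
  assumes t: "t > 0" "t = 2 ^ s * l" "odd l"
  defines "k \<equiv> 2 ^ (s + 1) :: nat"
  defines "A \<equiv> pi\<^sup>2 / 6 * (3 / 4 + 1 / (real k)\<^sup>2)"
  shows "\<exists>C. C \<noteq> 0 \<and> (\<lambda>n. of_real (exp (- (2 * A / sqrt (A / real n))) / (sqrt (A / real n))\<^sup>2 * (2 * pi) * of_int (p_diff t n)) -
    C * (\<Sum>u<2 ^ s. cis (- (2 * pi * real ((2 * u + 1) * n) / real k)) / theta_const k (2 * u + 1))) \<longlonglongrightarrow> 0"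
proof -
  define y where "y = (\<lambda>n. sqrt (A / real n))"
  define P where "P = (\<lambda>n. exp (- (2 * A / y n)) / (y n)\<^sup>2)"
  define H where "H = (\<lambda>h z. hook_gf t (zeta k h * exp (- z)))"
  define g where "g = (\<lambda>n h \<phi>. cis (- (2 * pi * real (h * n) / real k)) *
    H h (Complex (y n) (- \<phi>)) * exp (of_nat n * Complex (y n) (- \<phi>)))"
  define J where "J = (\<lambda>n h. integral {- y n..y n}
    (\<lambda>\<phi>. H h (Complex (y n) (- \<phi>)) * exp (of_nat n * Complex (y n) (- \<phi>))))"
  define C0 where "C0 = (theta_const 2 1 / (2 * theta_const 1 0)) ^ t / of_real (sqrt (pi / 6) / real k)"
  define S where "S = complex_of_real (sqrt (pi / A))"
  have k: "k > 0" "real k > 0" by (simp_all add: k_def)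
  have "(3 / 4 :: real) + 1 / (real k)\<^sup>2 > 0" by (intro add_pos_nonneg) auto
  then have A: "A > 0" by (simp add: A_def)
  have y0: "y n > 0" if "n > 0" for n using A that by (simp add: y_def)
  have ny: "real n * y n = A / y n" if "n > 0" for n
  proof -
    have "(y n)\<^sup>2 = A / real n" using A by (simp add: y_def)
    then have "real n * (y n)\<^sup>2 = A" using that by simp
    then show ?thesis using y0[OF that] by (auto simp: divide_simps power2_eq_square)
  qed
  have ylim: "y \<longlonglongrightarrow> 0" unfolding y_def using A by real_asymp
  obtain \<epsilon> y1 where \<epsilon>: "\<epsilon> > 0" and y1: "y1 > 0"
    and minor: "\<And>y \<theta>. 0 < y \<Longrightarrow> y < y1 \<Longrightarrow> \<bar>\<theta>\<bar> \<le> 7 \<Longrightarrow>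
      (\<And>h::int. odd h \<Longrightarrow> y \<le> \<bar>\<theta> - 2 * pi * of_int h / real k\<bar>) \<Longrightarrow>
      norm (hook_gf t (exp (- Complex y (- \<theta>)))) \<le> exp (pi\<^sup>2 / 6 * (3 / 4 + 1 / (real k)\<^sup>2 - \<epsilon>) / y)"
    using minor_arc_bound[OF t, folded k_def] by blast
  have contH: "continuous_on {z. Re z > 0} (H h)" for h
    unfolding H_def
  proof (rule continuous_on_compose2[OF continuous_on_hook_gf[OF t(1)]])
    show "continuous_on {z. Re z > 0} (\<lambda>z. zeta k h * exp (- z))" by (intro continuous_intros)
    show "(\<lambda>z. zeta k h * exp (- z)) ` {z. Re z > 0} \<subseteq> ball 0 1" by (auto simp: zeta_def norm_mult)
  qed
  have contg: "continuous_on X (g n h)" if "n > 0" for n h X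
  proof -
    have c: "continuous_on X (\<lambda>\<phi>. Complex (y n) (- \<phi>))" unfolding Complex_eq by (intro continuous_intros)
    show ?thesis unfolding g_def
      by (intro continuous_on_mult continuous_on_exp continuous_on_const c continuous_on_compose2[OF contH c])
         (use y0[OF that] in auto)
  qed
  define B where "B = (\<lambda>n. exp (pi\<^sup>2 / 6 * (3 / 4 + 1 / (real k)\<^sup>2 - \<epsilon>) / y n + real n * y n))"
  \<comment> \<open>Radius of the part treated as a major arc; around the roots with even
    \<open>h\<close> there is none.\<close>
  define rad where "rad = (\<lambda>n h::nat. if odd h then y n else 0)"
  have off: "norm (integral {- (pi / real k)..pi / real k} (g n h) - integral {- rad n h..rad n h} (g n h))
      \<le> 2 * (pi / real k) * B n"
    if n: "n > 0" "y n < y1" "y n < pi / real k" and h: "h < k" for n h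
  proof (rule integral_minus_middle[OF contg[OF n(1)]])
    show "0 \<le> rad n h" "rad n h \<le> pi / real k" using y0[OF n(1)] n(3) by (auto simp: rad_def)
    fix \<phi> assume \<phi>: "rad n h \<le> \<bar>\<phi>\<bar>" "\<bar>\<phi>\<bar> \<le> pi / real k"
    define \<theta> where "\<theta> = 2 * pi * real h / real k + \<phi>"
    have arg: "zeta k h * exp (- Complex (y n) (- \<phi>)) = exp (- Complex (y n) (- \<theta>))"
    proof -
      have pol: "exp (- Complex (y n) (- \<psi>)) = of_real (exp (- y n)) * cis \<psi>" for \<psi>
        by (simp add: exp_eq_polar)
      show ?thesis unfolding zeta_def pol unfolding \<theta>_def cis_mult[symmetric] by (simp only: ac_simps)
    qed
    have "norm (H h (Complex (y n) (- \<phi>))) \<le> exp (pi\<^sup>2 / 6 * (3 / 4 + 1 / (real k)\<^sup>2 - \<epsilon>) / y n)"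
      unfolding H_def arg
    proof (rule minor[OF y0[OF n(1)] n(2)])
      have "real h + 1 \<le> real k" using h by simp
      then have "2 * pi * (real h + 1) / real k \<le> 2 * pi * real k / real k"
        by (intro divide_right_mono mult_left_mono) auto
      then have "2 * pi * real h / real k + 2 * (pi / real k) \<le> 2 * pi"
        using k by (simp add: field_simps)
      moreover have "0 \<le> 2 * pi * real h / real k" by simp
      moreover have "pi / real k \<le> pi" using k by (auto simp: field_simps)
      moreover have "pi \<le> 7 / 2" using pi_approx(2) by simp
      moreover have "\<bar>x + \<phi>\<bar> \<le> 7" if "x + 2 * p \<le> 2 * pi" "0 \<le> x" "p \<le> pi" "\<bar>\<phi>\<bar> \<le> p" "pi \<le> 7 / 2" for x p
        using that by linarith
      ultimately show "\<bar>\<theta>\<bar> \<le> 7" using \<phi>(2) unfolding \<theta>_def by blast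
      fix m :: int assume m: "odd m"
      have eq: "\<theta> - 2 * pi * of_int m / real k = 2 * (pi / real k) * of_int (int h - m) + \<phi>"
        unfolding \<theta>_def using k by (simp add: field_simps)
      show "y n \<le> \<bar>\<theta> - 2 * pi * of_int m / real k\<bar>"
      proof (cases "m = int h")
        case True
        then show ?thesis using m \<phi>(1) unfolding eq by (simp add: rad_def)
      next
        case False
        then have "1 \<le> \<bar>real_of_int (int h - m)\<bar>" by linarith
        then have "2 * (pi / real k) * 1 \<le> 2 * (pi / real k) * \<bar>real_of_int (int h - m)\<bar>"
          by (intro mult_left_mono) auto
        also have "\<dots> = \<bar>2 * (pi / real k) * of_int (int h - m)\<bar>" by (simp add: abs_mult)
        finally show ?thesis unfolding eq using \<phi>(2) n(3) by linarith
      qed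
    qed
    then have "norm (H h (Complex (y n) (- \<phi>))) * exp (real n * y n)
        \<le> exp (pi\<^sup>2 / 6 * (3 / 4 + 1 / (real k)\<^sup>2 - \<epsilon>) / y n) * exp (real n * y n)"
      by (rule mult_right_mono) simp
    then show "norm (g n h \<phi>) \<le> B n" by (simp add: g_def B_def norm_mult exp_add)
  qed
  have odds: "(\<Sum>h<k. integral {- rad n h..rad n h} (g n h)) =
      (\<Sum>u<2 ^ s. cis (- (2 * pi * real ((2 * u + 1) * n) / real k)) * J n (2 * u + 1))" for n
  proof -
    have gJ: "integral {- y n..y n} (g n h) = cis (- (2 * pi * real (h * n) / real k)) * J n h" for h
      unfolding g_def J_def mult.assoc by (rule integral_mult_right)
    have "(\<Sum>h<k. integral {- rad n h..rad n h} (g n h)) = (\<Sum>h | h < k \<and> odd h. integral {- y n..y n} (g n h))"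
      by (rule sum.mono_neutral_cong_right) (auto simp: rad_def)
    also have "\<dots> = (\<Sum>u<2 ^ s. integral {- y n..y n} (g n (2 * u + 1)))"
    proof (rule sum.reindex_bij_witness[of _ "\<lambda>u. 2 * u + 1" "\<lambda>h. h div 2"])
      show "h div 2 \<in> {..<2 ^ s}" if "h \<in> {h. h < k \<and> odd h}" for h
        using that by (auto simp: k_def elim!: oddE)
    qed (auto simp: k_def)
    finally show ?thesis unfolding gJ .
  qed
  have total: "(\<Sum>h<k. integral {- (pi / real k)..pi / real k} (g n h)) = of_real (2 * pi * of_int (p_diff t n))" if n: "n > 0" for n
  proof -
    have "(\<Sum>h<k. integral {- (pi / real k)..pi / real k} (g n h)) = integral {- (pi / real k)..pi / real k} (\<lambda>\<phi>. \<Sum>h<k. g n h \<phi>)"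
      by (intro integral_sum[symmetric] integrable_continuous_interval contg[OF n]) simp
    also have "\<dots> = 2 * of_real pi * of_int (p_diff t n)"
      unfolding g_def H_def by (rule p_diff_integral[OF t(1) k(1) y0[OF n]])
    finally show ?thesis by simp
  qed
  have main: "(\<lambda>n. of_real (P n) * J n h) \<longlonglongrightarrow> C0 / theta_const k h * S" if "odd h" for h
  proof -
    have "((\<lambda>z. H h z / (csqrt z * exp (of_real A / z))) \<longlongrightarrow> C0 / theta_const k h) (at 0 within sector)"
      unfolding H_def C0_def divide_divide_eq_left
      by (rule hook_gf_asymptotics[OF t that, folded k_def, folded A_def])
    then show ?thesis unfolding P_def J_def y_def S_def by (rule saddle_point[OF A _ contH])
  qed
  have P0: "P n \<ge> 0" for n by (simp add: P_def)
  \<comment> \<open>The \<epsilon> of the minor arcs leaves exp (- c / y), which beats the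
    normalisation 1 / y^2.\<close>
  have PB: "(\<lambda>n. P n * (2 * pi * B n)) \<longlonglongrightarrow> 0"
  proof -
    define c where "c = pi\<^sup>2 / 6 * \<epsilon>"
    have c: "c > 0" using \<epsilon> by (simp add: c_def)
    have "(\<lambda>n. 2 * pi * (exp (- (c / y n)) / (y n)\<^sup>2)) \<longlonglongrightarrow> 0"
      unfolding y_def using A c by real_asymp
    moreover have "\<forall>\<^sub>F n in sequentially. 2 * pi * (exp (- (c / y n)) / (y n)\<^sup>2) = P n * (2 * pi * B n)"
      using eventually_gt_at_top[of 0]
    proof eventually_elim
      case (elim n)
      have "- (2 * A / y n) + (pi\<^sup>2 / 6 * (3 / 4 + 1 / (real k)\<^sup>2 - \<epsilon>) / y n + real n * y n) = - (c / y n)"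
        unfolding ny[OF elim] c_def A_def by (simp add: right_diff_distrib diff_divide_distrib)
      then have "exp (- (2 * A / y n)) * B n = exp (- (c / y n))"
        unfolding B_def exp_add[symmetric] by simp
      then show ?case unfolding P_def by (simp add: field_simps)
    qed
    ultimately show ?thesis by (rule Lim_transform_eventually)
  qed
  let ?W = "\<lambda>n u. cis (- (2 * pi * real ((2 * u + 1) * n) / real k))"
  have err: "(\<lambda>n. of_real (P n * (2 * pi) * of_int (p_diff t n)) - (\<Sum>u<2 ^ s. ?W n u * (of_real (P n) * J n (2 * u + 1)))) \<longlonglongrightarrow> 0"
  proof (rule Lim_null_comparison[OF _ PB])
    have "\<forall>\<^sub>F n in sequentially. y n < y1" "\<forall>\<^sub>F n in sequentially. y n < pi / real k"
      using y1 k by (auto intro!: order_tendstoD(2)[OF ylim])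
    then show "\<forall>\<^sub>F n in sequentially. norm (of_real (P n * (2 * pi) * of_int (p_diff t n)) -
        (\<Sum>u<2 ^ s. ?W n u * (of_real (P n) * J n (2 * u + 1)))) \<le> P n * (2 * pi * B n)"
      using eventually_gt_at_top[of 0]
    proof eventually_elim
      case (elim n)
      have "of_real (P n * (2 * pi) * of_int (p_diff t n)) - (\<Sum>u<2 ^ s. ?W n u * (of_real (P n) * J n (2 * u + 1)))
          = of_real (P n) * (\<Sum>h<k. integral {- (pi / real k)..pi / real k} (g n h) - integral {- rad n h..rad n h} (g n h))"
        unfolding sum_subtractf odds total[OF elim(3)] by (simp add: sum_distrib_left right_diff_distrib ac_simps)
      also have "norm \<dots> \<le> P n * (\<Sum>h<k. 2 * (pi / real k) * B n)"
        unfolding norm_mult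
      proof (rule mult_mono)
        show "norm (\<Sum>h<k. integral {- (pi / real k)..pi / real k} (g n h) - integral {- rad n h..rad n h} (g n h))
          \<le> (\<Sum>h<k. 2 * (pi / real k) * B n)"
          by (rule sum_norm_le) (rule off, use elim in auto)
      qed (use P0 in \<open>auto simp: sum_nonneg\<close>)
      also have "\<dots> = P n * (2 * pi * B n)" using k by simp
      finally show ?case .
    qed
  qed
  have "(\<lambda>n. \<Sum>u<2 ^ s. ?W n u * (of_real (P n) * J n (2 * u + 1) - C0 / theta_const k (2 * u + 1) * S)) \<longlonglongrightarrow> 0"
  proof (rule tendsto_null_sum, rule Lim_null_comparison)
    fix u
    show "\<forall>\<^sub>F n in sequentially. norm (?W n u * (of_real (P n) * J n (2 * u + 1) - C0 / theta_const k (2 * u + 1) * S))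
      \<le> norm (of_real (P n) * J n (2 * u + 1) - C0 / theta_const k (2 * u + 1) * S)" by (simp add: norm_mult)
    show "(\<lambda>n. norm (of_real (P n) * J n (2 * u + 1) - C0 / theta_const k (2 * u + 1) * S)) \<longlonglongrightarrow> 0"
      using tendsto_norm[OF LIM_zero[OF main[of "2 * u + 1"]]] by simp
  qed
  note diff = this
  have "(\<lambda>n. of_real (P n * (2 * pi) * of_int (p_diff t n)) - (C0 * S) * (\<Sum>u<2 ^ s. ?W n u / theta_const k (2 * u + 1))) \<longlonglongrightarrow> 0"
  proof -
    have W: "(\<Sum>u<2 ^ s. ?W n u * (C0 / theta_const k (2 * u + 1) * S)) = C0 * S * (\<Sum>u<2 ^ s. ?W n u / theta_const k (2 * u + 1))" for n
    proof -
      have "a * (c / d * e) = c * e * (a / d)" for a c d e :: complex by simp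
      then show ?thesis unfolding sum_distrib_left by (intro sum.cong refl)
    qed
    have "X - (\<Sum>u<2 ^ s. ?W n u * (of_real (P n) * J n (2 * u + 1))) +
        (\<Sum>u<2 ^ s. ?W n u * (of_real (P n) * J n (2 * u + 1) - C0 / theta_const k (2 * u + 1) * S)) =
      X - C0 * S * (\<Sum>u<2 ^ s. ?W n u / theta_const k (2 * u + 1))" for X n
      unfolding right_diff_distrib sum_subtractf W by (rule add_diff_eq[THEN trans]) (simp only: diff_add_cancel)
    then show ?thesis using tendsto_add[OF err diff] by (simp only: add_0_right)
  qed
  moreover have "C0 * S \<noteq> 0"
  proof -
    have "theta_const 2 1 \<noteq> 0" using theta_const_nonzero[of 1 0] by simp
    then show ?thesis using A k theta_const_one(1) by (simp add: C0_def S_def)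
  qed
  ultimately show ?thesis unfolding P_def y_def by blast
qed

theorem theorem1p13:
  fixes t s l :: nat
  assumes "t > 1" and "t = 2 ^ s * l" and "odd l"
  shows "(\<exists>N. \<forall>n\<ge>N. sgn (int (p_even t (n + 2 ^ (s + 1))) - int (p_odd t (n + 2 ^ (s + 1)))) =
                     sgn (int (p_even t n) - int (p_odd t n))) \<and>
         (odd t \<longrightarrow>
           (\<exists>N. \<forall>n\<ge>N. int (p_even t n) - int (p_odd t n) \<noteq> 0 \<and>
                     sgn (int (p_even t (n + 1)) - int (p_odd t (n + 1))) =
                       - sgn (int (p_even t n) - int (p_odd t n))))"
proof -
  define k where "k = (2 ^ (s + 1) :: nat)"
  define A where "A = pi\<^sup>2 / 6 * (3 / 4 + 1 / (real k)\<^sup>2)"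
  define P where "P = (\<lambda>n. exp (- (2 * A / sqrt (A / real n))) / (sqrt (A / real n))\<^sup>2 * (2 * pi))"
  define T where "T = (\<lambda>n. \<Sum>u<2 ^ s. cis (- (2 * pi * real ((2 * u + 1) * n) / real k)) / theta_const k (2 * u + 1))"
  have "t > 0" using assms(1) by simp
  from p_diff_asymptotics[OF this assms(2,3), folded k_def, folded A_def]
  obtain C where C: "C \<noteq> 0" "(\<lambda>n. of_real (P n * of_int (p_diff t n)) - C * T n) \<longlonglongrightarrow> 0"
    unfolding P_def T_def by blast
  have k: "k > 0" by (simp add: k_def)
  have "(3 / 4 :: real) + 1 / (real k)\<^sup>2 > 0" by (intro add_pos_nonneg) auto
  then have A: "A > 0" by (simp add: A_def)
  have P: "P n > 0" if "n > 0" for n using A that by (simp add: P_def)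
  have per: "C * T (n + k) = C * T n" for n
  proof -
    have "cis (- (2 * pi * real ((2 * u + 1) * (n + k)) / real k)) = cis (- (2 * pi * real ((2 * u + 1) * n) / real k))" for u
    proof -
      have "- (2 * pi * real ((2 * u + 1) * (n + k)) / real k) =
          - (2 * pi * real ((2 * u + 1) * n) / real k) + 2 * pi * of_int (- int (2 * u + 1))"
        using k by (simp add: field_simps)
      then show ?thesis by (simp only: cis_mult[symmetric] cis_multiple_2pi Ints_of_int mult_1_right)
    qed
    then show ?thesis by (simp add: T_def)
  qed
  have nz: "C * T n \<noteq> 0" for n
    using C(1) twisted_sum_nonzero[of n s] unfolding T_def k_def by simp
  note S = sgn_eventually_periodic[of k, OF k C(2) per nz]
  have sgn: "\<forall>\<^sub>F n in sequentially. real_of_int (sgn (p_diff t n)) = sgn (Re (C * T n))"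
    using S(2) eventually_gt_at_top[of 0]
  proof eventually_elim
    case (elim n)
    have "sgn (P n * of_int (p_diff t n)) = real_of_int (sgn (p_diff t n))"
      using P[OF elim(2)] by (auto simp: sgn_if zero_less_mult_iff)
    then show ?case using elim(1) by simp
  qed
  then obtain N where N: "\<And>n. n \<ge> N \<Longrightarrow> real_of_int (sgn (p_diff t n)) = sgn (Re (C * T n))"
    by (auto simp: eventually_sequentially)
  have "sgn (p_diff t (n + k)) = sgn (p_diff t n)" if "n \<ge> N" for n
    using N[of n] N[of "n + k"] that unfolding per by (simp flip: of_int_eq_iff[where 'a = real])
  moreover have "p_diff t n \<noteq> 0 \<and> sgn (p_diff t (n + 1)) = - sgn (p_diff t n)" if "n \<ge> N" "odd t" for n
  proof -
    \<comment> \<open>For odd \<open>t\<close> only the root -1 is dominant, so the periodic sum has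
      one term and changes sign with \<open>n\<close>.\<close>
    have "s = 0" using that(2) assms(2) by (cases s) auto
    have "T (n + 1) = - T n"
    proof -
      have "- (2 * pi * real ((2 * 0 + 1) * (n + 1)) / 2) = - (2 * pi * real ((2 * 0 + 1) * n) / 2) - pi"
        by (simp add: field_simps)
      then show ?thesis unfolding T_def k_def \<open>s = 0\<close> by (simp add: cis_divide[symmetric])
    qed
    then have "Re (C * T (n + 1)) = - Re (C * T n)" by simp
    then have "real_of_int (sgn (p_diff t (n + 1))) = - real_of_int (sgn (p_diff t n))"
      using N[OF that(1)] N[OF trans_le_add1[OF that(1)], of 1] by (simp only: sgn_minus)
    moreover have "p_diff t n \<noteq> 0" using N[OF that(1)] S(1)[of n] by (auto simp: sgn_0_0)
    ultimately show ?thesis by (metis of_int_eq_iff of_int_minus)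
  qed
  ultimately show ?thesis unfolding p_diff_def k_def by blast
qed

end
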